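(* Let $F$ be a distribution on $[0,\infty)$ with $F(0)=\vec{p}_c$ and let $\theta\in[0,\pi/2]$ with $\theta\neq\pi/4$. Then there exist $\delta=\delta(F,\theta)>0$ and constants $C_1,C_2>0$ (depending on $F,\theta,\delta$) such that for all $r>0$, $${\bf P}[\vec{T}({\bf 0},(r,\theta))\leq\delta r]\leq C_1\exp(-C_2 r).$$
   Context: Directed first passage percolation on ${\bf Z}^2$: i.i.d. non-negative passage times $t(e)$ with distribution $F$ on the nearest-neighbour edges of ${\bf Z}^2$. A northeast (NE) path moves only by steps $(1,0)$ or $(0,1)$. $\vec{T}(u,v)=\inf\sum_{e\in\gamma}t(e)$ over NE paths $\gamma$ from $u$ to $v$; for $u\in{\bf R}^2$, $\vec T({\bf 0},u)=\vec T({\bf 0},u')$ with $u'$ the nearest vertex of ${\bf Z}^2$ (ties broken by a fixed order). Points are in polar coordinates $(r,\theta)\in{\bf R}^+\times[0,\pi/2]$. $\vec{p}_c$ denotes the critical probability of oriented bond percolation on ${\bf Z}^2$ with NE-oriented edges (each NE edge open independently with probability $p$). *)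

theory Defs
  imports "HOL-Probability.Probability"
begin

type_synonym vertex = "int \<times> int"

text \<open>A NE edge is a pair (u, d): d = True is the edge from u to u + (1,0),
  d = False is the edge from u to u + (0,1).\<close>
type_synonym edge = "vertex \<times> bool"

fun ne_step :: "vertex \<Rightarrow> bool \<Rightarrow> vertex" where
  "ne_step (a, b) True = (a + 1, b)"
| "ne_step (a, b) False = (a, b + 1)"

fun path_edges :: "vertex \<Rightarrow> bool list \<Rightarrow> edge list" where
  "path_edges u [] = []"
| "path_edges u (d # ds) = (u, d) # path_edges (ne_step u d) ds"

fun path_end :: "vertex \<Rightarrow> bool list \<Rightarrow> vertex" where
  "path_end u [] = u"
| "path_end u (d # ds) = path_end (ne_step u d) ds"

definition dir_T :: "(edge \<Rightarrow> real) \<Rightarrow> vertex \<Rightarrow> vertex \<Rightarrow> real" where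
  "dir_T t u v = Inf {sum_list (map t (path_edges u ds)) | ds. path_end u ds = v}"

text \<open>Nearest vertex of Z^2 to a point of R^2 (componentwise rounding; ties are
  broken by the fixed rule of rounding half up).\<close>
definition nearest_vertex :: "real \<times> real \<Rightarrow> vertex" where
  "nearest_vertex x = (round (fst x), round (snd x))"

definition polar :: "real \<Rightarrow> real \<Rightarrow> real \<times> real" where
  "polar r \<theta> = (r * cos \<theta>, r * sin \<theta>)"

definition dir_T_pt :: "(edge \<Rightarrow> real) \<Rightarrow> real \<times> real \<Rightarrow> real" where
  "dir_T_pt t x = dir_T t (0, 0) (nearest_vertex x)"

definition perc_measure :: "real \<Rightarrow> (edge \<Rightarrow> bool) measure" where
  "perc_measure p = PiM UNIV (\<lambda>_. measure_pmf (bernoulli_pmf p))"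

definition open_cluster :: "(edge \<Rightarrow> bool) \<Rightarrow> vertex set" where
  "open_cluster \<omega> = {v. \<exists>ds. path_end (0, 0) ds = v \<and> (\<forall>e \<in> set (path_edges (0, 0) ds). \<omega> e)}"

definition perc_prob :: "real \<Rightarrow> real" where
  "perc_prob p = measure (perc_measure p) {\<omega> \<in> space (perc_measure p). infinite (open_cluster \<omega>)}"

definition oriented_pc :: real where
  "oriented_pc = Sup {p \<in> {0..1}. perc_prob p = 0}"

definition fpp_measure :: "real measure \<Rightarrow> (edge \<Rightarrow> real) measure" where
  "fpp_measure F = PiM UNIV (\<lambda>_. F)"

end

theory Submission
  imports Defs
begin

text \<open>
  Call an edge open if \<open>t e \<le> \<eta>\<close>; a path of passage time \<open>\<delta> r\<close> then has at most \<open>\<delta> r / \<eta>\<close> closed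
  edges. Let \<open>Y m\<close> be the displacement after \<open>m\<close> levels of the rightmost open path started from a
  half-line. If \<open>E (Y m) < s m\<close> for a single \<open>m\<close>, then subadditivity and a Chernoff bound over blocks
  of \<open>m\<close> levels, with a union bound over the blocks spoilt by a closed edge, show that paths of slope
  at least \<open>s\<close> with a small fraction of closed edges are exponentially unlikely. This condition is
  continuous in the density of open edges, so it suffices to find such an \<open>m\<close> at \<open>p\<^sub>c\<close> for every
  \<open>s > 1/2\<close>.

  Suppose there is none. Then \<open>Y m / m\<close> converges in probability to some \<open>\<alpha> > 1/2\<close>, so narrow long
  tubes of slope \<open>\<alpha>\<close>, and by reflection \<open>1 - \<alpha>\<close>, are crossed by open paths with probability close
  to \<open>1\<close>. Crossings of tubes of opposite inclination meet and can be glued into crossings of much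
  longer tubes. As a large tube contains two disjoint chains of small ones, the failure probability
  is squared at each change of scale, up to a factor. The initial smallness condition involves
  finitely many edges, so it persists for some \<open>p < p\<^sub>c\<close>, where percolation follows: a contradiction.
\<close>

section \<open>Events and functions determined by finitely many edges\<close>

text \<open>The obstacle is that \<open>F\<close> has mass exactly p_c at 0, so for every \<eta> > 0
  the edges with \<open>t e \<le> \<eta>\<close> may have density above p_c. Only strict
  inequalities about finitely many edges carry over from p_c to such densities, which is why the
  decay is derived from the mean displacement over one block of levels. The half-line makes the
  right edge restartable: at the end of each block the path lies left of some known point, whatever
  happened before, and the next displacement has the same law. A spoilt block costs a bounded push
  and carries no memory. In the renormalisation each scale lowers the slope by
  \<open>3 * W / H\<close>. Multiplying \<open>H\<close> by factors that grow geometrically makes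
  these losses summable, and squaring the failure probability outweighs the growing number of small
  tubes. Squaring alone controls tubes that start in a window growing with the scale. Percolation
  needs a fixed window, so a second estimate follows tubes with a prescribed window, whose failure
  probabilities merely add up.\<close>

definition determined :: "edge set \<Rightarrow> ((edge \<Rightarrow> bool) \<Rightarrow> 'b) \<Rightarrow> bool" where
  "determined S f \<longleftrightarrow> (\<forall>\<omega> \<omega>'. (\<forall>e\<in>S. \<omega> e = \<omega>' e) \<longrightarrow> f \<omega> = f \<omega>')"

abbreviation Pr :: "real \<Rightarrow> ((edge \<Rightarrow> bool) \<Rightarrow> bool) \<Rightarrow> real" where
  "Pr p A \<equiv> measure (perc_measure p) {\<omega>. A \<omega>}"

abbreviation Exp :: "real \<Rightarrow> ((edge \<Rightarrow> bool) \<Rightarrow> real) \<Rightarrow> real" where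
  "Exp p f \<equiv> integral\<^sup>L (perc_measure p) f"

lemma determinedI:
  "(\<And>\<omega> \<omega>'. (\<And>e. e \<in> S \<Longrightarrow> \<omega> e = \<omega>' e) \<Longrightarrow> f \<omega> = f \<omega>') \<Longrightarrow> determined S f"
  unfolding determined_def by blast

lemma determinedD:
  "determined S f \<Longrightarrow> (\<And>e. e \<in> S \<Longrightarrow> \<omega> e = \<omega>' e) \<Longrightarrow> f \<omega> = f \<omega>'"
  unfolding determined_def by blast

lemma determined_mono: "determined S f \<Longrightarrow> S \<subseteq> S' \<Longrightarrow> determined S' f"
  unfolding determined_def by blast

lemma determined_comp: "determined S f \<Longrightarrow> determined S (\<lambda>\<omega>. g (f \<omega>))"
  unfolding determined_def by metis

lemma determined_comp2:
  "determined S f \<Longrightarrow> determined S g \<Longrightarrow> determined S (\<lambda>\<omega>. h (f \<omega>) (g \<omega>))"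
  unfolding determined_def by metis

lemma determined_const: "determined S (\<lambda>_. c)"
  by (simp add: determined_def)

lemma determined_all:
  "(\<And>i. i \<in> I \<Longrightarrow> determined S (A i)) \<Longrightarrow> determined S (\<lambda>\<omega>. \<forall>i\<in>I. A i \<omega>)"
  unfolding determined_def by metis

lemma determined_reindex:
  "determined S f \<Longrightarrow> determined (\<pi> ` S) (\<lambda>\<omega>. f (\<lambda>e. \<omega> (\<pi> e)))"
  by (auto simp: determined_def)

lemma space_perc [simp]: "space (perc_measure p) = UNIV"
  by (simp add: perc_measure_def space_PiM)

lemma sets_perc: "sets (perc_measure p) = sets (PiM UNIV (\<lambda>_. count_space UNIV))"
  unfolding perc_measure_def by (intro sets_PiM_cong) auto

lemma prob_space_perc: "prob_space (perc_measure p)"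
  unfolding perc_measure_def by (intro prob_space_PiM measure_pmf.prob_space_axioms)

lemma measurable_edge_restrict:
  assumes "finite S"
  shows "(\<lambda>\<omega>. restrict \<omega> S) \<in> perc_measure p \<rightarrow>\<^sub>M count_space (PiE S (\<lambda>_. UNIV))"
proof -
  have "(\<lambda>\<omega>. restrict \<omega> S) \<in> PiM UNIV (\<lambda>_. count_space UNIV) \<rightarrow>\<^sub>M PiM S (\<lambda>_. count_space (UNIV::bool set))"
    by (intro measurable_restrict_subset) auto
  moreover have "PiM S (\<lambda>_. count_space (UNIV::bool set)) = count_space (PiE S (\<lambda>_. UNIV))"
    using assms by (intro count_space_PiM_finite) auto
  ultimately show ?thesis
    by (simp add: measurable_cong_sets[OF sets_perc refl])
qed

lemma determined_restrict:
  assumes "determined S f"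
  shows "f \<omega> = f (restrict \<omega> S)"
  by (rule determinedD[OF assms]) auto

text \<open>The restriction to a finite edge set takes values in a finite discrete space, on which
  every function is measurable. Measurability of the percolation events on finitely many edges comes
  from here.\<close>

lemma measurable_determined:
  assumes "finite S" "determined S f" "\<And>\<omega>. f \<omega> \<in> space N"
  shows "f \<in> perc_measure p \<rightarrow>\<^sub>M N"
proof -
  have "f \<in> count_space (PiE S (\<lambda>_. UNIV)) \<rightarrow>\<^sub>M N"
    using assms(3) by (auto intro!: measurable_count_space_eq1[THEN iffD2])
  from measurable_compose[OF measurable_edge_restrict[OF assms(1)] this]
  show ?thesis using determined_restrict[OF assms(2)] by (simp cong: measurable_cong)
qed

lemma sets_determined:
  assumes "finite S" "determined S A"
  shows "{\<omega>. A \<omega>} \<in> sets (perc_measure p)"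
proof -
  have "A \<in> perc_measure p \<rightarrow>\<^sub>M count_space UNIV"
    by (rule measurable_determined[OF assms]) auto
  from measurable_sets[OF this, of "{True}"] show ?thesis
    by (simp add: vimage_def)
qed

lemma finite_range_determined:
  assumes "finite S" "determined S f"
  shows "finite (range f)"
proof -
  have "f \<omega> \<in> f ` (PiE S (\<lambda>_. UNIV))" for \<omega>
    by (rule image_eqI[where x = "restrict \<omega> S"]) (auto intro: determined_restrict[OF assms(2)])
  then have "range f \<subseteq> f ` (PiE S (\<lambda>_. UNIV))" by auto
  moreover have "finite (f ` (PiE S (\<lambda>_. UNIV)))"
    using assms(1) by (intro finite_imageI finite_PiE) auto
  ultimately show ?thesis by (rule finite_subset)
qed

lemma integrable_determined:
  fixes f :: "(edge \<Rightarrow> bool) \<Rightarrow> real"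
  assumes "finite S" "determined S f"
  shows "integrable (perc_measure p) f"
proof -
  interpret prob_space "perc_measure p" by (rule prob_space_perc)
  have f: "f \<in> borel_measurable (perc_measure p)"
    by (rule measurable_determined[OF assms]) auto
  have "bounded (range f)"
    using finite_range_determined[OF assms] by (rule finite_imp_bounded)
  then obtain B where "\<And>\<omega>. \<bar>f \<omega>\<bar> \<le> B" by (auto simp: bounded_iff)
  then show ?thesis by (intro integrable_const_bound[OF _ f]) auto
qed

lemma Exp_indicator:
  assumes "finite S" "determined S A"
  shows "Exp p (\<lambda>\<omega>. of_bool (A \<omega>)) = Pr p A"
proof -
  have "(\<lambda>\<omega>. of_bool (A \<omega>)) = (indicator {\<omega>. A \<omega>} :: _ \<Rightarrow> real)"
    by (auto simp: indicator_def)
  then show ?thesis using sets_determined[OF assms] by simp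
qed

text \<open>The coordinates of a product measure are independent, hence so are the restrictions to
  \<open>S\<close> and \<open>T\<close>, and \<open>f\<close> and \<open>g\<close> are functions of
  these restrictions.\<close>

lemma Exp_prod:
  fixes f g :: "(edge \<Rightarrow> bool) \<Rightarrow> real"
  assumes S: "finite S" "determined S f" and T: "finite T" "determined T g"
    and disj: "S \<inter> T = {}"
  shows "Exp p (\<lambda>\<omega>. f \<omega> * g \<omega>) = Exp p f * Exp p g"
proof -
  interpret prob_space "perc_measure p" by (rule prob_space_perc)
  let ?M = "\<lambda>_::edge. measure_pmf (bernoulli_pmf p)"
  have M: "prob_space (?M e)" for e by (rule measure_pmf.prob_space_axioms)
  have "indep_vars ?M (\<lambda>e \<omega>. \<omega> e) UNIV"
  proof (subst indep_vars_iff_distr_eq_PiM)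
    show "(UNIV::edge set) \<noteq> {}" by simp
    show "random_variable (?M e) (\<lambda>\<omega>. \<omega> e)" for e
      unfolding perc_measure_def by measurable
    have "distr (perc_measure p) (PiM UNIV ?M) (\<lambda>x. \<lambda>i\<in>UNIV. x i) = perc_measure p"
      by (subst restrict_UNIV) (simp add: perc_measure_def)
    also have "\<dots> = PiM UNIV (\<lambda>e. distr (perc_measure p) (?M e) (\<lambda>\<omega>. \<omega> e))"
      unfolding perc_measure_def by (subst distr_PiM_component) (auto intro: M)
    finally show "distr (perc_measure p) (PiM UNIV ?M) (\<lambda>x. \<lambda>i\<in>UNIV. x i)
       = PiM UNIV (\<lambda>e. distr (perc_measure p) (?M e) (\<lambda>\<omega>. \<omega> e))" .
  qed
  from indep_var_restrict[OF this disj]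
  have ind: "indep_var (PiM S ?M) (\<lambda>\<omega>. \<lambda>i\<in>S. \<omega> i) (PiM T ?M) (\<lambda>\<omega>. \<lambda>i\<in>T. \<omega> i)" by auto
  have PiM_count: "sets (PiM U ?M) = sets (count_space (PiE U (\<lambda>_. UNIV)))" if "finite U" for U
  proof -
    have "sets (PiM U ?M) = sets (PiM U (\<lambda>_. count_space UNIV))"
      by (intro sets_PiM_cong) auto
    also have "PiM U (\<lambda>_. count_space (UNIV::bool set)) = count_space (PiE U (\<lambda>_. UNIV))"
      using that by (intro count_space_PiM_finite) auto
    finally show ?thesis .
  qed
  have mf: "h \<in> borel_measurable (PiM U ?M)" if "finite U" for h :: "_ \<Rightarrow> real" and U
    by (subst measurable_cong_sets[OF PiM_count[OF that] refl]) auto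
  have "indep_var borel (f \<circ> (\<lambda>\<omega>. \<lambda>i\<in>S. \<omega> i)) borel (g \<circ> (\<lambda>\<omega>. \<lambda>i\<in>T. \<omega> i))"
    by (rule indep_var_compose[OF ind]) (auto intro: mf S T)
  moreover have "f \<circ> (\<lambda>\<omega>. \<lambda>i\<in>S. \<omega> i) = f" "g \<circ> (\<lambda>\<omega>. \<lambda>i\<in>T. \<omega> i) = g"
    using determined_restrict[OF S(2)] determined_restrict[OF T(2)] by (auto simp: comp_def fun_eq_iff)
  ultimately have "indep_var borel f borel g" by simp
  then show ?thesis
    by (rule indep_var_lebesgue_integral) (auto intro: integrable_determined S T)
qed

lemma Pr_conj:
  assumes S: "finite S" "determined S A" and T: "finite T" "determined T B"
    and disj: "S \<inter> T = {}"
  shows "Pr p (\<lambda>\<omega>. A \<omega> \<and> B \<omega>) = Pr p A * Pr p B"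
proof -
  have "Pr p (\<lambda>\<omega>. A \<omega> \<and> B \<omega>) = Exp p (\<lambda>\<omega>. of_bool (A \<omega> \<and> B \<omega>))"
    by (rule Exp_indicator[symmetric, where S = "S \<union> T"])
      (use S T in \<open>auto intro!: determined_comp2[where h = "(\<and>)"] intro: determined_mono\<close>)
  also have "\<dots> = Exp p (\<lambda>\<omega>. of_bool (A \<omega>) * of_bool (B \<omega>))"
    by (simp add: of_bool_conj)
  also have "\<dots> = Exp p (\<lambda>\<omega>. of_bool (A \<omega>)) * Exp p (\<lambda>\<omega>. of_bool (B \<omega>))"
    using S T disj by (intro Exp_prod[of S _ T]) (auto intro: determined_comp)
  also have "\<dots> = Pr p A * Pr p B"
    using Exp_indicator[OF S] Exp_indicator[OF T] by simp
  finally show ?thesis .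
qed

lemma Pr_mono:
  assumes "finite T" "determined T B" "\<And>\<omega>. A \<omega> \<Longrightarrow> B \<omega>"
  shows "Pr p A \<le> Pr p B"
proof -
  interpret prob_space "perc_measure p" by (rule prob_space_perc)
  show ?thesis by (rule finite_measure_mono) (use assms sets_determined[OF assms(1,2)] in auto)
qed

lemma Pr_not:
  assumes "finite S" "determined S A"
  shows "Pr p (\<lambda>\<omega>. \<not> A \<omega>) = 1 - Pr p A"
proof -
  interpret prob_space "perc_measure p" by (rule prob_space_perc)
  have "{\<omega>. \<not> A \<omega>} = space (perc_measure p) - {\<omega>. A \<omega>}" by auto
  then show ?thesis using prob_compl[OF sets_determined[OF assms]] by simp
qed

lemma Pr_union_le:
  assumes I: "finite I" and S: "\<And>i. i \<in> I \<Longrightarrow> finite (S i)" "\<And>i. i \<in> I \<Longrightarrow> determined (S i) (Q i)"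
    and A: "\<And>\<omega>. A \<omega> \<Longrightarrow> \<exists>i\<in>I. Q i \<omega>"
  shows "Pr p A \<le> (\<Sum>i\<in>I. Pr p (Q i))"
proof -
  interpret prob_space "perc_measure p" by (rule prob_space_perc)
  have "(\<Union>i\<in>I. {\<omega>. Q i \<omega>}) \<in> events"
    using I by (rule sets.finite_UN) (auto intro: sets_determined S)
  then have "Pr p A \<le> measure (perc_measure p) (\<Union>i\<in>I. {\<omega>. Q i \<omega>})"
    using A by (intro finite_measure_mono) auto
  also have "\<dots> \<le> (\<Sum>i\<in>I. Pr p (Q i))"
    using I S by (intro finite_measure_subadditive_finite) (auto intro: sets_determined)
  finally show ?thesis .
qed

section \<open>Invariance of the product measure under relabelling of edges\<close>

lemma distr_perc_reindex:
  assumes "inj \<pi>"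
  shows "distr (perc_measure p) (perc_measure p) (\<lambda>\<omega> e. \<omega> (\<pi> e)) = perc_measure p"
  using distr_PiM_reindex[of UNIV "\<lambda>_. measure_pmf (bernoulli_pmf p)" \<pi> UNIV] assms
    measure_pmf.prob_space_axioms
  unfolding perc_measure_def by (auto simp: restrict_UNIV)

lemma Exp_reindex:
  assumes "inj \<pi>" "finite S" "determined S f"
  shows "Exp p (\<lambda>\<omega>. f (\<lambda>e. \<omega> (\<pi> e))) = Exp p f"
proof -
  have m: "(\<lambda>\<omega> e. \<omega> (\<pi> e)) \<in> perc_measure p \<rightarrow>\<^sub>M perc_measure p"
    unfolding perc_measure_def by (rule measurable_PiM_single') (auto simp: space_PiM)
  have f: "f \<in> borel_measurable (perc_measure p)"
    by (rule measurable_determined[OF assms(2,3)]) auto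
  show ?thesis
    using integral_distr[OF m f] distr_perc_reindex[OF assms(1), of p] by simp
qed

text \<open>With \<open>shift_edge\<close> and \<open>refl_edge\<close> this gives the invariance of
  path events under translations and under reflection in the diagonal.\<close>

lemma Pr_reindex:
  assumes "inj \<pi>" "finite S" "determined S A"
  shows "Pr p (\<lambda>\<omega>. A (\<lambda>e. \<omega> (\<pi> e))) = Pr p A"
proof -
  have "Pr p (\<lambda>\<omega>. A (\<lambda>e. \<omega> (\<pi> e))) = Exp p (\<lambda>\<omega>. of_bool (A (\<lambda>e. \<omega> (\<pi> e))))"
    by (rule Exp_indicator[symmetric, where S = "\<pi> ` S"])
      (use assms in \<open>auto intro: determined_reindex\<close>)
  also have "\<dots> = Exp p (\<lambda>\<omega>. of_bool (A \<omega>))"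
    by (rule Exp_reindex[where f = "\<lambda>\<omega>. of_bool (A \<omega>)"]) (use assms in \<open>auto intro: determined_comp\<close>)
  also have "\<dots> = Pr p A" by (rule Exp_indicator[OF assms(2,3)])
  finally show ?thesis .
qed

text \<open>Needed twice: with the law \<open>F\<close> and \<open>{..\<eta>}\<close> for passage
  times, and with uniform labels and \<open>{..p}\<close> for the coupling of all densities. Both
  sides agree on cylinder sets, where each factor is the probability of a subset of a two-point
  space.\<close>

lemma distr_threshold:
  fixes M :: "real measure"
  assumes M: "prob_space M" and B: "B \<in> sets M"
  shows "distr (PiM UNIV (\<lambda>_. M)) (perc_measure (measure M B)) (\<lambda>t e. t e \<in> B) = perc_measure (measure M B)"
    and "(\<lambda>t e. t e \<in> B) \<in> PiM UNIV (\<lambda>_. M) \<rightarrow>\<^sub>M perc_measure (measure M B)"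
proof -
  interpret prob_space M by fact
  let ?p = "measure M B"
  have mB: "(\<lambda>x. x \<in> B) \<in> M \<rightarrow>\<^sub>M count_space UNIV" using B by measurable
  show m: "(\<lambda>t e. t e \<in> B) \<in> PiM UNIV (\<lambda>_. M) \<rightarrow>\<^sub>M perc_measure (measure M B)"
    unfolding perc_measure_def
  proof (rule measurable_PiM_single', goal_cases)
    case (1 e)
    have "(\<lambda>t. t e) \<in> PiM UNIV (\<lambda>_. M) \<rightarrow>\<^sub>M M" by measurable
    from measurable_compose[OF this mB] show ?case by simp
  qed (auto simp: space_PiM)
  show "distr (PiM UNIV (\<lambda>_. M)) (perc_measure ?p) (\<lambda>t e. t e \<in> B) = perc_measure ?p"
    unfolding perc_measure_def
  proof (rule measure_eqI_PiM_infinite[where M = "\<lambda>_. measure_pmf (bernoulli_pmf ?p)" and I = UNIV], goal_cases)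
    case (3 A J)
    let ?N = "\<lambda>_::edge. measure_pmf (bernoulli_pmf ?p)"
    let ?A = "\<lambda>i. {x \<in> space M. (x \<in> B) \<in> A i}"
    have A: "?A i \<in> sets M" for i using measurable_sets[OF mB, of "A i"] by (simp add: vimage_def Int_def conj_commute)
    have eqA: "emeasure M (?A i) = emeasure (?N i) (A i)" for i
    proof -
      have "emeasure M (?A i) = emeasure (measure_pmf (bernoulli_pmf ?p)) (A i)"
      proof -
        have 1: "?A i = (if True \<in> A i then B else {}) \<union> (if False \<in> A i then space M - B else {})"
        proof (rule set_eqI)
          fix x
          show "x \<in> ?A i \<longleftrightarrow> x \<in> (if True \<in> A i then B else {}) \<union> (if False \<in> A i then space M - B else {})"
            using sets.sets_into_space[OF B] by (cases "x \<in> B") auto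
        qed
        have 2: "A i = (if True \<in> A i then {True} else {}) \<union> (if False \<in> A i then {False} else {})"
          by (auto split: if_splits) (metis (full_types))+
        have s: "{True, False} = UNIV" by auto
        have p: "0 \<le> ?p" "?p \<le> 1" by auto
        have "measure M (?A i) = (if True \<in> A i then ?p else 0) + (if False \<in> A i then 1 - ?p else 0)"
          by (subst 1) (use sets.sets_into_space[OF B] in \<open>auto simp: B prob_compl prob_space Un_absorb1\<close>)
        moreover have "measure (measure_pmf (bernoulli_pmf ?p)) (A i) = (if True \<in> A i then ?p else 0) + (if False \<in> A i then 1 - ?p else 0)"
          using p by (subst 2) (auto simp: s measure_pmf_single insert_commute measure_measure_pmf_finite)
        ultimately show ?thesis
          by (simp add: emeasure_eq_measure measure_pmf.emeasure_eq_measure)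
      qed
      then show ?thesis by simp
    qed
    have "emeasure (distr (PiM UNIV (\<lambda>_. M)) (PiM UNIV ?N) (\<lambda>t e. t e \<in> B)) (prod_emb UNIV ?N J (Pi\<^sub>E J A))
       = emeasure (PiM UNIV (\<lambda>_. M)) ((\<lambda>t e. t e \<in> B) -` (prod_emb UNIV ?N J (Pi\<^sub>E J A)) \<inter> space (PiM UNIV (\<lambda>_. M)))"
      using 3 m unfolding perc_measure_def by (intro emeasure_distr) (auto intro!: sets_PiM_I)
    also have "(\<lambda>t e. t e \<in> B) -` (prod_emb UNIV ?N J (Pi\<^sub>E J A)) \<inter> space (PiM UNIV (\<lambda>_. M))
        = prod_emb UNIV (\<lambda>_. M) J (Pi\<^sub>E J ?A)"
      by (auto simp: prod_emb_def space_PiM PiE_iff)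
    also have "emeasure (PiM UNIV (\<lambda>_. M)) \<dots> = (\<Prod>i\<in>J. emeasure M (?A i))"
      using 3 A M by (intro emeasure_PiM_emb) auto
    also have "\<dots> = (\<Prod>i\<in>J. emeasure (?N i) (A i))"
      by (simp only: eqA)
    also have "\<dots> = emeasure (PiM UNIV ?N) (prod_emb UNIV ?N J (Pi\<^sub>E J A))"
      using 3 by (intro emeasure_PiM_emb[symmetric]) (auto intro: measure_pmf.prob_space_axioms)
    finally show ?case .
  next
    case 4
    have "prob_space (distr (PiM UNIV (\<lambda>_. M)) (perc_measure ?p) (\<lambda>t (e::edge). t e \<in> B))"
      by (rule prob_space.prob_space_distr[OF prob_space_PiM[OF M] m])
    then show ?case unfolding perc_measure_def by (rule prob_space.finite_measure)
  qed auto
qed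

lemma Pr_threshold:
  fixes M :: "real measure"
  assumes M: "prob_space M" and B: "B \<in> sets M" and A: "{\<omega>. A \<omega>} \<in> sets (perc_measure (measure M B))"
  shows "Pr (measure M B) A = measure (PiM UNIV (\<lambda>_. M)) {t \<in> space (PiM UNIV (\<lambda>_. M)). A (\<lambda>e. t e \<in> B)}"
    and "{t \<in> space (PiM UNIV (\<lambda>_. M)). A (\<lambda>e. t e \<in> B)} \<in> sets (PiM UNIV (\<lambda>_. M))"
proof -
  have *: "{t \<in> space (PiM UNIV (\<lambda>_. M)). A (\<lambda>e. t e \<in> B)} = (\<lambda>t e. t e \<in> B) -` {\<omega>. A \<omega>} \<inter> space (PiM UNIV (\<lambda>_. M))"
    by auto
  show "Pr (measure M B) A = measure (PiM UNIV (\<lambda>_. M)) {t \<in> space (PiM UNIV (\<lambda>_. M)). A (\<lambda>e. t e \<in> B)}"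
    unfolding * using measure_distr[OF distr_threshold(2)[OF M B] A] distr_threshold(1)[OF M B] by simp
  show "{t \<in> space (PiM UNIV (\<lambda>_. M)). A (\<lambda>e. t e \<in> B)} \<in> sets (PiM UNIV (\<lambda>_. M))"
    unfolding * using measurable_sets[OF distr_threshold(2)[OF M B] A] .
qed

section \<open>Coupling of all densities by uniform labels\<close>

definition unif :: "real measure" where
  "unif = uniform_measure lborel {0..1}"

lemma prob_space_unif: "prob_space unif"
  unfolding unif_def by (rule prob_space_uniform_measure) auto

lemma measure_unif: "0 \<le> a \<Longrightarrow> a \<le> b \<Longrightarrow> b \<le> 1 \<Longrightarrow> measure unif {a<..b} = b - a"
  "0 \<le> b \<Longrightarrow> b \<le> 1 \<Longrightarrow> measure unif {..b} = b"
proof -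
  show "measure unif {a<..b} = b - a" if "0 \<le> a" "a \<le> b" "b \<le> 1" for a b
  proof -
    have "{0..1} \<inter> {a<..b} = {a<..b}" using that by auto
    then show ?thesis using that unfolding unif_def by (subst measure_uniform_measure) auto
  qed
  show "measure unif {..b} = b" if "0 \<le> b" "b \<le> 1" for b
  proof -
    have "{0..1} \<inter> {..b} = {0..b}" using that by auto
    then show ?thesis using that unfolding unif_def by (subst measure_uniform_measure) auto
  qed
qed

lemma Pr_unif:
  assumes A: "{\<omega>. A \<omega>} \<in> sets (perc_measure x)" and x: "0 \<le> x" "x \<le> 1"
  shows "Pr x A = measure (PiM UNIV (\<lambda>_. unif)) {u \<in> space (PiM UNIV (\<lambda>_. unif)). A (\<lambda>e. u e \<le> x)}"
    and "{u \<in> space (PiM UNIV (\<lambda>_. unif)). A (\<lambda>e. u e \<le> x)} \<in> sets (PiM UNIV (\<lambda>_. unif))"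
proof -
  have B: "{..x} \<in> sets unif" by (simp add: unif_def)
  have [simp]: "measure unif {..x} = x" using x by (rule measure_unif)
  show "Pr x A = measure (PiM UNIV (\<lambda>_. unif)) {u \<in> space (PiM UNIV (\<lambda>_. unif)). A (\<lambda>e. u e \<le> x)}"
    using Pr_threshold(1)[OF prob_space_unif B, of A] A by simp
  show "{u \<in> space (PiM UNIV (\<lambda>_. unif)). A (\<lambda>e. u e \<le> x)} \<in> sets (PiM UNIV (\<lambda>_. unif))"
    using Pr_threshold(2)[OF prob_space_unif B, of A] A by simp
qed

text \<open>With common labels the configurations of densities \<open>p\<close> and \<open>q\<close>
  differ on \<open>S\<close> only if some edge of \<open>S\<close> has its label in
  \<open>{p<..q}\<close>. This continuity in the density moves finite criteria to and from
  \<open>oriented_pc\<close>.\<close>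

lemma Pr_Lipschitz_aux:
  fixes p q :: real
  assumes S: "finite S" "determined S A" and pq: "0 \<le> p" "p \<le> q" "q \<le> 1"
  shows "\<bar>Pr p A - Pr q A\<bar> \<le> card S * (q - p)"
proof -
  let ?U = "PiM UNIV (\<lambda>_::edge. unif)"
  interpret prob_space ?U by (intro prob_space_PiM prob_space_unif)
  have sU: "sets unif = sets borel" by (simp add: unif_def)
  define Ap where "Ap = {u \<in> space ?U. A (\<lambda>e. u e \<le> p)}"
  define Aq where "Aq = {u \<in> space ?U. A (\<lambda>e. u e \<le> q)}"
  define D where "D e = {u \<in> space ?U. u e \<in> {p<..q}}" for e
  have P: "Pr p A = prob Ap" "Ap \<in> events"
    unfolding Ap_def using pq by (auto intro!: Pr_unif sets_determined[OF S])
  have Q: "Pr q A = prob Aq" "Aq \<in> events"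
    unfolding Aq_def using pq by (auto intro!: Pr_unif sets_determined[OF S])
  have D: "D e \<in> events" for e
  proof -
    have "(\<lambda>u. u e) -` {p<..q} \<inter> space ?U \<in> events"
      by (rule measurable_sets[where A = unif]) (auto simp: sU)
    then show ?thesis by (simp add: D_def vimage_def Int_def conj_commute)
  qed
  have DP: "prob (D e) = q - p" for e
  proof -
    have "measure unif {p<..q} = measure (distr ?U unif (\<lambda>u. u e)) {p<..q}"
      by (subst distr_PiM_component) (auto intro: prob_space_unif)
    also have "\<dots> = prob (D e)"
      unfolding D_def by (subst measure_distr) (auto simp: sU Int_def vimage_def conj_commute)
    finally show ?thesis using pq by (simp add: measure_unif)
  qed
  have "prob (\<Union>e\<in>S. D e) \<le> (\<Sum>e\<in>S. prob (D e))"
    using S D by (intro finite_measure_subadditive_finite) auto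
  then have U: "prob (\<Union>e\<in>S. D e) \<le> card S * (q - p)" by (simp add: DP)
  have eq: "A (\<lambda>e. u e \<le> p) = A (\<lambda>e. u e \<le> q)" if "u \<in> space ?U" "u \<notin> (\<Union>e\<in>S. D e)" for u
    using that pq by (intro determinedD[OF S(2)]) (auto simp: D_def)
  have UD: "(\<Union>e\<in>S. D e) \<in> events" using S D by (auto intro: sets.finite_UN)
  have "prob Ap \<le> prob (Aq \<union> (\<Union>e\<in>S. D e))"
    using eq Q UD by (intro finite_measure_mono) (auto simp: Ap_def Aq_def)
  also have "\<dots> \<le> prob Aq + prob (\<Union>e\<in>S. D e)" 
    using Q UD by (intro measure_Un_le)
  finally have 1: "prob Ap \<le> prob Aq + prob (\<Union>e\<in>S. D e)" .
  have "prob Aq \<le> prob (Ap \<union> (\<Union>e\<in>S. D e))"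
    using eq P UD by (intro finite_measure_mono) (auto simp: Ap_def Aq_def)
  also have "\<dots> \<le> prob Ap + prob (\<Union>e\<in>S. D e)" 
    using P UD by (intro measure_Un_le)
  finally have 2: "prob Aq \<le> prob Ap + prob (\<Union>e\<in>S. D e)" .
  show ?thesis using 1 2 U by (simp add: P Q)
qed

lemma Pr_Lipschitz:
  fixes p q :: real
  assumes S: "finite S" "determined S A" and "p \<in> {0..1}" "q \<in> {0..1}"
  shows "\<bar>Pr p A - Pr q A\<bar> \<le> card S * \<bar>q - p\<bar>"
  using Pr_Lipschitz_aux[OF S, of p q] Pr_Lipschitz_aux[OF S, of q p] assms
  by (cases "p \<le> q") (auto simp: abs_minus_commute)

text \<open>In the coupling, edges open at \<open>p\<close> remain open at \<open>q\<close>.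
  Measurability is an assumption rather than a consequence of \<open>determined\<close>, because the
  lemma is meant for the infinite cluster, which depends on infinitely many edges.\<close>

lemma Pr_increasing:
  assumes A: "\<And>p. {\<omega>. A \<omega>} \<in> sets (perc_measure p)"
    and inc: "\<And>\<omega> \<omega>'. (\<And>e. \<omega> e \<Longrightarrow> \<omega>' e) \<Longrightarrow> A \<omega> \<Longrightarrow> A \<omega>'"
    and pq: "0 \<le> p" "p \<le> q" "q \<le> 1"
  shows "Pr p A \<le> Pr q A"
proof -
  let ?U = "PiM UNIV (\<lambda>_::edge. unif)"
  interpret prob_space ?U by (intro prob_space_PiM prob_space_unif)
  have "prob {u \<in> space ?U. A (\<lambda>e. u e \<le> p)} \<le> prob {u \<in> space ?U. A (\<lambda>e. u e \<le> q)}"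
  proof (rule finite_measure_mono)
    show "{u \<in> space ?U. A (\<lambda>e. u e \<le> q)} \<in> events" using pq by (intro Pr_unif A) auto
    have "A (\<lambda>e. u e \<le> q)" if "A (\<lambda>e. u e \<le> p)" for u
      by (rule inc[OF _ that]) (use pq in auto)
    then show "{u \<in> space ?U. A (\<lambda>e. u e \<le> p)} \<subseteq> {u \<in> space ?U. A (\<lambda>e. u e \<le> q)}" by auto
  qed
  then show ?thesis using Pr_unif(1)[OF A] pq by simp
qed

section \<open>North-east paths and the right edge\<close>

text \<open>The index may range over all functions. The condition \<open>P\<close>, free of
  \<open>\<omega>\<close>, confines the path to a finite region; \<open>crossing\<close>,
  \<open>cheap_path\<close> and \<open>reaches\<close> are written as such conjunctions for this
  reason.\<close>

lemma determined_ex: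
  "(\<And>i. P i \<Longrightarrow> determined S (\<lambda>\<omega>. Q i \<omega>)) \<Longrightarrow> determined S (\<lambda>\<omega>. \<exists>i. P i \<and> Q i \<omega>)"
  unfolding determined_def by metis

lemma Exp_mono:
  fixes f g :: "(edge \<Rightarrow> bool) \<Rightarrow> real"
  assumes "finite S" "determined S f" "finite T" "determined T g" "\<And>\<omega>. f \<omega> \<le> g \<omega>"
  shows "Exp p f \<le> Exp p g"
  using assms by (intro integral_mono integrable_determined) auto

lemma Exp_cmult: "Exp p (\<lambda>\<omega>. c * f \<omega>) = c * Exp p f"
  by simp

lemma Exp_const: "Exp p (\<lambda>_. c) = c"
  using prob_space.prob_space[OF prob_space_perc, of p] by simp

text \<open>A path is encoded by its first coordinate as a function of the level \<open>n\<close> =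
  x + y. It steps east exactly when this function increases.\<close>

definition edge_at :: "(int \<Rightarrow> int) \<Rightarrow> int \<Rightarrow> edge" where
  "edge_at f n = ((f n, n - f n), f (n + 1) \<noteq> f n)"

definition nepath :: "int \<Rightarrow> int \<Rightarrow> (int \<Rightarrow> int) \<Rightarrow> bool" where
  "nepath a b f \<longleftrightarrow> (\<forall>n\<in>{a..<b}. f (n + 1) = f n \<or> f (n + 1) = f n + 1)"

definition opath :: "(edge \<Rightarrow> bool) \<Rightarrow> int \<Rightarrow> int \<Rightarrow> (int \<Rightarrow> int) \<Rightarrow> bool" where
  "opath \<omega> a b f \<longleftrightarrow> nepath a b f \<and> (\<forall>n\<in>{a..<b}. \<omega> (edge_at f n))"

text \<open>The level of an edge is that of its tail, so slabs over consecutive level intervals are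
  disjoint and hence independent.\<close>

definition slab :: "int \<Rightarrow> int \<Rightarrow> int \<Rightarrow> int \<Rightarrow> edge set" where
  "slab a b l u = (\<lambda>(n, x, d). ((x, n - x), d)) ` ({a..<b} \<times> {l..u} \<times> UNIV)"

lemma finite_slab [simp]: "finite (slab a b l u)"
  by (simp add: slab_def)

lemma mem_slab: "((x, y), d) \<in> slab a b l u \<longleftrightarrow> x + y \<in> {a..<b} \<and> x \<in> {l..u}"
  by (force simp: slab_def image_iff)

lemma edge_at_slab: "edge_at f n \<in> slab a b l u \<longleftrightarrow> n \<in> {a..<b} \<and> f n \<in> {l..u}"
  by (simp add: edge_at_def mem_slab)

lemma slab_mono: "a' \<le> a \<Longrightarrow> b \<le> b' \<Longrightarrow> l' \<le> l \<Longrightarrow> u \<le> u' \<Longrightarrow> slab a b l u \<subseteq> slab a' b' l' u'"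
  by (auto simp: mem_slab)

lemma slab_disjoint: "b \<le> a' \<Longrightarrow> slab a b l u \<inter> slab a' b' l' u' = {}"
  by (auto simp: mem_slab)

lemma nepath_mono: "nepath a b f \<Longrightarrow> a \<le> a' \<Longrightarrow> b' \<le> b \<Longrightarrow> nepath a' b' f"
  by (auto simp: nepath_def)

lemma opath_mono: "opath \<omega> a b f \<Longrightarrow> a \<le> a' \<Longrightarrow> b' \<le> b \<Longrightarrow> opath \<omega> a' b' f"
  using nepath_mono by (auto simp: opath_def)

lemma nepath_bounds:
  assumes "nepath a b f" "a \<le> n" "n \<le> n'" "n' \<le> b"
  shows "f n \<le> f n' \<and> f n' \<le> f n + (n' - n)"
  using assms(3,4)
proof (induction n' rule: int_ge_induct)
  case (step i)
  then have "f (i + 1) = f i \<or> f (i + 1) = f i + 1"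
    using assms(1,2) by (auto simp: nepath_def)
  then show ?case using step by auto
qed auto

lemma determined_opath:
  assumes "\<And>n. n \<in> {a..<b} \<Longrightarrow> edge_at f n \<in> S"
  shows "determined S (\<lambda>\<omega>. opath \<omega> a b f)"
  using assms unfolding determined_def opath_def by metis

definition closed_count :: "(edge \<Rightarrow> bool) \<Rightarrow> (int \<Rightarrow> int) \<Rightarrow> int \<Rightarrow> int \<Rightarrow> nat" where
  "closed_count \<omega> f a b = card {n \<in> {a..<b}. \<not> \<omega> (edge_at f n)}"

lemma determined_closed_count:
  assumes "\<And>n. n \<in> {a..<b} \<Longrightarrow> edge_at f n \<in> S"
  shows "determined S (\<lambda>\<omega>. closed_count \<omega> f a b)"
proof (rule determinedI)
  fix \<omega> \<omega>' :: "edge \<Rightarrow> bool" assume "\<And>e. e \<in> S \<Longrightarrow> \<omega> e = \<omega>' e"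
  then have "{n \<in> {a..<b}. \<not> \<omega> (edge_at f n)} = {n \<in> {a..<b}. \<not> \<omega>' (edge_at f n)}"
    using assms by blast
  then show "closed_count \<omega> f a b = closed_count \<omega>' f a b" by (simp add: closed_count_def)
qed

lemma finite_closed: "finite {n \<in> {a..<b::int}. Q n}"
  by (rule finite_subset[of _ "{a..<b}"]) auto

lemma closed_count_split:
  assumes "a \<le> b" "b \<le> c"
  shows "closed_count \<omega> f a c = closed_count \<omega> f a b + closed_count \<omega> f b c"
  unfolding closed_count_def
  by (subst card_Un_disjoint[OF finite_closed finite_closed, symmetric])
    (use assms in \<open>auto intro!: arg_cong[where f = card]\<close>)

lemma closed_count_0: "closed_count \<omega> f a b = 0 \<Longrightarrow> nepath a b f \<Longrightarrow> opath \<omega> a b f"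
  unfolding closed_count_def opath_def card_0_eq[OF finite_closed] by blast

section \<open>Crossings from a half-line and the right edge\<close>

definition crossing :: "(edge \<Rightarrow> bool) \<Rightarrow> int \<Rightarrow> int \<Rightarrow> int \<Rightarrow> int \<Rightarrow> bool" where
  "crossing \<omega> a b z y \<longleftrightarrow> (\<exists>f. (nepath a b f \<and> f a \<le> z \<and> y \<le> f b) \<and> opath \<omega> a b f)"

text \<open>The start is unbounded to the left, but steps of size at most 1 keep any path that
  begins at or left of \<open>z\<close> and reaches \<open>y\<close> at level \<open>b\<close>
  inside a finite slab.\<close>

lemma determined_crossing:
  "determined (slab a b (y - (b - a)) (z + (b - a))) (\<lambda>\<omega>. crossing \<omega> a b z y)"
  unfolding crossing_def
proof (intro determined_ex determined_opath)
  fix f n assume f: "nepath a b f \<and> f a \<le> z \<and> y \<le> f b" and n: "n \<in> {a..<b}"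
  then show "edge_at f n \<in> slab a b (y - (b - a)) (z + (b - a))"
    using nepath_bounds[of a b f a n] nepath_bounds[of a b f n b] by (auto simp: edge_at_slab)
qed

definition shift_edge :: "int \<Rightarrow> int \<Rightarrow> edge \<Rightarrow> edge" where
  "shift_edge c z e = ((fst (fst e) + z, snd (fst e) + (c - z)), snd e)"

lemma inj_shift_edge: "inj (shift_edge c z)"
  by (auto simp: inj_def shift_edge_def prod_eq_iff)

lemma edge_at_shift: "shift_edge c z (edge_at (\<lambda>n. f (n + c) - z) n) = edge_at f (n + c)"
  by (simp add: edge_at_def shift_edge_def algebra_simps)

lemma ball_shift: "(\<forall>n\<in>{a..<b::int}. P (n + c)) \<longleftrightarrow> (\<forall>n\<in>{a + c..<b + c}. P n)"
proof -
  have "{a + c..<b + c} = (\<lambda>n. n + c) ` {a..<b}" by simp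
  then show ?thesis by (simp only: ball_simps image_iff Ball_image_comp o_def)
qed

lemma nepath_shift: "nepath a b (\<lambda>n. f (n + c) - z) \<longleftrightarrow> nepath (a + c) (b + c) f"
proof -
  have "nepath a b (\<lambda>n. f (n + c) - z) \<longleftrightarrow> (\<forall>n\<in>{a..<b}. f (n + c + 1) = f (n + c) \<or> f (n + c + 1) = f (n + c) + 1)"
    unfolding nepath_def by (intro ball_cong refl) (auto simp: algebra_simps)
  then show ?thesis unfolding nepath_def ball_shift[where P = "\<lambda>n. f (n + 1) = f n \<or> f (n + 1) = f n + 1"] .
qed

lemma opath_shift:
  "opath (\<lambda>e. \<omega> (shift_edge c z e)) a b (\<lambda>n. f (n + c) - z) \<longleftrightarrow> opath \<omega> (a + c) (b + c) f"
  unfolding opath_def edge_at_shift nepath_shift ball_shift[where P = "\<lambda>n. \<omega> (edge_at f n)"] ..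

lemma crossing_shift:
  "crossing (\<lambda>e. \<omega> (shift_edge c w e)) a b z y \<longleftrightarrow> crossing \<omega> (a + c) (b + c) (z + w) (y + w)"
proof
  assume "crossing (\<lambda>e. \<omega> (shift_edge c w e)) a b z y"
  then obtain f where f: "nepath a b f" "f a \<le> z" "y \<le> f b" "opath (\<lambda>e. \<omega> (shift_edge c w e)) a b f"
    by (auto simp: crossing_def)
  define g where "g n = f (n - c) + w" for n
  have "f = (\<lambda>n. g (n + c) - w)" by (auto simp: g_def)
  then have "opath \<omega> (a + c) (b + c) g" using f(4) opath_shift[of \<omega> c w a b g] by simp
  then show "crossing \<omega> (a + c) (b + c) (z + w) (y + w)"
    using f by (auto simp: crossing_def opath_def g_def intro!: exI[of _ g])
next
  assume "crossing \<omega> (a + c) (b + c) (z + w) (y + w)"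
  then obtain f where f: "f (a + c) \<le> z + w" "y + w \<le> f (b + c)" "opath \<omega> (a + c) (b + c) f"
    by (auto simp: crossing_def)
  then show "crossing (\<lambda>e. \<omega> (shift_edge c w e)) a b z y"
    using opath_shift[of \<omega> c w a b f] unfolding crossing_def
    by (intro exI[of _ "\<lambda>n. f (n + c) - w"]) (auto simp: opath_def)
qed

text \<open>The displacement of the right edge started from the half-line \<open>x \<le> z\<close>, truncated below
  at \<open>0\<close>: this keeps it bounded and finitely determined while preserving subadditivity.\<close>
definition edge_disp :: "(edge \<Rightarrow> bool) \<Rightarrow> int \<Rightarrow> nat \<Rightarrow> int \<Rightarrow> nat" where
  "edge_disp \<omega> a m z = Max {j. j \<le> m \<and> (j = 0 \<or> crossing \<omega> a (a + int m) z (z + int j))}"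

lemma edge_disp_set: "finite {j::nat. j \<le> m \<and> Q j}"
  by (rule finite_subset[of _ "{..m}"]) auto

lemma edge_disp_le: "edge_disp \<omega> a m z \<le> m"
  unfolding edge_disp_def by (subst Max_le_iff) (auto simp: edge_disp_set)

lemma edge_disp_ge: "crossing \<omega> a (a + int m) z (z + int j) \<Longrightarrow> j \<le> m \<Longrightarrow> j \<le> edge_disp \<omega> a m z"
  unfolding edge_disp_def by (rule Max_ge) (auto simp: edge_disp_set)

lemma edge_disp_crossing:
  assumes "0 < edge_disp \<omega> a m z"
  shows "crossing \<omega> a (a + int m) z (z + int (edge_disp \<omega> a m z))"
proof -
  have "edge_disp \<omega> a m z \<in> {j. j \<le> m \<and> (j = 0 \<or> crossing \<omega> a (a + int m) z (z + int j))}"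
    unfolding edge_disp_def by (rule Max_in) (auto simp: edge_disp_set)
  then show ?thesis using assms by auto
qed

text \<open>Allows restarting at every block: only the position relative to \<open>z\<close>
  matters, not where the path begins. If the path ends at or left of \<open>z\<close>, the
  truncation at 0 covers it.\<close>

lemma opath_edge_disp:
  assumes "opath \<omega> a (a + int m) f" "f a \<le> z"
  shows "f (a + int m) \<le> z + int (edge_disp \<omega> a m z)"
proof (cases "f (a + int m) \<le> z")
  case False
  define j where "j = nat (f (a + int m) - z)"
  have "nepath a (a + int m) f" using assms by (simp add: opath_def)
  from nepath_bounds[OF this, of a "a + int m"] have "j \<le> m" using assms by (auto simp: j_def)
  moreover have "crossing \<omega> a (a + int m) z (z + int j)"
    using assms False by (auto simp: crossing_def j_def opath_def)
  ultimately have "j \<le> edge_disp \<omega> a m z" by (intro edge_disp_ge) auto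
  then show ?thesis by (simp add: j_def)
qed auto

lemma determined_edge_disp: 
  "determined (slab a (a + int m) (z - int m) (z + int m)) (\<lambda>\<omega>. edge_disp \<omega> a m z)"
proof (rule determinedI)
  fix \<omega> \<omega>' :: "edge \<Rightarrow> bool"
  assume eq: "\<And>e. e \<in> slab a (a + int m) (z - int m) (z + int m) \<Longrightarrow> \<omega> e = \<omega>' e"
  have "crossing \<omega> a (a + int m) z (z + int j) = crossing \<omega>' a (a + int m) z (z + int j)" for j
    by (rule determinedD[OF determined_crossing]) (auto intro!: eq elim!: subsetD[OF slab_mono, rotated -1])
  then show "edge_disp \<omega> a m z = edge_disp \<omega>' a m z" by (simp add: edge_disp_def)
qed

lemma edge_disp_shift: "edge_disp (\<lambda>e. \<omega> (shift_edge a z e)) 0 m 0 = edge_disp \<omega> a m z"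
  by (simp add: edge_disp_def crossing_shift add.commute)

lemma Exp_edge_disp_shift:
  fixes g :: "nat \<Rightarrow> real"
  shows "Exp p (\<lambda>\<omega>. g (edge_disp \<omega> a m z)) = Exp p (\<lambda>\<omega>. g (edge_disp \<omega> 0 m 0))"
proof -
  have "Exp p (\<lambda>\<omega>. g (edge_disp (\<lambda>e. \<omega> (shift_edge a z e)) 0 m 0)) = Exp p (\<lambda>\<omega>. g (edge_disp \<omega> 0 m 0))"
    by (rule Exp_reindex[OF inj_shift_edge finite_slab determined_comp[OF determined_edge_disp]])
  then show ?thesis by (simp add: edge_disp_shift)
qed

section \<open>Exponential moments over blocks and the Chernoff bound\<close>

text \<open>Sum over all choices of which of \<open>K\<close> consecutive blocks of \<open>m\<close> levels contain a closed
  edge; such a block is charged \<open>exp (- \<mu>)\<close> and moves the right edge by its maximal amount \<open>m\<close>.\<close>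
fun block_sum :: "real \<Rightarrow> real \<Rightarrow> nat \<Rightarrow> nat \<Rightarrow> int \<Rightarrow> int \<Rightarrow> (edge \<Rightarrow> bool) \<Rightarrow> real" where
  "block_sum l \<mu> m 0 a z \<omega> = exp (l * z)"
| "block_sum l \<mu> m (Suc K) a z \<omega> = block_sum l \<mu> m K (a + int m) (z + int (edge_disp \<omega> a m z)) \<omega>
     + exp (- \<mu>) * block_sum l \<mu> m K (a + int m) (z + int m) \<omega>"

lemma block_sum_nonneg: "0 \<le> block_sum l \<mu> m K a z \<omega>"
  by (induction K arbitrary: a z) auto

text \<open>Induction over the blocks maintains that the path is at or left of the current point.
  The summand for the pattern of blocks that the path really spoils dominates the left side. This
  holds for all paths at once, so \<open>2 ^ K\<close> patterns are summed instead of paths.\<close>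

lemma block_sum_ge:
  fixes l \<mu> :: real and f :: "int \<Rightarrow> int"
  assumes "0 \<le> l" "0 \<le> \<mu>" "nepath a (a + int (K * m)) f" "f a \<le> z"
  shows "exp (l * f (a + int (K * m)) - \<mu> * closed_count \<omega> f a (a + int (K * m))) \<le> block_sum l \<mu> m K a z \<omega>"
  using assms(3,4)
proof (induction K arbitrary: a z)
  case 0
  then show ?case using assms(1) by (auto simp: closed_count_def intro: mult_left_mono)
next
  case (Suc K)
  let ?b = "a + int m" and ?c = "a + int (Suc K * m)"
  have c: "?c = ?b + int (K * m)" by (simp add: algebra_simps)
  have ord: "a \<le> ?b" "?b \<le> ?c" by (auto simp: algebra_simps)
  have np1: "nepath a ?b f" by (rule nepath_mono[OF Suc.prems(1)]) (use ord in auto)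
  have np2: "nepath ?b (?b + int (K * m)) f" by (rule nepath_mono[OF Suc.prems(1)]) (use ord c in auto)
  have cc: "closed_count \<omega> f a ?c = closed_count \<omega> f a ?b + closed_count \<omega> f ?b ?c"
    by (rule closed_count_split[OF ord])
  note IH = Suc.IH[OF np2, folded c]
  show ?case
  proof (cases "closed_count \<omega> f a ?b = 0")
    case True
    from opath_edge_disp[OF closed_count_0[OF True np1] Suc.prems(2)]
    have "f ?b \<le> z + int (edge_disp \<omega> a m z)" .
    from IH[OF this] show ?thesis using True cc block_sum_nonneg[of l \<mu> m K ?b "z + int m" \<omega>]
      by (simp add: add_increasing2 del: of_nat_mult)
  next
    case False
    have "f ?b \<le> z + int m" using nepath_bounds[OF np1, of a ?b] Suc.prems(2) by simp
    note 1 = IH[OF this]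
    \<comment> \<open>A block with several closed edges is charged \<open>exp (- \<mu>)\<close>
      once, which is weaker than charging for each of them since
      \<open>0 \<le> \<mu>\<close>.\<close>
    have "exp (l * f ?c - \<mu> * closed_count \<omega> f a ?c) \<le> exp (- \<mu>) * exp (l * f ?c - \<mu> * closed_count \<omega> f ?b ?c)"
    proof -
      have "1 + real (closed_count \<omega> f ?b ?c) \<le> real (closed_count \<omega> f a ?c)" using False cc by linarith
      from mult_left_mono[OF this assms(2)] show ?thesis
        by (simp add: exp_add[symmetric] algebra_simps del: of_nat_mult)
    qed
    also have "\<dots> \<le> exp (- \<mu>) * block_sum l \<mu> m K ?b (z + int m) \<omega>"
      using 1 by (simp del: of_nat_mult)
    also have "\<dots> \<le> block_sum l \<mu> m (Suc K) a z \<omega>"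
      using block_sum_nonneg by simp
    finally show ?thesis .
  qed
qed

lemma determined_block_sum:
  "determined (slab a (a + int (K * m)) (z - int m) (z + int (Suc K * m))) (block_sum l \<mu> m K a z)"
proof (induction K arbitrary: a z)
  case 0
  then show ?case by (auto simp: determined_def)
next
  case (Suc K)
  let ?S = "slab a (a + int (Suc K * m)) (z - int m) (z + int (Suc (Suc K) * m))"
  show ?case
  proof (rule determinedI)
    fix \<omega> \<omega>' :: "edge \<Rightarrow> bool" assume eq: "\<And>e. e \<in> ?S \<Longrightarrow> \<omega> e = \<omega>' e"
    have Km: "0 \<le> int K * int m" by simp
    have sub: "slab a (a + int m) (z - int m) (z + int m) \<subseteq> ?S"
      by (rule slab_mono) (use Km in \<open>auto simp: algebra_simps\<close>)
    have 1: "edge_disp \<omega> a m z = edge_disp \<omega>' a m z"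
      by (rule determinedD[OF determined_mono[OF determined_edge_disp sub]]) (rule eq)
    have 2: "block_sum l \<mu> m K (a + int m) (z + int j) \<omega> = block_sum l \<mu> m K (a + int m) (z + int j) \<omega>'"
      if "j \<le> m" for j
    proof (rule determinedD[OF determined_mono[OF Suc.IH]])
      show "slab (a + int m) (a + int m + int (K * m)) (z + int j - int m) (z + int j + int (Suc K * m)) \<subseteq> ?S"
        by (rule slab_mono) (use that Km in \<open>auto simp: algebra_simps\<close>)
    qed (rule eq)
    show "block_sum l \<mu> m (Suc K) a z \<omega> = block_sum l \<mu> m (Suc K) a z \<omega>'"
      using 1 2[OF edge_disp_le] 2[of m] by simp
  qed
qed

text \<open>Consecutive blocks use disjoint levels, and the start enters only through the factor
  \<open>exp (l * z)\<close>. Each block therefore contributes one factor \<open>\<rho>\<close>: the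
  exponential moment of the displacement for an unspoilt block plus
  \<open>exp (l * real m - \<mu>)\<close> for a spoilt one.\<close>

lemma Exp_block_sum:
  fixes p l \<mu> :: real and m :: nat
  defines "\<rho> \<equiv> Exp p (\<lambda>\<omega>. exp (l * edge_disp \<omega> 0 m 0)) + exp (l * real m - \<mu>)"
  shows "Exp p (block_sum l \<mu> m K a z) = exp (l * z) * \<rho> ^ K"
proof (induction K arbitrary: a z)
  case 0
  then show ?case using Exp_const[of p "exp (l * z)"] by (simp del: Bochner_Integration.lebesgue_integral_const)
next
  case (Suc K)
  let ?Y = "\<lambda>\<omega>. edge_disp \<omega> a m z"
  let ?B = "\<lambda>j. block_sum l \<mu> m K (a + int m) (z + int j)"
  note dY = determined_edge_disp[of a m z]
  have dB: "determined (slab (a + int m) (a + int m + int (K * m)) (z + int j - int m) (z + int j + int (Suc K * m))) (?B j)" for j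
    by (rule determined_block_sum)
  have disj: "slab a (a + int m) (z - int m) (z + int m) \<inter> slab (a + int m) (a + int m + int (K * m)) l' u' = {}" for l' u'
    by (rule slab_disjoint) simp
  have int1: "integrable (perc_measure p) (\<lambda>\<omega>. of_bool (?Y \<omega> = j) * ?B j \<omega>)" for j
    by (rule integrable_determined[where S = "slab a (a + int m) (z - int m) (z + int m) \<union> slab (a + int m) (a + int m + int (K * m)) (z + int j - int m) (z + int j + int (Suc K * m))"])
      (auto intro!: determined_comp2[where h = "\<lambda>y b. of_bool (y = j) * b"] intro: determined_mono[OF dY] determined_mono[OF dB])
  \<comment> \<open>The remaining sum starts at a random point. Splitting by the value of the
    displacement gives products over disjoint edge sets.\<close>
  have split: "?B (?Y \<omega>) \<omega> = (\<Sum>j\<le>m. of_bool (?Y \<omega> = j) * ?B j \<omega>)" for \<omega>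
  proof -
    have "(\<Sum>j\<le>m. of_bool (?Y \<omega> = j) * ?B j \<omega>) = (\<Sum>j\<in>{?Y \<omega>}. of_bool (?Y \<omega> = j) * ?B j \<omega>)"
      by (rule sum.mono_neutral_right) (auto simp: edge_disp_le)
    then show ?thesis by simp
  qed
  have "Exp p (\<lambda>\<omega>. ?B (?Y \<omega>) \<omega>) = (\<Sum>j\<le>m. Exp p (\<lambda>\<omega>. of_bool (?Y \<omega> = j) * ?B j \<omega>))"
    unfolding split by (intro Bochner_Integration.integral_sum int1)
  also have "\<dots> = (\<Sum>j\<le>m. Exp p (\<lambda>\<omega>. of_bool (?Y \<omega> = j)) * Exp p (?B j))"
    by (intro sum.cong refl Exp_prod[OF finite_slab determined_comp[OF dY] finite_slab dB] disj)
  also have "\<dots> = (\<Sum>j\<le>m. Exp p (\<lambda>\<omega>. of_bool (?Y \<omega> = j)) * exp (l * j)) * (exp (l * z) * \<rho> ^ K)"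
    by (simp add: Suc.IH sum_distrib_right sum_distrib_left algebra_simps exp_add)
  also have "(\<Sum>j\<le>m. Exp p (\<lambda>\<omega>. of_bool (?Y \<omega> = j)) * exp (l * j)) = Exp p (\<lambda>\<omega>. \<Sum>j\<le>m. of_bool (?Y \<omega> = j) * exp (l * j))"
    by (subst Bochner_Integration.integral_sum)
      (auto intro!: integrable_determined[OF finite_slab determined_comp[OF dY]])
  also have "(\<lambda>\<omega>. \<Sum>j\<le>m. of_bool (?Y \<omega> = j) * exp (l * j)) = (\<lambda>\<omega>. exp (l * ?Y \<omega>))"
  proof
    fix \<omega>
    have "(\<Sum>j\<le>m. of_bool (?Y \<omega> = j) * exp (l * j)) = (\<Sum>j\<in>{?Y \<omega>}. of_bool (?Y \<omega> = j) * exp (l * j))"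
      by (rule sum.mono_neutral_right) (auto simp: edge_disp_le)
    then show "(\<Sum>j\<le>m. of_bool (?Y \<omega> = j) * exp (l * j)) = exp (l * ?Y \<omega>)" by simp
  qed
  also have "Exp p (\<lambda>\<omega>. exp (l * ?Y \<omega>)) = Exp p (\<lambda>\<omega>. exp (l * edge_disp \<omega> 0 m 0))"
    by (rule Exp_edge_disp_shift[where g = "\<lambda>j. exp (l * j)"])
  finally have 1: "Exp p (\<lambda>\<omega>. ?B (?Y \<omega>) \<omega>) = Exp p (\<lambda>\<omega>. exp (l * edge_disp \<omega> 0 m 0)) * (exp (l * z) * \<rho> ^ K)" .
  have i1: "integrable (perc_measure p) (\<lambda>\<omega>. ?B (?Y \<omega>) \<omega>)"
    unfolding split by (intro Bochner_Integration.integrable_sum int1)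
  have i2: "integrable (perc_measure p) (?B m)"
    by (rule integrable_determined[OF finite_slab dB])
  have "Exp p (block_sum l \<mu> m (Suc K) a z) = Exp p (\<lambda>\<omega>. ?B (?Y \<omega>) \<omega> + exp (- \<mu>) * ?B m \<omega>)"
    by (intro Bochner_Integration.integral_cong) auto
  also have "\<dots> = Exp p (\<lambda>\<omega>. ?B (?Y \<omega>) \<omega>) + exp (- \<mu>) * Exp p (?B m)"
    using i1 i2 by simp
  also have "\<dots> = exp (l * z) * \<rho> ^ Suc K"
    unfolding 1 Suc.IH by (simp add: \<rho>_def algebra_simps exp_add exp_diff exp_minus field_simps)
  finally show ?case .
qed

definition cheap_path :: "(edge \<Rightarrow> bool) \<Rightarrow> nat \<Rightarrow> real \<Rightarrow> real \<Rightarrow> bool" where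
  "cheap_path \<omega> n y k \<longleftrightarrow> (\<exists>f. (nepath 0 (int n) f \<and> f 0 \<le> 0 \<and> y \<le> f (int n)) \<and> real (closed_count \<omega> f 0 (int n)) \<le> k)"

lemma determined_cheap_path:
  assumes "0 \<le> y"
  shows "determined (slab 0 (int n) (- int n) (int n)) (\<lambda>\<omega>. cheap_path \<omega> n y k)"
  unfolding cheap_path_def
proof (intro determined_ex determined_comp[where g = "\<lambda>c. real c \<le> k"] determined_closed_count)
  fix f i assume f: "nepath 0 (int n) f \<and> f 0 \<le> 0 \<and> y \<le> f (int n)" and i: "i \<in> {0..<int n}"
  then have "0 \<le> f (int n)" using assms by auto
  then show "edge_at f i \<in> slab 0 (int n) (- int n) (int n)"
    using f i nepath_bounds[of 0 "int n" f 0 i] nepath_bounds[of 0 "int n" f i "int n"] 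
    by (auto simp: edge_at_slab)
qed

text \<open>To first order in \<open>l\<close> the exponential moment is 1 plus \<open>l\<close>
  times the mean, which is below \<open>1 + l * (s * real m)\<close> and so below its exponential.
  The displacement is at most \<open>m\<close>, which controls the second order;
  \<open>\<mu>\<close> is chosen after \<open>l\<close>.\<close>

lemma exponential_tilt:
  fixes s :: real
  assumes m: "0 < m" and s: "Exp p (\<lambda>\<omega>. edge_disp \<omega> 0 m 0) < s * real m"
  obtains l \<mu> :: real where "0 < l" "0 < \<mu>" "Exp p (\<lambda>\<omega>. exp (l * edge_disp \<omega> 0 m 0)) + exp (l * real m - \<mu>) < exp (l * (s * real m))"
proof -
  let ?Y = "\<lambda>\<omega>. real (edge_disp \<omega> 0 m 0)"
  define g where "g = s * real m - Exp p ?Y"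
  have g: "0 < g" using s by (simp add: g_def)
  \<comment> \<open>The first bound gives \<open>l * real m \<le> 1\<close>, as required for exp x
    \<le> 1 + x + x^2; the second makes the quadratic error at most half of the linear gain
    \<open>l * g\<close>.\<close>
  define l where "l = min (1 / real m) (g / (2 * (real m)\<^sup>2))"
  have l: "0 < l" "l * real m \<le> 1" "l * (real m)\<^sup>2 \<le> g / 2"
    using m g by (auto simp: l_def min_def field_simps power2_eq_square)
  note dY = determined_edge_disp[of 0 m 0]
  have "exp (l * ?Y \<omega>) \<le> 1 + l * ?Y \<omega> + l * (l * (real m)\<^sup>2)" for \<omega>
  proof -
    have Ym: "?Y \<omega> \<le> real m" using edge_disp_le by simp
    have "l * ?Y \<omega> \<le> l * real m" using Ym l by (intro mult_left_mono) auto
    then have "exp (l * ?Y \<omega>) \<le> 1 + l * ?Y \<omega> + (l * ?Y \<omega>)\<^sup>2"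
      using l(1,2) by (intro exp_bound mult_nonneg_nonneg order.trans[OF _ l(2)]) auto
    also have "(l * ?Y \<omega>)\<^sup>2 \<le> (l * real m)\<^sup>2"
      using l Ym by (intro power_mono mult_left_mono) auto
    finally show ?thesis by (simp add: power2_eq_square algebra_simps)
  qed
  then have "Exp p (\<lambda>\<omega>. exp (l * ?Y \<omega>)) \<le> Exp p (\<lambda>\<omega>. 1 + l * ?Y \<omega> + l * (l * (real m)\<^sup>2))"
    by (intro Exp_mono[OF finite_slab determined_comp[OF dY] finite_slab determined_comp[OF dY]])
  also have "\<dots> = 1 + l * Exp p ?Y + l * (l * (real m)\<^sup>2)"
  proof -
    interpret prob_space "perc_measure p" by (rule prob_space_perc)
    have "integrable (perc_measure p) ?Y"
      by (rule integrable_determined[OF finite_slab determined_comp[OF dY]])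
    then show ?thesis using prob_space by simp
  qed
  also have "\<dots> \<le> 1 + l * Exp p ?Y + l * (g / 2)" using l by simp
  also have "\<dots> = 1 + l * (s * real m) - l * g / 2" by (simp add: g_def field_simps)
  also have "\<dots> \<le> exp (l * (s * real m)) - l * g / 2" using exp_ge_add_one_self[of "l * (s * real m)"] by simp
  finally have 1: "Exp p (\<lambda>\<omega>. exp (l * ?Y \<omega>)) \<le> exp (l * (s * real m)) - l * g / 2" .
  \<comment> \<open>Spoilt blocks may use half of the remaining gap
    \<open>l * g / 2\<close>.\<close>
  define \<mu> where "\<mu> = max 1 (l * real m - ln (l * g / 4))"
  have "exp (l * real m - \<mu>) \<le> exp (ln (l * g / 4))" unfolding \<mu>_def by (subst exp_le_cancel_iff) auto
  also have "\<dots> = l * g / 4" using l g by simp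
  also have "\<dots> < l * g / 2" using l g by simp
  finally have "Exp p (\<lambda>\<omega>. exp (l * ?Y \<omega>)) + exp (l * real m - \<mu>) < exp (l * (s * real m))" using 1 by simp
  moreover have "0 < \<mu>" by (simp add: \<mu>_def)
  ultimately show thesis using that l by blast
qed

text \<open>Markov's inequality for \<open>block_sum\<close>. Each block gains
  \<open>\<beta>\<close> in the exponent, and \<open>\<delta>\<close> is so small that the charges
  for the closed edges consume only half of this gain.\<close>

proposition cheap_path_decay:
  assumes m: "0 < m" and s0: "0 \<le> s" and s: "Exp p (\<lambda>\<omega>. edge_disp \<omega> 0 m 0) < s * real m"
  obtains C c \<delta> :: real where "0 < C" "0 < c" "0 < \<delta>"
    "\<And>n. Pr p (\<lambda>\<omega>. cheap_path \<omega> n (s * real n) (\<delta> * real n)) \<le> C * exp (- c * real n)"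
proof -
  obtain l \<mu> :: real where l: "0 < l" "0 < \<mu>"
    and lt: "Exp p (\<lambda>\<omega>. exp (l * edge_disp \<omega> 0 m 0)) + exp (l * real m - \<mu>) < exp (l * (s * real m))"
    using exponential_tilt[OF m s] .
  define \<rho> where "\<rho> = Exp p (\<lambda>\<omega>. exp (l * edge_disp \<omega> 0 m 0)) + exp (l * real m - \<mu>)"
  have rho: "0 < \<rho>" unfolding \<rho>_def by (intro add_nonneg_pos Bochner_Integration.integral_nonneg) auto
  define \<beta> where "\<beta> = l * (s * real m) - ln \<rho>"
  have "ln \<rho> < l * (s * real m)" using lt ln_less_cancel_iff[OF rho, of "exp (l * (s * real m))"] by (simp add: \<rho>_def[symmetric])
  then have \<beta>: "0 < \<beta>" by (simp add: \<beta>_def)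
  define \<delta> where "\<delta> = \<beta> / (2 * real m * \<mu>)"
  define c where "c = \<beta> / (2 * real m)"
  have pos: "0 < c" "0 < \<delta>" using \<beta> m l by (auto simp: c_def \<delta>_def)
  have "Pr p (\<lambda>\<omega>. cheap_path \<omega> n (s * real n) (\<delta> * real n)) \<le> exp (\<beta> + l * real m) * exp (- c * real n)" for n
  proof -
    \<comment> \<open>Only the first \<open>K * m\<close> levels are used; the levels left over cost
      at most \<open>m\<close> in displacement.\<close>
    define K where "K = n div m"
    have K: "K * m \<le> n" "real n \<le> real K * real m + real m"
    proof -
      show "K * m \<le> n" by (simp add: K_def)
      have "n \<le> K * m + m" unfolding K_def using mod_less_divisor[OF m, of n] div_mult_mod_eq[of n m] by linarith
      then show "real n \<le> real K * real m + real m" by (simp flip: of_nat_mult of_nat_add)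
    qed
    \<comment> \<open>The value that \<open>block_sum\<close> must reach if a cheap path
      exists.\<close>
    define t where "t = exp (l * (s * (real K * real m) - real m) - \<mu> * (\<delta> * real n))"
    let ?A = "\<lambda>\<omega>. cheap_path \<omega> n (s * real n) (\<delta> * real n)"
    have dA: "determined (slab 0 (int n) (- int n) (int n)) ?A"
      using s0 by (intro determined_cheap_path) auto
    have "t * of_bool (?A \<omega>) \<le> block_sum l \<mu> m K 0 0 \<omega>" for \<omega>
    proof (cases "?A \<omega>")
      case True
      then obtain f where f: "nepath 0 (int n) f" "f 0 \<le> 0" "s * real n \<le> f (int n)" "closed_count \<omega> f 0 (int n) \<le> \<delta> * real n"
        by (auto simp: cheap_path_def)
      have Kn: "int (K * m) \<le> int n" using K(1) by (simp only: of_nat_le_iff)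
      have np: "nepath 0 (0 + int (K * m)) f" by (rule nepath_mono[OF f(1)]) (use Kn in auto)
      have cc: "closed_count \<omega> f 0 (int (K * m)) \<le> closed_count \<omega> f 0 (int n)"
        using closed_count_split[of 0 "int (K * m)" "int n" \<omega> f] Kn by (simp del: of_nat_mult)
      have "f (int n) \<le> f (int (K * m)) + (int n - int (K * m))"
        using nepath_bounds[OF f(1), of "int (K * m)" "int n"] Kn by (simp del: of_nat_mult)
      then have "f (int n) \<le> f (int (K * m)) + real m" using K(2) by (simp flip: of_nat_mult of_nat_add)
      moreover have "s * (real K * real m) \<le> s * real n"
        using K(1) s0 by (intro mult_left_mono) (simp_all flip: of_nat_mult)
      ultimately have "l * (s * (real K * real m) - real m) \<le> l * f (int (K * m))"
        using f(3) l by (intro mult_left_mono) auto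
      moreover have "\<mu> * closed_count \<omega> f 0 (int (K * m)) \<le> \<mu> * (\<delta> * real n)"
        using f(4) cc l by (intro mult_left_mono) auto
      ultimately have "t \<le> exp (l * f (0 + int (K * m)) - \<mu> * closed_count \<omega> f 0 (0 + int (K * m)))"
        unfolding t_def by (subst exp_le_cancel_iff) (simp del: of_nat_mult)
      also have "\<dots> \<le> block_sum l \<mu> m K 0 0 \<omega>"
        using l f(2) by (intro block_sum_ge np) auto
      finally show ?thesis using True by simp
    qed (auto simp: block_sum_nonneg)
    then have "Exp p (\<lambda>\<omega>. t * of_bool (?A \<omega>)) \<le> Exp p (block_sum l \<mu> m K 0 0)"
      by (intro Exp_mono[OF finite_slab determined_comp[OF dA] finite_slab determined_block_sum])
    then have "t * Pr p ?A \<le> \<rho> ^ K"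
      unfolding Exp_block_sum Exp_cmult Exp_indicator[OF finite_slab dA] by (simp add: \<rho>_def)
    then have "Pr p ?A \<le> \<rho> ^ K / t" by (simp add: t_def field_simps)
    also have "\<rho> ^ K = exp (real K * ln \<rho>)" using rho by (simp add: exp_of_nat_mult)
    also have "\<dots> / t = exp (real K * ln \<rho> - (l * (s * (real K * real m) - real m) - \<mu> * (\<delta> * real n)))"
      by (simp add: t_def exp_diff)
    also have "real K * ln \<rho> - (l * (s * (real K * real m) - real m) - \<mu> * (\<delta> * real n))
        = - \<beta> * real K + l * real m + c * real n"
      using l m by (simp add: \<beta>_def \<delta>_def c_def field_simps)
    also have "\<dots> \<le> \<beta> + l * real m + - c * real n"
    proof -
      have "\<beta> / real m * real n \<le> \<beta> / real m * (real K * real m + real m)"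
        using K(2) \<beta> m by (intro mult_left_mono) auto
      also have "\<dots> = \<beta> * real K + \<beta>" using m by (simp add: field_simps)
      finally have "2 * c * real n \<le> \<beta> * real K + \<beta>" by (simp add: c_def)
      then show ?thesis by simp
    qed
    finally show ?thesis by (simp add: exp_add[symmetric])
  qed
  then show thesis using that[of "exp (\<beta> + l * real m)" c \<delta>] pos by auto
qed

section \<open>Tubes and lanes\<close>

text \<open>\<open>s\<close> is the excess over the diagonal slope 1/2, so that reflection merely
  changes its sign.\<close>

definition tube :: "(edge \<Rightarrow> bool) \<Rightarrow> real \<Rightarrow> int \<Rightarrow> int \<Rightarrow> int \<Rightarrow> int \<Rightarrow> (int \<Rightarrow> int) \<Rightarrow> bool" where
  "tube \<omega> s W L x n0 f \<longleftrightarrow> opath \<omega> n0 (n0 + L) f \<and>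
     (\<forall>n\<in>{n0..n0 + L}. \<bar>real_of_int (f n) - x - (1/2 + s) * (n - n0)\<bar> \<le> W)"

definition has_tube :: "(edge \<Rightarrow> bool) \<Rightarrow> real \<Rightarrow> int \<Rightarrow> int \<Rightarrow> int \<Rightarrow> int \<Rightarrow> bool" where
  "has_tube \<omega> s W L x n0 \<longleftrightarrow> (\<exists>f. tube \<omega> s W L x n0 f)"

text \<open>The axis may start at a real point \<open>X\<close>, which lets the region of a whole
  lane be described in the same way.\<close>

definition tube_edges :: "real \<Rightarrow> real \<Rightarrow> int \<Rightarrow> real \<Rightarrow> int \<Rightarrow> edge set" where
  "tube_edges s W L X n0 = {((x, y), d). x + y \<in> {n0..<n0 + L} \<and>
     \<bar>real_of_int x - X - (1/2 + s) * (real_of_int (x + y) - n0)\<bar> \<le> W}"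

lemma finite_tube_edges: "finite (tube_edges s W L X n0)"
proof -
  let ?c = "\<lambda>n. X + (1/2 + s) * (real_of_int n - n0)"
  have "tube_edges s W L X n0 \<subseteq> (\<Union>n\<in>{n0..<n0 + L}. slab n (n + 1) (\<lfloor>?c n - W\<rfloor>) (\<lceil>?c n + W\<rceil>))"
  proof (safe)
    fix x y d assume "((x, y), d) \<in> tube_edges s W L X n0"
    then have h: "x + y \<in> {n0..<n0 + L}" "\<bar>real_of_int x - ?c (x + y)\<bar> \<le> W"
      by (auto simp: tube_edges_def algebra_simps)
    have "\<lfloor>?c (x + y) - W\<rfloor> \<le> x" "x \<le> \<lceil>?c (x + y) + W\<rceil>" using h(2) by linarith+
    with h(1) show "((x, y), d) \<in> (\<Union>n\<in>{n0..<n0 + L}. slab n (n + 1) (\<lfloor>?c n - W\<rfloor>) (\<lceil>?c n + W\<rceil>))"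
      by (intro UN_I[of "x + y"]) (auto simp: mem_slab)
  qed
  then show ?thesis by (rule finite_subset) auto
qed

lemma determined_has_tube: "determined (tube_edges s W L x n0) (\<lambda>\<omega>. has_tube \<omega> s W L x n0)"
proof -
  have "determined (tube_edges s W L x n0) (\<lambda>\<omega>. \<exists>f. (\<forall>n\<in>{n0..n0 + L}. \<bar>real_of_int (f n) - x - (1/2 + s) * (n - n0)\<bar> \<le> W) \<and> opath \<omega> n0 (n0 + L) f)"
    by (intro determined_ex determined_opath) (auto simp: edge_at_def tube_edges_def)
  then show ?thesis by (simp add: has_tube_def tube_def conj_commute)
qed

lemma has_tube_shift:
  "has_tube (\<lambda>e. \<omega> (shift_edge n0 x e)) s W L 0 0 \<longleftrightarrow> has_tube \<omega> s W L x n0"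
proof
  assume "has_tube (\<lambda>e. \<omega> (shift_edge n0 x e)) s W L 0 0"
  then obtain f where f: "opath (\<lambda>e. \<omega> (shift_edge n0 x e)) 0 L f"
      "\<And>n. n \<in> {0..L} \<Longrightarrow> \<bar>real_of_int (f n) - (1/2 + s) * n\<bar> \<le> W"
    by (auto simp: has_tube_def tube_def)
  define g where "g n = f (n - n0) + x" for n
  have fg: "f = (\<lambda>n. g (n + n0) - x)" by (auto simp: g_def)
  have "opath \<omega> (0 + n0) (L + n0) g" using f(1) unfolding fg opath_shift .
  moreover have "\<bar>real_of_int (g n) - x - (1/2 + s) * (n - n0)\<bar> \<le> W" if "n \<in> {n0..n0 + L}" for n
    using f(2)[of "n - n0"] that by (simp add: g_def algebra_simps)
  ultimately show "has_tube \<omega> s W L x n0"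
    unfolding has_tube_def tube_def by (intro exI[of _ g]) (auto simp: add.commute)
next
  assume "has_tube \<omega> s W L x n0"
  then obtain g where g: "opath \<omega> n0 (n0 + L) g"
      "\<And>n. n \<in> {n0..n0 + L} \<Longrightarrow> \<bar>real_of_int (g n) - x - (1/2 + s) * (n - n0)\<bar> \<le> W"
    by (auto simp: has_tube_def tube_def)
  have "opath (\<lambda>e. \<omega> (shift_edge n0 x e)) 0 L (\<lambda>n. g (n + n0) - x)"
    using g(1) unfolding opath_shift by (simp add: add.commute)
  moreover have "\<bar>real_of_int (g (n + n0) - x) - (1/2 + s) * n\<bar> \<le> W" if "n \<in> {0..L}" for n
    using g(2)[of "n + n0"] that by simp
  ultimately show "has_tube (\<lambda>e. \<omega> (shift_edge n0 x e)) s W L 0 0"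
    unfolding has_tube_def tube_def by (intro exI[of _ "\<lambda>n. g (n + n0) - x"]) auto
qed

section \<open>Reflection in the diagonal\<close>

definition refl_edge :: "edge \<Rightarrow> edge" where
  "refl_edge e = ((snd (fst e), fst (fst e)), \<not> snd e)"

lemma refl_refl_edge [simp]: "refl_edge (refl_edge e) = e"
  by (simp add: refl_edge_def)

lemma inj_refl_edge: "inj refl_edge"
  by (metis injI refl_refl_edge)

lemma opath_refl:
  assumes "opath \<omega> a b f"
  shows "opath (\<lambda>e. \<omega> (refl_edge e)) a b (\<lambda>n. n - f n)"
proof -
  have "refl_edge (edge_at (\<lambda>n. n - f n) n) = edge_at f n" if "f (n + 1) = f n \<or> f (n + 1) = f n + 1" for n
    using that by (auto simp: edge_at_def refl_edge_def)
  moreover have "nepath a b (\<lambda>n. n - f n)" using assms by (auto simp: opath_def nepath_def)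
  ultimately show ?thesis using assms by (auto simp: opath_def nepath_def)
qed

lemma has_tube_refl_imp:
  assumes "has_tube \<omega> s W L 0 0"
  shows "has_tube (\<lambda>e. \<omega> (refl_edge e)) (- s) W L 0 0"
proof -
  obtain f where f: "opath \<omega> 0 L f" "\<And>n. n \<in> {0..L} \<Longrightarrow> \<bar>real_of_int (f n) - (1/2 + s) * n\<bar> \<le> W"
    using assms by (auto simp: has_tube_def tube_def)
  have "\<bar>real_of_int (n - f n) - (1/2 - s) * n\<bar> \<le> W" if "n \<in> {0..L}" for n
    using f(2)[OF that] by (auto simp: abs_le_iff algebra_simps)
  then show ?thesis
    using opath_refl[OF f(1)] unfolding has_tube_def tube_def by (intro exI[of _ "\<lambda>n. n - f n"]) auto
qed

lemma has_tube_refl: "has_tube (\<lambda>e. \<omega> (refl_edge e)) (- s) W L 0 0 \<longleftrightarrow> has_tube \<omega> s W L 0 0"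
  using has_tube_refl_imp[of \<omega> s] has_tube_refl_imp[of "\<lambda>e. \<omega> (refl_edge e)" "- s"] by auto

abbreviation tube_fail :: "real \<Rightarrow> real \<Rightarrow> int \<Rightarrow> int \<Rightarrow> real" where
  "tube_fail p s W L \<equiv> Pr p (\<lambda>\<omega>. \<not> has_tube \<omega> s W L 0 0)"

lemma determined_not_tube: "determined (tube_edges s W L x n0) (\<lambda>\<omega>. \<not> has_tube \<omega> s W L x n0)"
  by (rule determined_comp[OF determined_has_tube])

text \<open>Translations and the reflection preserve the measure, so one number controls tubes of
  either inclination in any position.\<close>

lemma Pr_tube:
  shows "Pr p (\<lambda>\<omega>. \<not> has_tube \<omega> s W L x n0) = tube_fail p s W L"
    and "Pr p (\<lambda>\<omega>. \<not> has_tube \<omega> (- s) W L x n0) = tube_fail p s W L"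
proof -
  show *: "Pr p (\<lambda>\<omega>. \<not> has_tube \<omega> s W L x n0) = tube_fail p s W L" for s
    using Pr_reindex[OF inj_shift_edge[of n0 x] finite_tube_edges determined_not_tube[of s W L 0 0], of p]
    by (simp add: has_tube_shift)
  show "Pr p (\<lambda>\<omega>. \<not> has_tube \<omega> (- s) W L x n0) = tube_fail p s W L"
    using Pr_reindex[OF inj_refl_edge finite_tube_edges determined_not_tube[of "- s" W L 0 0], of p]
    by (simp add: has_tube_refl *)
qed

section \<open>Meeting and gluing of paths\<close>

lemma discrete_ivt:
  fixes f g :: "int \<Rightarrow> int"
  assumes "nepath a b f" "nepath a b g" "a \<le> b" "f a \<le> g a" "g b \<le> f b"
  shows "\<exists>n\<in>{a..b}. f n = g n"
proof -
  \<comment> \<open>Each path moves by 0 or 1 per level, so the difference cannot pass from negative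
    to positive without vanishing.\<close>
  have "f c \<le> g c \<or> (\<exists>n\<in>{a..c}. f n = g n)" if "a \<le> c" "c \<le> b" for c
    using that
  proof (induction c rule: int_ge_induct)
    case (step i)
    show ?case
    proof (cases "\<exists>n\<in>{a..i}. f n = g n")
      case True
      then show ?thesis by fastforce
    next
      case False
      then have "f i < g i" using step by fastforce
      moreover have "f (i + 1) \<le> f i + 1" "g i \<le> g (i + 1)"
        using nepath_bounds[OF assms(1), of i "i + 1"] nepath_bounds[OF assms(2), of i "i + 1"] step by auto
      ultimately show ?thesis by auto
    qed
  qed (use assms in auto)
  from this[of b] consider "f b \<le> g b" | "\<exists>n\<in>{a..b}. f n = g n" using assms(3) by blast
  then show ?thesis
  proof cases
    case 1
    then show ?thesis using assms(3,5) by (intro bexI[of _ b]) auto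
  qed
qed

lemma opath_concat:
  assumes "opath \<omega> a b f" "opath \<omega> b c g" "f b = g b"
  shows "opath \<omega> a c (\<lambda>n. if n \<le> b then f n else g n)"
proof -
  let ?h = "\<lambda>n. if n \<le> b then f n else g n"
  \<comment> \<open>At level \<open>b - 1\<close> the head of the edge is \<open>f b = g b\<close>,
    so the edge is still that of \<open>f\<close>; from level \<open>b\<close> on it is that of
    \<open>g\<close>.\<close>
  have eq: "edge_at ?h n = (if n < b then edge_at f n else edge_at g n)" for n
    using assms(3) by (auto simp: edge_at_def)
  have "(?h (n + 1) = ?h n \<or> ?h (n + 1) = ?h n + 1) \<and> \<omega> (edge_at ?h n)" if "n \<in> {a..<c}" for n
  proof (cases "n < b")
    case True
    then show ?thesis unfolding eq using assms(1) that by (auto simp: opath_def nepath_def)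
  next
    case False
    then have "?h n = g n" using assms(3) by auto
    then show ?thesis unfolding eq using assms(2) that False by (auto simp: opath_def nepath_def)
  qed
  then show ?thesis unfolding opath_def nepath_def by blast
qed

text \<open>On the window \<open>[a, b]\<close> the path \<open>g\<close> crosses from the right of \<open>f\<^sub>1\<close> to the left of \<open>f\<^sub>2 \<le> f\<^sub>1\<close>;
  it must meet \<open>f\<^sub>1\<close> no later than \<open>f\<^sub>2\<close>, so one can switch from \<open>f\<^sub>1\<close> via \<open>g\<close> to \<open>f\<^sub>2\<close>.\<close>
lemma glue:
  assumes f1: "opath \<omega> c b f1" and f2: "opath \<omega> a d f2" and g: "opath \<omega> a b g"
    and ord: "c \<le> a" "a \<le> b" "b \<le> d"
    and le: "\<And>n. n \<in> {a..b} \<Longrightarrow> f2 n \<le> f1 n" and start: "f1 a \<le> g a" and finish: "g b \<le> f2 b"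
  shows "\<exists>h. opath \<omega> c d h \<and> (\<forall>n\<in>{c..a}. h n = f1 n) \<and> (\<forall>n\<in>{b..d}. h n = f2 n) \<and>
           (\<forall>n\<in>{a..b}. h n \<in> {f1 n, g n, f2 n})"
proof -
  have np: "nepath a b f1" "nepath a b f2" "nepath a b g"
    using opath_mono[OF f1, of a b] opath_mono[OF f2, of a b] g ord by (auto simp: opath_def)
  obtain t2 where t2: "t2 \<in> {a..b}" "f2 t2 = g t2"
    using discrete_ivt[OF np(2,3)] ord le[of a] start finish by auto
  have "\<exists>n\<in>{a..t2}. f1 n = g n"
    by (rule discrete_ivt) (use np t2 le[OF t2(1)] start in \<open>auto intro: nepath_mono\<close>)
  then obtain t1 where t1: "t1 \<in> {a..t2}" "f1 t1 = g t1" by auto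
  define k where "k = (\<lambda>n. if n \<le> t1 then f1 n else g n)"
  define h where "h = (\<lambda>n. if n \<le> t2 then k n else f2 n)"
  have "opath \<omega> c t2 k" unfolding k_def
    by (rule opath_concat) (use t1 t2 in \<open>auto intro: opath_mono[OF f1] opath_mono[OF g]\<close>)
  then have "opath \<omega> c d h" unfolding h_def
    by (rule opath_concat) (use t1 t2 in \<open>auto intro: opath_mono[OF f2] simp: k_def\<close>)
  moreover have "h n = f2 n" if "n \<in> {b..d}" for n
  proof (cases "n \<le> t2")
    case True
    then have "n = t2" using t2 that by auto
    then show ?thesis using t1 t2 by (auto simp: h_def k_def)
  qed (simp add: h_def)
  ultimately show ?thesis using t1 t2 by (intro exI[of _ h]) (auto simp: h_def k_def)
qed

text \<open>A lane consists of right-leaning tubes of length \<open>2 * H\<close> started at the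
  levels \<open>i * H\<close>, consecutive ones overlapping in \<open>H\<close> levels, and
  left-leaning tubes linking them. Each tube is placed about \<open>3 * W\<close> left of the axis
  of its predecessor: two half-widths and one more \<open>W\<close> for rounding. This lowers the
  slope of the lane by \<open>3 * W / H\<close>. The bound \<open>4 * W \<le> s * H\<close> lets a
  link get across the next tube within \<open>H\<close> levels.\<close>

locale lane_geometry =
  fixes s s' :: real and W H :: int and X :: real
  assumes H: "0 < H" and W: "1 \<le> W" and sW: "4 * real_of_int W \<le> s * H" and s: "s \<le> 1/2"
    and s': "s' = s - 3 * real_of_int W / H"
begin

definition base :: "nat \<Rightarrow> int" where
  "base i = \<lfloor>X + (1/2 + s') * (real i * H)\<rfloor>"

lemma base_bounds: "base i \<le> X + (1/2 + s') * (real i * H)" "X + (1/2 + s') * (real i * H) \<le> base i + 1"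
  unfolding base_def by linarith+

lemma slope_diff:
  assumes "0 \<le> u" "u \<le> 2 * real_of_int H"
  shows "s' * u \<le> s * u" "s * u \<le> s' * u + 6 * W" "0 \<le> s * u" "s * u \<le> H"
proof -
  have Hr: "0 < real_of_int H" using H by simp
  have Wr: "1 \<le> real_of_int W" using W by simp
  have spos: "0 < s * H" using sW Wr by linarith
  then have "0 < s" using Hr by (simp add: zero_less_mult_iff)
  have "3 * real_of_int W / H * u \<le> 3 * real_of_int W / H * (2 * real_of_int H)"
    using assms Hr Wr by (intro mult_left_mono) auto
  also have "\<dots> = 6 * W" using Hr by simp
  finally have 1: "3 * real_of_int W / H * u \<le> 6 * W" .
  have 2: "0 \<le> 3 * real_of_int W / H * u" using assms Hr Wr by auto
  have eq: "s' * u = s * u - 3 * real_of_int W / H * u" by (simp add: s' algebra_simps)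
  show "s' * u \<le> s * u" "s * u \<le> s' * u + 6 * W" using 1 2 eq by linarith+
  show "0 \<le> s * u" using \<open>0 < s\<close> assms by simp
  have "s * u \<le> 1/2 * (2 * real_of_int H)" using \<open>0 < s\<close> assms s by (intro mult_mono) auto
  then show "s * u \<le> H" by simp
qed

lemma base_step: 
  "base (Suc i) \<le> base i + (1/2 + s) * H - 3 * W + 1" "base i + (1/2 + s) * H - 3 * W - 1 \<le> base (Suc i)"
proof -
  have "s' * H = s * H - 3 * W" using H by (simp add: s' field_simps)
  then have "X + (1/2 + s') * (real (Suc i) * H) = X + (1/2 + s') * (real i * H) + ((1/2 + s) * H - 3 * W)"
    by (simp add: algebra_simps)
  then show "base (Suc i) \<le> base i + (1/2 + s) * H - 3 * W + 1" "base i + (1/2 + s) * H - 3 * W - 1 \<le> base (Suc i)"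
    using base_bounds[of i] base_bounds[of "Suc i"] by linarith+
qed

text \<open>A left-leaning tube drifts from the axis by at most
  \<open>s * u + s' * u \<le> 2 * H\<close> (with \<open>u\<close> as in the proof), and the
  offsets, at most \<open>8 * W \<le> H\<close>, fit into the rest. Hence lanes with axes
  \<open>12 * H\<close> apart use disjoint edges.\<close>

lemma near_axis:
  fixes x n :: real
  assumes n: "real i * H \<le> n" "n \<le> real i * H + 2 * real_of_int H"
    and "\<bar>x - base i - (1/2 + s) * (n - real i * H)\<bar> \<le> W \<or>
         \<bar>x - (base i + 6 * W) - (1/2 - s) * (n - real i * H)\<bar> \<le> W"
  shows "\<bar>x - X - (1/2 + s') * n\<bar> \<le> 4 * real_of_int H"
proof -
  define u where "u = n - real i * H"
  have u: "0 \<le> u" "u \<le> 2 * real_of_int H" using n by (auto simp: u_def)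
  note sd = slope_diff[OF u]
  have ax: "(1/2 + s') * n = (1/2 + s') * (real i * H) + (u / 2 + s' * u)"
    by (simp add: u_def field_simps)
  have r: "(1/2 + s) * u = u / 2 + s * u" and l: "(1/2 - s) * u = u / 2 - s * u"
    by (simp_all add: algebra_simps)
  have dis: "\<bar>x - base i - (u / 2 + s * u)\<bar> \<le> W \<or> \<bar>x - (base i + 6 * W) - (u / 2 - s * u)\<bar> \<le> W"
    using assms(3) unfolding u_def[symmetric] r l .
  have sH: "s * H \<le> 1/2 * H" using s H by (intro mult_right_mono) auto
  have W1: "1 \<le> real_of_int W" using W by simp
  show ?thesis
    using dis base_bounds[of i] sd sW sH W1 ax by linarith
qed

text \<open>The index starts at 1: the tube at level 0 is supplied separately as a path, so that its
  starting point can be prescribed.\<close>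

definition links :: "(edge \<Rightarrow> bool) \<Rightarrow> nat \<Rightarrow> bool" where
  "links \<omega> J \<longleftrightarrow> (\<forall>i\<in>{1..J}. has_tube \<omega> s W (2 * H) (base i) (int i * H) \<and>
     has_tube \<omega> (- s) W (2 * H) (base i + 6 * W) (int i * H))"

text \<open>Induction on \<open>J\<close> by \<open>glue\<close>. On the window from
  \<open>a\<close> to \<open>b\<close> the second half of the old tube overlaps the first half of
  the new one, and the link crosses both. The invariant records the position on the last
  \<open>H\<close> levels, where the next gluing takes place, and the start
  \<open>h 0\<close>.\<close>

lemma lane_path:
  assumes f0: "tube \<omega> s W (2 * H) (base 0) 0 f0" and ln: "links \<omega> J"
  shows "\<exists>h. opath \<omega> 0 (int J * H + 2 * H) h \<and> h 0 = f0 0 \<and>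
    (\<forall>n\<in>{int J * H + H..int J * H + 2 * H}. \<bar>real_of_int (h n) - base J - (1/2 + s) * (n - int J * H)\<bar> \<le> W) \<and>
    (\<forall>n\<in>{0..int J * H + 2 * H}. \<bar>real_of_int (h n) - X - (1/2 + s') * n\<bar> \<le> 4 * real_of_int H)"
  using ln
proof (induction J)
  case 0
  have t: "opath \<omega> 0 (2 * H) f0" "\<And>n. n \<in> {0..2 * H} \<Longrightarrow> \<bar>real_of_int (f0 n) - base 0 - (1/2 + s) * n\<bar> \<le> W"
    using f0 by (auto simp: tube_def)
  have "\<bar>real_of_int (f0 n) - X - (1/2 + s') * n\<bar> \<le> 4 * real_of_int H" if "n \<in> {0..2 * H}" for n
    by (rule near_axis[of 0]) (use t(2)[OF that] that in auto)
  then show ?case using t by (intro exI[of _ f0]) auto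
next
  case (Suc J)
  then have "links \<omega> J" by (auto simp: links_def)
  from Suc.IH[OF this] obtain f1 where f1: "opath \<omega> 0 (int J * H + 2 * H) f1" "f1 0 = f0 0"
      "\<And>n. n \<in> {int J * H + H..int J * H + 2 * H} \<Longrightarrow> \<bar>real_of_int (f1 n) - base J - (1/2 + s) * (n - int J * H)\<bar> \<le> W"
      "\<And>n. n \<in> {0..int J * H + 2 * H} \<Longrightarrow> \<bar>real_of_int (f1 n) - X - (1/2 + s') * n\<bar> \<le> 4 * real_of_int H"
    by blast
  define a where "a = int (Suc J) * H"
  have a: "a = int J * H + H" by (simp add: a_def algebra_simps)
  obtain f2 where f2: "opath \<omega> a (a + 2 * H) f2"
      "\<And>n. n \<in> {a..a + 2 * H} \<Longrightarrow> \<bar>real_of_int (f2 n) - base (Suc J) - (1/2 + s) * (n - a)\<bar> \<le> W"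
  proof -
    have "has_tube \<omega> s W (2 * H) (base (Suc J)) a"
      using bspec[OF Suc.prems[unfolded links_def], of "Suc J"] unfolding a_def by simp
    then show thesis using that unfolding has_tube_def tube_def by auto
  qed
  obtain g where g: "opath \<omega> a (a + 2 * H) g"
      "\<And>n. n \<in> {a..a + 2 * H} \<Longrightarrow> \<bar>real_of_int (g n) - (base (Suc J) + 6 * W) - (1/2 - s) * (n - a)\<bar> \<le> W"
  proof -
    have "has_tube \<omega> (- s) W (2 * H) (base (Suc J) + 6 * W) a"
      using bspec[OF Suc.prems[unfolded links_def], of "Suc J"] unfolding a_def by simp
    then show thesis using that unfolding has_tube_def tube_def by auto
  qed
  define b where "b = a + H"
  have b: "b = int J * H + 2 * H" by (simp add: b_def a)
  have JH: "0 \<le> int J * H" using H by simp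
  have W1: "1 \<le> real_of_int W" using W by simp
  note bs = base_step[of J]
  \<comment> \<open>The axes are \<open>3 * W\<close> apart up to a rounding error of 1, and the
    half-widths take \<open>2 * W\<close>.\<close>
  have le: "f2 n \<le> f1 n" if "n \<in> {a..b}" for n
  proof -
    have 1: "\<bar>real_of_int (f1 n) - base J - (1/2 + s) * (n - int J * H)\<bar> \<le> W"
      by (rule f1(3)) (use that a b H in auto)
    have 2: "\<bar>real_of_int (f2 n) - base (Suc J) - (1/2 + s) * (n - a)\<bar> \<le> W"
      by (rule f2(2)) (use that b_def H in auto)
    have "(1/2 + s) * real_of_int (n - int J * H) = (1/2 + s) * (n - a) + (1/2 + s) * H"
      by (simp add: a algebra_simps)
    then have "real_of_int (f2 n) \<le> f1 n" using 1 2 bs W1 by linarith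
    then show ?thesis by simp
  qed
  \<comment> \<open>The link starts \<open>6 * W\<close> right of the new base, thus about
    \<open>3 * W\<close> right of the old axis.\<close>
  have start: "f1 a \<le> g a"
  proof -
    have 1: "\<bar>real_of_int (f1 a) - base J - (1/2 + s) * (a - int J * H)\<bar> \<le> W"
      by (rule f1(3)) (use a b H in auto)
    have 2: "\<bar>real_of_int (g a) - (real_of_int (base (Suc J)) + 6 * real_of_int W)\<bar> \<le> W"
      using g(2)[of a] H by simp
    have "(1/2 + s) * real_of_int (a - int J * H) = (1/2 + s) * H"
      by (simp add: a)
    then have "real_of_int (f1 a) \<le> g a" using 1 2 bs W1 by linarith
    then show ?thesis by simp
  qed
  \<comment> \<open>Over \<open>H\<close> levels the two axes move by
    \<open>2 * s * H \<ge> 8 * W\<close> relative to each other, which covers the initial distance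
    \<open>6 * W\<close> and both half-widths.\<close>
  have finish: "g b \<le> f2 b"
  proof -
    have 1: "\<bar>real_of_int (f2 b) - base (Suc J) - (1/2 + s) * (b - a)\<bar> \<le> W"
      by (rule f2(2)) (use b_def H in auto)
    have 2: "\<bar>real_of_int (g b) - (base (Suc J) + 6 * W) - (1/2 - s) * (b - a)\<bar> \<le> W"
      by (rule g(2)) (use b_def H in auto)
    have "(1/2 + s) * real_of_int (b - a) = H / 2 + s * H" "(1/2 - s) * real_of_int (b - a) = H / 2 - s * H"
      by (simp_all add: b_def algebra_simps)
    then have "real_of_int (g b) \<le> f2 b" using 1 2 sW by linarith
    then show ?thesis by simp
  qed
  have f1b: "opath \<omega> 0 b f1" using f1(1) unfolding b .
  have gb: "opath \<omega> a b g" by (rule opath_mono[OF g(1)]) (use b_def H in auto)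
  from glue[OF f1b f2(1) gb _ _ _ le start finish] obtain h where
    h: "opath \<omega> 0 (a + 2 * H) h" "\<forall>n\<in>{0..a}. h n = f1 n" "\<forall>n\<in>{b..a + 2 * H}. h n = f2 n"
       "\<forall>n\<in>{a..b}. h n \<in> {f1 n, g n, f2 n}"
    using a b_def H JH by auto
  show ?case unfolding a_def[symmetric]
  proof (intro exI[of _ h] conjI ballI)
    show "opath \<omega> 0 (a + 2 * H) h" by (rule h(1))
    show "h 0 = f0 0" using h(2) f1(2) a H JH by auto
  next
    fix n assume n: "n \<in> {a + H..a + 2 * H}"
    then have "h n = f2 n" using h(3) b_def by auto
    then show "\<bar>real_of_int (h n) - base (Suc J) - (1/2 + s) * (n - a)\<bar> \<le> W"
      using f2(2)[of n] n H by simp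
  next
    fix n assume n: "n \<in> {0..a + 2 * H}"
    have ra: "real_of_int a = real (Suc J) * H" by (simp add: a_def)
    have f2n: "\<bar>real_of_int (f2 n) - X - (1/2 + s') * n\<bar> \<le> 4 * real_of_int H" if "a \<le> n"
      by (rule near_axis[of "Suc J"]) (use f2(2)[of n] that n ra in \<open>auto simp flip: of_int_le_iff\<close>)
    have gn: "\<bar>real_of_int (g n) - X - (1/2 + s') * n\<bar> \<le> 4 * real_of_int H" if "a \<le> n"
      by (rule near_axis[of "Suc J"]) (use g(2)[of n] that n ra in \<open>auto simp flip: of_int_le_iff\<close>)
    consider "n \<le> a" | "n \<in> {a..b}" | "b \<le> n" by fastforce
    then show "\<bar>real_of_int (h n) - X - (1/2 + s') * n\<bar> \<le> 4 * real_of_int H"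
    proof cases
      case 1
      then show ?thesis using h(2) f1(4)[of n] n a H by auto
    next
      case 2
      then consider "h n = f1 n" | "h n = g n" | "h n = f2 n" using h(4) by blast
      then show ?thesis
      proof cases
        case 1
        then show ?thesis using f1(4)[of n] 2 n unfolding b by simp
      qed (use 2 f2n gn in auto)
    next
      case 3
      then show ?thesis using h(3) f2n n H b_def by auto
    qed
  qed
qed

lemma tube_edges_lane:
  assumes "i \<le> J"
  shows "tube_edges s W (2 * H) (base i) (int i * H) \<subseteq> tube_edges s' (4 * H) (int J * H + 2 * H) X 0"
    and "tube_edges (- s) W (2 * H) (base i + 6 * W) (int i * H) \<subseteq> tube_edges s' (4 * H) (int J * H + 2 * H) X 0"
proof -
  have iJ: "int i * H \<le> int J * H" "0 \<le> int i * H" using assms H by (auto intro: mult_right_mono)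
  have *: "((x, y), d) \<in> tube_edges s' (4 * H) (int J * H + 2 * H) X 0"
    if n: "x + y \<in> {int i * H..<int i * H + 2 * H}"
      and near: "\<bar>real_of_int x - base i - (1/2 + s) * (real_of_int (x + y) - real i * H)\<bar> \<le> W \<or>
         \<bar>real_of_int x - (base i + 6 * W) - (1/2 - s) * (real_of_int (x + y) - real i * H)\<bar> \<le> W" for x y d
  proof -
    have "real_of_int (int i * H) \<le> real_of_int (x + y)" "real_of_int (x + y) \<le> real_of_int (int i * H + 2 * H)"
      using n unfolding of_int_le_iff by auto
    then have "\<bar>real_of_int x - X - (1/2 + s') * real_of_int (x + y)\<bar> \<le> 4 * real_of_int H"
      by (intro near_axis[OF _ _ near]) auto
    moreover have "0 \<le> x + y" "x + y < int J * H + 2 * H"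
      using n iJ unfolding atLeastLessThan_iff by linarith+
    ultimately show ?thesis by (simp add: tube_edges_def)
  qed
  show "tube_edges s W (2 * H) (base i) (int i * H) \<subseteq> tube_edges s' (4 * H) (int J * H + 2 * H) X 0"
    unfolding tube_edges_def[of s] using * by (auto simp: tube_edges_def)
  show "tube_edges (- s) W (2 * H) (base i + 6 * W) (int i * H) \<subseteq> tube_edges s' (4 * H) (int J * H + 2 * H) X 0"
    unfolding tube_edges_def[of "- s"] using * by (auto simp: tube_edges_def)
qed

definition lane :: "(edge \<Rightarrow> bool) \<Rightarrow> nat \<Rightarrow> bool" where
  "lane \<omega> J \<longleftrightarrow> has_tube \<omega> s W (2 * H) (base 0) 0 \<and> links \<omega> J"

lemma determined_lane:
  "determined (tube_edges s' (4 * H) (int J * H + 2 * H) X 0) (\<lambda>\<omega>. \<not> lane \<omega> J)"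
proof -
  let ?S = "tube_edges s' (4 * H) (int J * H + 2 * H) X 0"
  have r: "determined ?S (\<lambda>\<omega>. has_tube \<omega> s W (2 * H) (base i) (int i * H))" if "i \<le> J" for i
    by (rule determined_mono[OF determined_has_tube tube_edges_lane(1)[OF that]])
  have l: "determined ?S (\<lambda>\<omega>. has_tube \<omega> (- s) W (2 * H) (base i + 6 * W) (int i * H))" if "i \<le> J" for i
    using determined_mono[OF determined_has_tube] tube_edges_lane(2)[OF that] by simp
  have "determined ?S (\<lambda>\<omega>. links \<omega> J)"
    unfolding links_def by (intro determined_all determined_comp2[where h = "(\<and>)"] r l) auto
  with r[of 0] have "determined ?S (\<lambda>\<omega>. lane \<omega> J)"
    unfolding lane_def by (intro determined_comp2[where h = "(\<and>)"]) auto
  then show ?thesis by (rule determined_comp)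
qed

lemma lane_fail: "Pr p (\<lambda>\<omega>. \<not> lane \<omega> J) \<le> 2 * (real J + 1) * tube_fail p s W (2 * H)"
proof -
  let ?I = "{..J} \<times> (UNIV :: bool set)"
  define Q where "Q = (\<lambda>(i, d) \<omega>. \<not> (if d then has_tube \<omega> s W (2 * H) (base i) (int i * H)
    else has_tube \<omega> (- s) W (2 * H) (base i + 6 * W) (int i * H)))"
  define S where "S = (\<lambda>(i, d). if d then tube_edges s W (2 * H) (base i) (int i * H)
    else tube_edges (- s) W (2 * H) (base i + 6 * W) (int i * H))"
  have "Pr p (\<lambda>\<omega>. \<not> lane \<omega> J) \<le> (\<Sum>j\<in>?I. Pr p (Q j))"
  proof (rule Pr_union_le[where S = S])
    fix j assume "j \<in> ?I"
    show "finite (S j)" by (auto simp: S_def finite_tube_edges split: prod.splits)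
    show "determined (S j) (Q j)"
      using determined_not_tube[of "- s" W "2 * H" "base (fst j) + 6 * W"]
      by (auto simp: S_def Q_def intro: determined_not_tube split: prod.splits)
  next
    fix \<omega> assume "\<not> lane \<omega> J"
    then consider "\<not> has_tube \<omega> s W (2 * H) (base 0) 0"
      | i where "i \<le> J" "\<not> has_tube \<omega> s W (2 * H) (base i) (int i * H)"
      | i where "i \<le> J" "\<not> has_tube \<omega> (- s) W (2 * H) (base i + 6 * W) (int i * H)"
      unfolding lane_def links_def by auto
    then show "\<exists>j\<in>?I. Q j \<omega>"
    proof cases
      case 1
      then show ?thesis by (intro bexI[of _ "(0, True)"]) (auto simp: Q_def)
    next
      case (2 i)
      then show ?thesis by (intro bexI[of _ "(i, True)"]) (auto simp: Q_def)
    next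
      case (3 i)
      then show ?thesis by (intro bexI[of _ "(i, False)"]) (auto simp: Q_def)
    qed
  qed auto
  also have "\<dots> = (\<Sum>j\<in>?I. tube_fail p s W (2 * H))"
  proof (intro sum.cong refl)
    fix j :: "nat \<times> bool"
    obtain i d where j: "j = (i, d)" by (cases j)
    show "Pr p (Q j) = tube_fail p s W (2 * H)"
      using Pr_tube(1)[of p s W "2 * H" "base i" "int i * H"]
        Pr_tube(2)[of p s W "2 * H" "base i + 6 * W" "int i * H"]
      by (cases d) (simp_all add: j Q_def)
  qed
  also have "\<dots> = 2 * (real J + 1) * tube_fail p s W (2 * H)"
    by (simp add: card_cartesian_product)
  finally show ?thesis .
qed

end

text \<open>Two lanes of small tubes fit side by side into the large tube, using disjoint edge sets.\<close>
lemma tube_fail_step: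
  assumes "0 < H" "1 \<le> W" "4 * real_of_int W \<le> s * H" "s \<le> 1/2" "1 \<le> K"
  shows "tube_fail p (s - 3 * real_of_int W / H) (12 * H) (2 * H * int K) \<le> (4 * real K * tube_fail p s W (2 * H))\<^sup>2"
proof -
  define s' where "s' = s - 3 * real_of_int W / H"
  \<comment> \<open>With axes at \<open>6 * H\<close> and \<open>- (6 * H)\<close> and half-width
    \<open>4 * H\<close> the lanes are disjoint and stay within \<open>10 * H\<close> of the axis of
    the large tube.\<close>
  interpret A: lane_geometry s s' W H "6 * real_of_int H"
    using assms by unfold_locales (auto simp: s'_def)
  interpret B: lane_geometry s s' W H "- (6 * real_of_int H)"
    using assms by unfold_locales (auto simp: s'_def)
  \<comment> \<open>A lane with \<open>J\<close> links spans \<open>(J + 2) * H\<close> levels,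
    which has to equal \<open>2 * H * K\<close>.\<close>
  define J where "J = 2 * K - 2"
  have J: "int J * H + 2 * H = 2 * H * int K" using assms(5) by (simp add: J_def of_nat_diff algebra_simps)
  have big: "has_tube \<omega> s' (12 * H) (2 * H * int K) 0 0" if AB: "A.lane \<omega> J \<or> B.lane \<omega> J" for \<omega>
  proof -
    obtain h X where h: "opath \<omega> 0 (2 * H * int K) h" "\<bar>X\<bar> \<le> 6 * real_of_int H"
      "\<And>n. n \<in> {0..2 * H * int K} \<Longrightarrow> \<bar>real_of_int (h n) - X - (1/2 + s') * n\<bar> \<le> 4 * real_of_int H"
    proof (cases "A.lane \<omega> J")
      case True
      then obtain f0 where "tube \<omega> s W (2 * H) (A.base 0) 0 f0" "A.links \<omega> J"
        unfolding A.lane_def has_tube_def by blast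
      from A.lane_path[OF this] that[of _ "6 * real_of_int H"] show ?thesis using assms(1) unfolding J by auto
    next
      case False
      with AB obtain f0 where "tube \<omega> s W (2 * H) (B.base 0) 0 f0" "B.links \<omega> J"
        unfolding B.lane_def has_tube_def by blast
      from B.lane_path[OF this] that[of _ "- (6 * real_of_int H)"] show ?thesis using assms(1) unfolding J by auto
    qed
    have "\<bar>real_of_int (h n) - (1/2 + s') * n\<bar> \<le> 12 * real_of_int H" if "n \<in> {0..2 * H * int K}" for n
      using h(2) h(3)[OF that] assms(1) by linarith
    then show ?thesis using h(1) unfolding has_tube_def tube_def by (intro exI[of _ h]) auto
  qed
  let ?L = "2 * H * int K"
  have dA: "determined (tube_edges s' (4 * H) ?L (6 * real_of_int H) 0) (\<lambda>\<omega>. \<not> A.lane \<omega> J)"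
    using A.determined_lane[of J] unfolding J .
  have dB: "determined (tube_edges s' (4 * H) ?L (- (6 * real_of_int H)) 0) (\<lambda>\<omega>. \<not> B.lane \<omega> J)"
    using B.determined_lane[of J] unfolding J .
  have disj: "tube_edges s' (4 * H) ?L (6 * real_of_int H) 0 \<inter> tube_edges s' (4 * H) ?L (- (6 * real_of_int H)) 0 = {}"
    using assms(1) by (auto simp: tube_edges_def)
  have "tube_fail p s' (12 * H) ?L \<le> Pr p (\<lambda>\<omega>. \<not> A.lane \<omega> J \<and> \<not> B.lane \<omega> J)"
  proof (rule Pr_mono[OF finite_UnI[OF finite_tube_edges finite_tube_edges]])
    show "determined (tube_edges s' (4 * H) ?L (6 * real_of_int H) 0 \<union> tube_edges s' (4 * H) ?L (- (6 * real_of_int H)) 0)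
        (\<lambda>\<omega>. \<not> A.lane \<omega> J \<and> \<not> B.lane \<omega> J)"
      by (intro determined_comp2[where h = "(\<and>)"] determined_mono[OF dA] determined_mono[OF dB]) auto
  qed (use big in blast)
  also have "\<dots> = Pr p (\<lambda>\<omega>. \<not> A.lane \<omega> J) * Pr p (\<lambda>\<omega>. \<not> B.lane \<omega> J)"
    by (rule Pr_conj[OF finite_tube_edges dA finite_tube_edges dB disj])
  also have "\<dots> \<le> (4 * real K * tube_fail p s W (2 * H)) * (4 * real K * tube_fail p s W (2 * H))"
  proof (rule mult_mono)
    have "2 * (real J + 1) * tube_fail p s W (2 * H) \<le> 4 * real K * tube_fail p s W (2 * H)"
      using assms(5) by (intro mult_right_mono) (auto simp: J_def of_nat_diff)
    then show "Pr p (\<lambda>\<omega>. \<not> A.lane \<omega> J) \<le> 4 * real K * tube_fail p s W (2 * H)"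
        "Pr p (\<lambda>\<omega>. \<not> B.lane \<omega> J) \<le> 4 * real K * tube_fail p s W (2 * H)"
      using A.lane_fail[of p J] B.lane_fail[of p J] by linarith+
  qed auto
  finally show ?thesis by (simp add: s'_def power2_eq_square)
qed

text \<open>A tube path starts within \<open>W\<close> of the origin, and \<open>W\<close> grows
  with the scale. Percolation requires starts in a window \<open>w\<close> that stays fixed.\<close>

definition start_tube :: "(edge \<Rightarrow> bool) \<Rightarrow> int \<Rightarrow> real \<Rightarrow> int \<Rightarrow> int \<Rightarrow> bool" where
  "start_tube \<omega> w s W L \<longleftrightarrow> (\<exists>f. \<bar>f 0\<bar> \<le> w \<and> tube \<omega> s W L 0 0 f)"

lemma determined_start_tube: "determined (tube_edges s W L 0 0) (\<lambda>\<omega>. start_tube \<omega> w s W L)"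
proof -
  have "determined (tube_edges s W L 0 0) (\<lambda>\<omega>. \<exists>f. (\<bar>f (0::int)\<bar> \<le> w \<and> (\<forall>n\<in>{0..0 + L}. \<bar>real_of_int (f n) - real_of_int 0 - (1/2 + s) * (n - 0::int)\<bar> \<le> W)) \<and> opath \<omega> 0 (0 + L) f)"
    by (intro determined_ex determined_opath) (auto simp: edge_at_def tube_edges_def)
  then show ?thesis by (simp add: start_tube_def tube_def conj_ac)
qed

text \<open>A single lane carries the prescribed start, so the failure is not squared. The added
  term is the failure of that lane, which is summable over the scales.\<close>

lemma start_fail_step:
  assumes "0 < H" "1 \<le> W" "4 * real_of_int W \<le> s * H" "s \<le> 1/2" "1 \<le> K"
  shows "Pr p (\<lambda>\<omega>. \<not> start_tube \<omega> w (s - 3 * real_of_int W / H) (12 * H) (2 * H * int K))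
    \<le> Pr p (\<lambda>\<omega>. \<not> start_tube \<omega> w s W (2 * H)) + 4 * real K * tube_fail p s W (2 * H)"
proof -
  define s' where "s' = s - 3 * real_of_int W / H"
  interpret lane_geometry s s' W H 0
    using assms by unfold_locales (auto simp: s'_def)
  define J where "J = 2 * K - 2"
  have J: "int J * H + 2 * H = 2 * H * int K" using assms(5) by (simp add: J_def of_nat_diff algebra_simps)
  have b0: "base 0 = 0" by (simp add: base_def)
  let ?Q = "\<lambda>i \<omega>. if i then \<not> start_tube \<omega> w s W (2 * H) else \<not> lane \<omega> J"
  let ?S = "\<lambda>i. if i then tube_edges s W (2 * H) 0 0 else tube_edges s' (4 * H) (int J * H + 2 * H) 0 0"
  have "Pr p (\<lambda>\<omega>. \<not> start_tube \<omega> w s' (12 * H) (2 * H * int K)) \<le> (\<Sum>i\<in>UNIV. Pr p (?Q i))"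
  proof (rule Pr_union_le[where S = ?S])
    show "finite (?S i)" for i using finite_tube_edges by simp
    show "determined (?S i) (?Q i)" for i
      using determined_comp[OF determined_start_tube] determined_lane by (cases i) simp_all
  next
    fix \<omega> assume n: "\<not> start_tube \<omega> w s' (12 * H) (2 * H * int K)"
    have "start_tube \<omega> w s' (12 * H) (2 * H * int K)" if "start_tube \<omega> w s W (2 * H)" "lane \<omega> J"
    proof -
      obtain f0 where f0: "\<bar>f0 0\<bar> \<le> w" "tube \<omega> s W (2 * H) 0 0 f0" using \<open>start_tube \<omega> w s W (2 * H)\<close> by (auto simp: start_tube_def)
      have "tube \<omega> s W (2 * H) (base 0) 0 f0" "links \<omega> J" using f0 that by (auto simp: b0 lane_def)
      from lane_path[OF this, unfolded J] obtain h where h: "opath \<omega> 0 (2 * H * int K) h" "h 0 = f0 0"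
        "\<forall>n\<in>{0..2 * H * int K}. \<bar>real_of_int (h n) - 0 - (1/2 + s') * n\<bar> \<le> 4 * real_of_int H" by blast
      have "\<bar>real_of_int (h n) - (1/2 + s') * n\<bar> \<le> 12 * real_of_int H" if "n \<in> {0..2 * H * int K}" for n
        using bspec[OF h(3) that] assms(1) by linarith
      then show ?thesis using h(1,2) f0(1) unfolding start_tube_def tube_def by (intro exI[of _ h]) auto
    qed
    then show "\<exists>i\<in>UNIV. ?Q i \<omega>" using n by (metis UNIV_I)
  qed auto
  also have "\<dots> = Pr p (\<lambda>\<omega>. \<not> start_tube \<omega> w s W (2 * H)) + Pr p (\<lambda>\<omega>. \<not> lane \<omega> J)"
    by (simp add: UNIV_bool)
  also have "Pr p (\<lambda>\<omega>. \<not> lane \<omega> J) \<le> 4 * real K * tube_fail p s W (2 * H)"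
  proof -
    have "2 * (real J + 1) * tube_fail p s W (2 * H) \<le> 4 * real K * tube_fail p s W (2 * H)"
      using assms(5) by (intro mult_right_mono) (auto simp: J_def of_nat_diff)
    then show ?thesis using lane_fail[of p J] by linarith
  qed
  finally show ?thesis by (simp add: s'_def)
qed

section \<open>Renormalisation and the critical probability\<close>

fun scale_K :: "nat \<Rightarrow> nat \<Rightarrow> nat" where "scale_K K0 k = K0 * 2 ^ k"

text \<open>The growth of the factor \<open>scale_K K0 k\<close> makes the ratios
  \<open>W / H\<close>, and with them the slope losses, summable.\<close>

fun scale :: "nat \<Rightarrow> real \<Rightarrow> int \<Rightarrow> int \<Rightarrow> nat \<Rightarrow> real \<times> int \<times> int" where
  "scale K0 s W H 0 = (s, W, H)"
| "scale K0 s W H (Suc k) = (case scale K0 s W H k of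
     (s', W', H') \<Rightarrow> (s' - 3 * real_of_int W' / H', 12 * H', H' * int (scale_K K0 k)))"

text \<open>At scale \<open>k\<close> the slope loses at most \<open>s / 4 / 2 ^ k\<close>, in total
  less than \<open>s / 2\<close>. The constant is 288 = 12 * 12 * 2: one 12 from the ratio bound,
  one from the new width \<open>12 * H\<close>, and 2 from the next power of 2.\<close>

lemma scale_invariant:
  fixes s :: real
  assumes s: "0 < s" "s \<le> 1/2" and W: "1 \<le> W" "12 * real_of_int W \<le> s * H" and K0: "288 \<le> s * K0" "1 \<le> K0"
    and H: "0 < H" and sc: "scale K0 s W H k = (s', W', H')"
  shows "2 ^ k \<le> H' \<and> 1 \<le> W' \<and> s / 2 + s / 2 / 2 ^ k \<le> s' \<and> s' \<le> 1/2 \<and> 12 * 2 ^ k * real_of_int W' \<le> s * H'"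
  using sc
proof (induction k arbitrary: s' W' H')
  case 0
  then show ?case using s W H by auto
next
  case (Suc k)
  obtain s1 W1 H1 where p: "scale K0 s W H k = (s1, W1, H1)" by (cases "scale K0 s W H k") auto
  note I = Suc.IH[OF p]
  have eqs: "s' = s1 - 3 * real_of_int W1 / H1" "W' = 12 * H1" "H' = H1 * int (scale_K K0 k)"
    using Suc.prems p by auto
  have H1: "0 < H1" using I by (smt (verit) zero_less_power)
  have K2: "2 \<le> K0"
  proof -
    have "288 \<le> 1/2 * real K0" using K0 s by (smt (verit) mult_right_mono of_nat_0_le_iff)
    then show ?thesis by linarith
  qed
  have "2 ^ k * 2 \<le> H1 * int (scale_K K0 k)"
  proof (rule mult_mono)
    have "2 * 1 \<le> K0 * 2 ^ k" using K2 by (intro mult_mono) auto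
    then show "2 \<le> int (scale_K K0 k)" by (simp flip: of_nat_mult of_nat_power)
  qed (use I H1 in auto)
  moreover have "s / 2 + s / 2 / 2 ^ Suc k \<le> s'" "s' \<le> 1/2"
  proof -
    have "3 * real_of_int W1 / H1 \<le> s / 4 / 2 ^ k" using I H1 by (simp add: field_simps)
    moreover have "0 \<le> 3 * real_of_int W1 / H1" using I H1 by simp
    moreover have "s / 2 / 2 ^ Suc k = s / 4 / 2 ^ k" "s / 2 / 2 ^ k = 2 * (s / 4 / 2 ^ k)" by simp_all
    moreover have "s / 2 + s / 2 / 2 ^ k \<le> s1" "s1 \<le> 1/2" using I by auto
    ultimately show "s / 2 + s / 2 / 2 ^ Suc k \<le> s'" "s' \<le> 1/2" unfolding eqs by linarith+
  qed
  moreover have "12 * 2 ^ Suc k * real_of_int W' \<le> s * H'"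
  proof -
    have "12 * 2 ^ Suc k * real_of_int W' = 288 * (2 ^ k * real_of_int H1)" by (simp add: eqs)
    also have "\<dots> \<le> (s * K0) * (2 ^ k * real_of_int H1)" using K0 H1 by (intro mult_right_mono) auto
    also have "\<dots> = s * H'" by (simp add: eqs)
    finally show ?thesis .
  qed
  moreover have "1 \<le> W'" using H1 by (simp add: eqs)
  moreover have "2 ^ Suc k \<le> H'" using calculation(1) by (simp add: eqs mult.commute)
  ultimately show ?case by blast
qed

text \<open>Squaring wins over the number of small tubes: the bound of scale \<open>k\<close>
  inserted into \<open>tube_fail_step\<close> gives
  \<open>1 / (4096 * (real K0)\<^sup>2 * 16 ^ k)\<close>, less than what scale \<open>k + 1\<close>
  requires. With a prescribed window the failures add up: they start at no more than 1/4, grow by at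
  most \<open>1 / (8 * 2 ^ k)\<close>, and stay below 1/2.\<close>

lemma scale_fail:
  fixes s :: real
  assumes s: "0 < s" "s \<le> 1/2" and W: "1 \<le> W" "12 * real_of_int W \<le> s * H" and K0: "288 \<le> s * K0" "1 \<le> K0"
    and H: "0 < H" and init: "tube_fail p s W (2 * H) \<le> 1 / (256 * (real K0)\<^sup>2)"
    and sc: "scale K0 s W H k = (s', W', H')"
  shows "tube_fail p s' W' (2 * H') \<le> 1 / (256 * (real K0)\<^sup>2 * 8 ^ k) \<and>
     Pr p (\<lambda>\<omega>. \<not> start_tube \<omega> W s' W' (2 * H')) \<le> 1 / 2 - 1 / (4 * 2 ^ k)"
  using sc
proof (induction k arbitrary: s' W' H')
  case 0
  \<comment> \<open>At scale 0 the window is the half-width of the tube itself.\<close>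
  have "start_tube \<omega> W s W (2 * H)" if tb: "has_tube \<omega> s W (2 * H) 0 0" for \<omega>
  proof -
    obtain f where f: "tube \<omega> s W (2 * H) 0 0 f" using tb by (auto simp: has_tube_def)
    then have "\<forall>n\<in>{0..2 * H}. \<bar>real_of_int (f n) - (1/2 + s) * n\<bar> \<le> W" by (simp add: tube_def)
    from bspec[OF this, of 0] have "\<bar>real_of_int (f 0)\<bar> \<le> W" using H by simp
    then have "\<bar>f 0\<bar> \<le> W" by linarith
    with f show ?thesis by (auto simp: start_tube_def)
  qed
  then have "Pr p (\<lambda>\<omega>. \<not> start_tube \<omega> W s W (2 * H)) \<le> tube_fail p s W (2 * H)"
    by (intro Pr_mono[OF finite_tube_edges determined_not_tube]) auto
  also have "\<dots> \<le> 1 / (256 * (real K0)\<^sup>2)" by (rule init)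
  also have "\<dots> \<le> 1 / 256" using K0 by (simp add: field_simps)
  finally show ?case using init 0 by simp
next
  case (Suc k)
  obtain s1 W1 H1 where p: "scale K0 s W H k = (s1, W1, H1)" by (cases "scale K0 s W H k") auto
  note IH = Suc.IH[OF p]
  note I = scale_invariant[OF s W K0 H p]
  have eqs: "s' = s1 - 3 * real_of_int W1 / H1" "W' = 12 * H1" "2 * H' = 2 * H1 * int (scale_K K0 k)"
    using Suc.prems p by auto
  have H1: "0 < H1" using I by (smt (verit) zero_less_power)
  have K1: "1 \<le> scale_K K0 k" using K0 by simp
  have sW: "4 * real_of_int W1 \<le> s1 * H1"
  proof -
    have W1: "1 \<le> real_of_int W1" using I by simp
    have "4 * real_of_int W1 \<le> 6 * 2 ^ k * real_of_int W1"
      using W1 one_le_power[of "2::real" k] by (intro mult_right_mono) linarith+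
    also have "\<dots> \<le> s / 2 * H1" using I by simp
    also have "\<dots> \<le> s1 * H1"
    proof (rule mult_right_mono)
      have "0 \<le> s / 2 / 2 ^ k" using s by simp
      then show "s / 2 \<le> s1" using I by linarith
    qed (use H1 in auto)
    finally show ?thesis .
  qed
  have s1: "s1 \<le> 1/2" and W1: "1 \<le> W1" using I by auto
  let ?f = "tube_fail p s1 W1 (2 * H1)"
  have Kr: "1 \<le> real K0" using K0 by simp
  have mf: "4 * real (scale_K K0 k) * ?f \<le> 4 * real (scale_K K0 k) * (1 / (256 * (real K0)\<^sup>2 * 8 ^ k))"
    using IH by (intro mult_left_mono) auto
  also have "\<dots> = 1 / (64 * real K0 * 4 ^ k)"
  proof -
    have "(8::real) ^ k = 2 ^ k * 4 ^ k" by (simp flip: power_mult_distrib)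
    then show ?thesis using Kr by (simp add: power2_eq_square)
  qed
  finally have mf: "4 * real (scale_K K0 k) * ?f \<le> 1 / (64 * real K0 * 4 ^ k)" .
  have "tube_fail p s' W' (2 * H') \<le> (4 * real (scale_K K0 k) * ?f)\<^sup>2"
    unfolding eqs by (rule tube_fail_step[OF H1 W1 sW s1 K1])
  also have "\<dots> \<le> (1 / (64 * real K0 * 4 ^ k))\<^sup>2"
    by (rule power_mono[OF mf]) simp
  also have "\<dots> = 1 / (4096 * (real K0)\<^sup>2 * 16 ^ k)"
    by (simp add: power_divide power_mult_distrib flip: power_mult) (simp add: power_mult mult.commute[of k])
  also have "\<dots> \<le> 1 / (256 * (real K0)\<^sup>2 * 8 ^ Suc k)"
  proof -
    have "(8::real) ^ k \<le> 16 ^ k" by (intro power_mono) auto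
    then have "(8::real) ^ k \<le> 2 * 16 ^ k" by (smt (verit) zero_le_power)
    then have "256 * (real K0)\<^sup>2 * 8 ^ Suc k \<le> 4096 * (real K0)\<^sup>2 * 16 ^ k"
      using mult_left_mono[of "8 ^ k" "2 * 16 ^ k" "2048 * (real K0)\<^sup>2"] Kr by simp
    then show ?thesis using Kr by (intro divide_left_mono) auto
  qed
  finally have 1: "tube_fail p s' W' (2 * H') \<le> 1 / (256 * (real K0)\<^sup>2 * 8 ^ Suc k)" .
  have "Pr p (\<lambda>\<omega>. \<not> start_tube \<omega> W s' W' (2 * H')) \<le>
      Pr p (\<lambda>\<omega>. \<not> start_tube \<omega> W s1 W1 (2 * H1)) + 4 * real (scale_K K0 k) * ?f"
    unfolding eqs by (rule start_fail_step[OF H1 W1 sW s1 K1])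
  also have "\<dots> \<le> (1 / 2 - 1 / (4 * 2 ^ k)) + 1 / (64 * real K0 * 4 ^ k)"
    using IH mf by (intro add_mono) auto
  also have "1 / (64 * real K0 * 4 ^ k) \<le> 1 / (8 * 2 ^ k)"
  proof -
    have "(2::real) ^ k \<le> 4 ^ k" by (intro power_mono) auto
    then have "8 * 1 * 2 ^ k \<le> 64 * real K0 * 4 ^ k" using Kr by (intro mult_mono) auto
    then show ?thesis using K0 by (intro divide_left_mono) auto
  qed
  finally have 2: "Pr p (\<lambda>\<omega>. \<not> start_tube \<omega> W s' W' (2 * H')) \<le> 1 / 2 - 1 / (4 * 2 ^ Suc k)" by simp
  show ?case using 1 2 by simp
qed

section \<open>Reaching a level from a fixed vertex\<close>

definition reaches :: "(edge \<Rightarrow> bool) \<Rightarrow> nat \<Rightarrow> int \<Rightarrow> bool" where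
  "reaches \<omega> n x \<longleftrightarrow> (\<exists>f. (nepath 0 (int n) f \<and> f 0 = x) \<and> opath \<omega> 0 (int n) f)"

lemma determined_reaches: "determined (slab 0 (int n) x (x + int n)) (\<lambda>\<omega>. reaches \<omega> n x)"
  unfolding reaches_def
proof (intro determined_ex determined_opath)
  fix f i assume f: "nepath 0 (int n) f \<and> f 0 = x" and i: "i \<in> {0..<int n}"
  then show "edge_at f i \<in> slab 0 (int n) x (x + int n)"
    using nepath_bounds[of 0 "int n" f 0 i] by (auto simp: edge_at_slab)
qed

lemma Pr_reaches: "Pr p (\<lambda>\<omega>. reaches \<omega> n x) = Pr p (\<lambda>\<omega>. reaches \<omega> n 0)"
proof -
  have "reaches (\<lambda>e. \<omega> (shift_edge 0 x e)) n 0 = reaches \<omega> n x" for \<omega>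
  proof
    assume "reaches (\<lambda>e. \<omega> (shift_edge 0 x e)) n 0"
    then obtain f where f: "opath (\<lambda>e. \<omega> (shift_edge 0 x e)) 0 (int n) f" "f 0 = 0"
      by (auto simp: reaches_def)
    have "opath \<omega> (0 + 0) (int n + 0) (\<lambda>n. f n + x)"
      using opath_shift[of \<omega> 0 x 0 "int n" "\<lambda>n. f n + x"] f(1) by simp
    then show "reaches \<omega> n x" using f(2) unfolding reaches_def
      by (intro exI[of _ "\<lambda>n. f n + x"]) (auto simp: opath_def)
  next
    assume "reaches \<omega> n x"
    then obtain f where f: "opath \<omega> 0 (int n) f" "f 0 = x" by (auto simp: reaches_def)
    then show "reaches (\<lambda>e. \<omega> (shift_edge 0 x e)) n 0" 
      using opath_shift[of \<omega> 0 x 0 "int n" f] unfolding reaches_def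
      by (intro exI[of _ "\<lambda>n. f n - x"]) (auto simp: opath_def)
  qed
  then show ?thesis
    using Pr_reindex[OF inj_shift_edge[of 0 x] finite_slab determined_reaches[of n 0], of p] by simp
qed

text \<open>The start tube of scale \<open>n\<close> exists with probability at least 1/2 and spans
  at least \<open>n\<close> levels. It begins at one of \<open>2 * W + 1\<close> points, which are
  equivalent by translation. The window does not grow with the scale, hence the bound is uniform in
  \<open>n\<close>.\<close>

lemma reaches_lower_bound:
  fixes s :: real
  assumes s: "0 < s" "s \<le> 1/2" and W: "1 \<le> W" "12 * real_of_int W \<le> s * H" and K0: "288 \<le> s * K0" "1 \<le> K0"
    and H: "0 < H" and init: "tube_fail p s W (2 * H) \<le> 1 / (256 * (real K0)\<^sup>2)"
  shows "1 / (2 * (2 * real_of_int W + 1)) \<le> Pr p (\<lambda>\<omega>. reaches \<omega> n 0)"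
proof -
  obtain s' W' H' where sc: "scale K0 s W H n = (s', W', H')" by (cases "scale K0 s W H n") auto
  have "int n < 2 ^ n" by (simp flip: of_nat_power) 
  then have H': "int n \<le> 2 * H'" using scale_invariant[OF s W K0 H sc] by linarith
  have "1/2 \<le> 1 - Pr p (\<lambda>\<omega>. \<not> start_tube \<omega> W s' W' (2 * H'))"
  proof -
    have "0 \<le> 1 / (4 * 2 ^ n :: real)" by simp
    then show ?thesis using conjunct2[OF scale_fail[OF s W K0 H init sc]] by linarith
  qed
  also have "\<dots> = Pr p (\<lambda>\<omega>. start_tube \<omega> W s' W' (2 * H'))"
    using Pr_not[OF finite_tube_edges determined_start_tube] by simp
  also have "\<dots> \<le> (\<Sum>x\<in>{-W..W}. Pr p (\<lambda>\<omega>. reaches \<omega> n x))"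
  proof (rule Pr_union_le[OF _ finite_slab determined_reaches])
    fix \<omega> assume "start_tube \<omega> W s' W' (2 * H')"
    then obtain f where f: "\<bar>f 0\<bar> \<le> W" "opath \<omega> 0 (2 * H') f" by (auto simp: start_tube_def tube_def)
    have "opath \<omega> 0 (int n) f" by (rule opath_mono[OF f(2)]) (use H' in auto)
    then show "\<exists>x\<in>{-W..W}. reaches \<omega> n x" using f(1) unfolding reaches_def
      by (intro bexI[of _ "f 0"]) (auto simp: opath_def)
  qed auto
  also have "\<dots> = (\<Sum>x\<in>{-W..W}. Pr p (\<lambda>\<omega>. reaches \<omega> n 0))"
    by (intro sum.cong refl Pr_reaches)
  also have "\<dots> = (2 * real_of_int W + 1) * Pr p (\<lambda>\<omega>. reaches \<omega> n 0)"
    using W by simp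
  finally show ?thesis using W by (simp add: field_simps)
qed

section \<open>Lists of steps as functions of the level\<close>

definition walk :: "bool list \<Rightarrow> int \<Rightarrow> int" where
  "walk ds n = int (length (filter id (take (nat n) ds)))"

lemma path_end_eq: "path_end u ds = (fst u + int (length (filter id ds)), snd u + int (length (filter Not ds)))"
proof (induction ds arbitrary: u)
  case (Cons d ds)
  then show ?case by (cases u; cases d) auto
qed auto

lemma length_filter_id_Not: "int (length (filter Not ds)) = int (length ds) - int (length (filter id ds))"
  by (induction ds) auto

lemma path_end_walk: "path_end (0, 0) ds = (walk ds (int (length ds)), int (length ds) - walk ds (int (length ds)))"
  by (simp add: path_end_eq length_filter_id_Not walk_def)

lemma walk_0 [simp]: "walk ds 0 = 0"
  by (simp add: walk_def)

lemma walk_step: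
  assumes "i < length ds"
  shows "walk ds (int i + 1) = walk ds (int i) + (if ds ! i then 1 else 0)"
proof -
  have "nat (int i + 1) = Suc i" by simp
  then show ?thesis using assms by (simp add: walk_def take_Suc_conv_app_nth)
qed

lemma nepath_walk: "nepath 0 (int (length ds)) (walk ds)"
  unfolding nepath_def
proof
  fix n assume "n \<in> {0..<int (length ds)}"
  then obtain i where "n = int i" "i < length ds" by (metis atLeastLessThan_iff nat_0_le of_nat_less_iff)
  then show "walk ds (n + 1) = walk ds n \<or> walk ds (n + 1) = walk ds n + 1" using walk_step by auto
qed

lemma path_edges_nth:
  "i < length ds \<Longrightarrow> path_edges u ds ! i = (path_end u (take i ds), ds ! i)"
proof (induction ds arbitrary: u i)
  case (Cons d ds)
  then show ?case by (cases i) auto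
qed auto

lemma length_path_edges [simp]: "length (path_edges u ds) = length ds"
  by (induction ds arbitrary: u) auto

lemma path_edges_walk:
  assumes "i < length ds"
  shows "path_edges (0, 0) ds ! i = edge_at (walk ds) (int i)"
proof -
  have "walk (take i ds) (int i) = walk ds (int i)" by (simp add: walk_def)
  then show ?thesis using assms path_end_walk[of "take i ds"] walk_step[OF assms]
    by (auto simp: path_edges_nth edge_at_def)
qed

lemma opath_walk:
  "opath \<omega> 0 (int (length ds)) (walk ds) \<longleftrightarrow> (\<forall>e\<in>set (path_edges (0, 0) ds). \<omega> e)"
proof -
  have "(\<forall>e\<in>set (path_edges (0, 0) ds). \<omega> e) \<longleftrightarrow> (\<forall>i<length ds. \<omega> (edge_at (walk ds) (int i)))"
    by (auto simp: all_set_conv_all_nth path_edges_walk)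
  also have "\<dots> \<longleftrightarrow> (\<forall>n\<in>{0..<int (length ds)}. \<omega> (edge_at (walk ds) n))"
    by (auto simp: image_int_atLeastLessThan[of 0, simplified, symmetric] simp del: image_int_atLeastLessThan)
  finally show ?thesis using nepath_walk by (simp add: opath_def)
qed

lemma nepath_obtain_list:
  assumes "nepath 0 (int n) f" "f 0 = 0"
  obtains ds where "length ds = n" "\<And>i. i \<in> {0..int n} \<Longrightarrow> walk ds i = f i"
proof -
  define ds where "ds = map (\<lambda>i. f (int i + 1) \<noteq> f (int i)) [0..<n]"
  have "walk ds (int i) = f (int i)" if "i \<le> n" for i
    using that
  proof (induction i)
    case (Suc i)
    have "f (int i + 1) = f (int i) \<or> f (int i + 1) = f (int i) + 1"
      using assms(1) Suc.prems by (auto simp: nepath_def)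
    then show ?case using walk_step[of i ds] Suc by (auto simp: ds_def add.commute)
  qed (use assms in auto)
  then have "walk ds i = f i" if "i \<in> {0..int n}" for i
    using that by (metis atLeastAtMost_iff nat_0_le nat_int nat_le_iff)
  then show thesis using that[of ds] by (simp add: ds_def)
qed

lemma opath_cong:
  assumes "\<And>n. n \<in> {a..b} \<Longrightarrow> f n = g n"
  shows "opath \<omega> a b f \<longleftrightarrow> opath \<omega> a b g"
  using assms unfolding opath_def nepath_def edge_at_def by (intro conj_cong ball_cong) auto

lemma open_cluster_levels:
  "v \<in> open_cluster \<omega> \<longleftrightarrow> (\<exists>n f. opath \<omega> 0 (int n) f \<and> f 0 = 0 \<and> v = (f (int n), int n - f (int n)))"
proof
  assume "v \<in> open_cluster \<omega>"
  then obtain ds where ds: "path_end (0, 0) ds = v" "\<forall>e\<in>set (path_edges (0, 0) ds). \<omega> e"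
    by (auto simp: open_cluster_def)
  then show "\<exists>n f. opath \<omega> 0 (int n) f \<and> f 0 = 0 \<and> v = (f (int n), int n - f (int n))"
    by (intro exI[of _ "length ds"] exI[of _ "walk ds"]) (auto simp: opath_walk path_end_walk)
next
  assume "\<exists>n f. opath \<omega> 0 (int n) f \<and> f 0 = 0 \<and> v = (f (int n), int n - f (int n))"
  then obtain n f where f: "opath \<omega> 0 (int n) f" "f 0 = 0" "v = (f (int n), int n - f (int n))" by blast
  then have "nepath 0 (int n) f" by (simp add: opath_def)
  from nepath_obtain_list[OF this f(2)] obtain ds where ds: "length ds = n" "\<And>i. i \<in> {0..int n} \<Longrightarrow> walk ds i = f i" by blast
  have "opath \<omega> 0 (int (length ds)) (walk ds)"
    using f(1) opath_cong[of 0 "int n" "walk ds" f \<omega>] ds by simp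
  then have "\<forall>e\<in>set (path_edges (0, 0) ds). \<omega> e" unfolding opath_walk .
  moreover have "path_end (0, 0) ds = v" using f(3) ds by (simp add: path_end_walk)
  ultimately show "v \<in> open_cluster \<omega>" by (auto simp: open_cluster_def)
qed

text \<open>The cluster has finitely many vertices below any level, and initial pieces of open paths
  are open. Conversely each level reached contributes a vertex of its own.\<close>

lemma infinite_cluster_iff: "infinite (open_cluster \<omega>) \<longleftrightarrow> (\<forall>n. reaches \<omega> n 0)"
proof
  assume inf: "infinite (open_cluster \<omega>)"
  show "\<forall>n. reaches \<omega> n 0"
  proof
    fix n
    have "\<not> open_cluster \<omega> \<subseteq> {0..int n} \<times> {0..int n}"
      using inf finite_subset by blast
    then obtain v where v: "v \<in> open_cluster \<omega>" "v \<notin> {0..int n} \<times> {0..int n}" by auto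
    then obtain m f where f: "opath \<omega> 0 (int m) f" "f 0 = 0" "v = (f (int m), int m - f (int m))"
      unfolding open_cluster_levels by blast
    have "0 \<le> f (int m) \<and> f (int m) \<le> int m"
      using nepath_bounds[of 0 "int m" f 0 "int m"] f by (auto simp: opath_def)
    then have "n \<le> m" using v(2) f(3) by auto
    then have "opath \<omega> 0 (int n) f" by (intro opath_mono[OF f(1)]) auto
    then show "reaches \<omega> n 0" using f(2) by (auto simp: reaches_def opath_def)
  qed
next
  assume r: "\<forall>n. reaches \<omega> n 0"
  have "\<exists>v. v \<in> open_cluster \<omega> \<and> fst v + snd v = int n" for n
  proof -
    obtain f where "opath \<omega> 0 (int n) f" "f 0 = 0"
      using r[rule_format, of n] unfolding reaches_def by blast
    then have "(f (int n), int n - f (int n)) \<in> open_cluster \<omega>" unfolding open_cluster_levels by blast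
    then show ?thesis by (intro exI[of _ "(f (int n), int n - f (int n))"]) simp
  qed
  then have "range int \<subseteq> (\<lambda>v. fst v + snd v) ` open_cluster \<omega>" by (metis (no_types, lifting) image_eqI image_subset_iff rangeE subsetI)
  moreover have "infinite (range int)" by (simp add: finite_image_iff)
  ultimately show "infinite (open_cluster \<omega>)" using finite_subset finite_imageI by blast
qed

section \<open>Percolation probability and its critical value\<close>

lemma sets_infinite_cluster: "{\<omega>. infinite (open_cluster \<omega>)} \<in> sets (perc_measure p)"
proof -
  have "{\<omega>. infinite (open_cluster \<omega>)} = (\<Inter>n. {\<omega>. reaches \<omega> n 0})" by (auto simp: infinite_cluster_iff)
  then show ?thesis using sets_determined[OF finite_slab determined_reaches] by auto
qed

lemma perc_prob_eq: "perc_prob p = Pr p (\<lambda>\<omega>. infinite (open_cluster \<omega>))"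
  by (simp add: perc_prob_def)

text \<open>Continuity from above: the events decrease to that of an infinite cluster.\<close>

lemma perc_prob_ge:
  assumes "\<And>n. c \<le> Pr p (\<lambda>\<omega>. reaches \<omega> n 0)"
  shows "c \<le> perc_prob p"
proof -
  interpret prob_space "perc_measure p" by (rule prob_space_perc)
  have dec: "decseq (\<lambda>n. {\<omega>. reaches \<omega> n 0})"
  proof (rule decseq_SucI, safe)
    fix n \<omega> assume "reaches \<omega> (Suc n) 0"
    then obtain f where f: "opath \<omega> 0 (int (Suc n)) f" "f 0 = 0" by (auto simp: reaches_def)
    have "opath \<omega> 0 (int n) f" by (rule opath_mono[OF f(1)]) auto
    then show "reaches \<omega> n 0" using f(2) by (auto simp: reaches_def opath_def)
  qed
  have "(\<lambda>n. Pr p (\<lambda>\<omega>. reaches \<omega> n 0)) \<longlonglongrightarrow> prob (\<Inter>n. {\<omega>. reaches \<omega> n 0})"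
    by (rule finite_Lim_measure_decseq[OF _ dec]) (auto intro: sets_determined[OF finite_slab determined_reaches])
  moreover have "(\<Inter>n. {\<omega>. reaches \<omega> n 0}) = {\<omega>. infinite (open_cluster \<omega>)}" by (auto simp: infinite_cluster_iff)
  ultimately have "(\<lambda>n. Pr p (\<lambda>\<omega>. reaches \<omega> n 0)) \<longlonglongrightarrow> perc_prob p" by (simp add: perc_prob_eq)
  then show ?thesis by (rule LIMSEQ_le_const) (use assms in auto)
qed

lemma perc_prob_mono:
  assumes "0 \<le> p" "p \<le> q" "q \<le> 1"
  shows "perc_prob p \<le> perc_prob q"
  unfolding perc_prob_eq
proof (rule Pr_increasing[OF sets_infinite_cluster _ assms])
  fix \<omega> \<omega>' :: "edge \<Rightarrow> bool" assume "\<And>e. \<omega> e \<Longrightarrow> \<omega>' e" "infinite (open_cluster \<omega>)"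
  then show "infinite (open_cluster \<omega>')" unfolding infinite_cluster_iff reaches_def opath_def by meson
qed

text \<open>Makes the set in \<open>oriented_pc\<close> nonempty, so that its supremum is
  meaningful, and settles density 0 in the argument at criticality. An infinite cluster requires an
  open edge at the origin.\<close>

lemma perc_prob_0: "perc_prob 0 = 0"
proof -
  have s: "{\<omega>. \<omega> e} \<in> sets (perc_measure 0)" for e :: edge
    using sets_determined[of "{e}" "\<lambda>\<omega>. \<omega> e"] by (simp add: determined_def)
  have one: "Pr 0 (\<lambda>\<omega>. \<omega> e) = 0" for e
  proof -
    have "Pr 0 (\<lambda>\<omega>. \<omega> e) = measure (distr (perc_measure 0) (measure_pmf (bernoulli_pmf 0)) (\<lambda>\<omega>. \<omega> e)) {True}"
      unfolding perc_measure_def by (subst measure_distr) (auto simp: vimage_def space_PiM)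
    also have "\<dots> = measure (measure_pmf (bernoulli_pmf 0)) {True}"
      unfolding perc_measure_def by (subst distr_PiM_component) (auto intro: measure_pmf.prob_space_axioms)
    also have "\<dots> = 0" by (simp add: measure_pmf_single)
    finally show ?thesis .
  qed
  interpret prob_space "perc_measure 0" by (rule prob_space_perc)
  have "perc_prob 0 \<le> prob ({\<omega>. \<omega> ((0, 0), True)} \<union> {\<omega>. \<omega> ((0, 0), False)})"
    unfolding perc_prob_eq
  proof (rule finite_measure_mono)
    show "{\<omega>. infinite (open_cluster \<omega>)} \<subseteq> {\<omega>. \<omega> ((0, 0), True)} \<union> {\<omega>. \<omega> ((0, 0), False)}"
    proof safe
      fix \<omega> assume "infinite (open_cluster \<omega>)" "\<not> \<omega> ((0, 0), False)"
      then obtain f where "opath \<omega> 0 (int 1) f" "f 0 = 0" unfolding infinite_cluster_iff reaches_def by blast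
      then have "\<omega> ((0, 0), f 1 \<noteq> 0)" using bspec[of "{0..<1}" _ 0] by (force simp: opath_def edge_at_def)
      then show "\<omega> ((0, 0), True)" using \<open>\<not> \<omega> ((0, 0), False)\<close> by (cases "f 1 = 0") auto
    qed
  qed (use s in auto)
  also have "\<dots> \<le> prob {\<omega>. \<omega> ((0, 0), True)} + prob {\<omega>. \<omega> ((0, 0), False)}"
    by (rule measure_Un_le[OF s s])
  finally show ?thesis using one by (simp add: perc_prob_eq order.antisym)
qed

lemma oriented_pc_bounds: "0 \<le> oriented_pc" "oriented_pc \<le> 1"
proof -
  have 0: "0 \<in> {p \<in> {0..1}. perc_prob p = 0}" using perc_prob_0 by simp
  show "0 \<le> oriented_pc" unfolding oriented_pc_def by (rule cSup_upper[OF 0]) (auto intro: bdd_aboveI[of _ 1])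
  show "oriented_pc \<le> 1" unfolding oriented_pc_def
  proof (rule cSup_least)
    show "{p \<in> {0..1}. perc_prob p = 0} \<noteq> {}" using 0 by blast
  qed auto
qed

lemma perc_prob_below_pc:
  assumes "0 \<le> p" "p < oriented_pc \<or> p = 0"
  shows "perc_prob p = 0"
proof (cases "p = 0")
  case False
  then have "p < Sup {p \<in> {0..1}. perc_prob p = 0}" using assms by (simp add: oriented_pc_def)
  moreover have "0 \<in> {p \<in> {0..1}. perc_prob p = 0}" using perc_prob_0 by simp
  ultimately obtain q where "q \<in> {p \<in> {0..1}. perc_prob p = 0}" "p < q"
    by (blast elim: less_cSupE)
  then have "perc_prob p \<le> 0" using perc_prob_mono[of p q] assms by auto
  then show ?thesis by (simp add: perc_prob_eq order.antisym)
qed (simp add: perc_prob_0)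

text \<open>Openness in \<open>p\<close> of the finite-size criterion is what excludes it at \<open>p\<^sub>c\<close> itself.\<close>
lemma tube_fail_at_pc:
  fixes s :: real
  assumes s: "0 < s" "s \<le> 1/2" and W: "1 \<le> W" "12 * real_of_int W \<le> s * H" and K0: "288 \<le> s * K0" "1 \<le> K0"
    and H: "0 < H"
  shows "1 / (256 * (real K0)\<^sup>2) \<le> tube_fail oriented_pc s W (2 * H)"
proof (rule ccontr)
  assume neg: "\<not> ?thesis"
  define g where "g = 1 / (256 * (real K0)\<^sup>2) - tube_fail oriented_pc s W (2 * H)"
  have g: "0 < g" using neg by (simp add: g_def)
  define N where "N = card (tube_edges s W (2 * H) 0 0)"
  \<comment> \<open>The Lipschitz bound over \<open>N\<close> edges changes the probability by at
    most \<open>g\<close>. If the shift would pass below 0, then \<open>p = 0\<close>, and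
    \<open>perc_prob_0\<close> takes the place of \<open>p < oriented_pc\<close>.\<close>
  define p where "p = max 0 (oriented_pc - g / (N + 1))"
  have d: "0 < g / (N + 1)" using g by simp
  have p: "0 \<le> p" "p \<le> 1" "p < oriented_pc \<or> p = 0"
    using oriented_pc_bounds d by (auto simp: p_def max_def)
  have "\<bar>tube_fail p s W (2 * H) - tube_fail oriented_pc s W (2 * H)\<bar> \<le> N * \<bar>oriented_pc - p\<bar>"
    unfolding N_def using Pr_Lipschitz[OF finite_tube_edges determined_not_tube[of s W "2 * H" 0 0], of p oriented_pc] oriented_pc_bounds p by simp
  also have "\<dots> \<le> N * (g / (N + 1))"
    using d oriented_pc_bounds by (intro mult_left_mono) (auto simp: p_def max_def)
  also have "\<dots> \<le> g" using g by (simp add: field_simps)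
  finally have "tube_fail p s W (2 * H) \<le> 1 / (256 * (real K0)\<^sup>2)" by (simp add: g_def)
  from perc_prob_ge[OF reaches_lower_bound[OF s W K0 H this]]
  have "1 / (2 * (2 * real_of_int W + 1)) \<le> perc_prob p" .
  moreover have "0 < 1 / (2 * (2 * real_of_int W + 1))" using W by simp
  ultimately show False using perc_prob_below_pc[OF p(1,3)] by simp
qed

section \<open>The speed of the right edge at criticality\<close>

lemma determined_disp_less: "determined (slab 0 (int m) (- int m) (int m)) (\<lambda>\<omega>. real (edge_disp \<omega> 0 m 0) < y)"
  using determined_comp[OF determined_edge_disp[of 0 m 0], of "\<lambda>j. real j < y"] by simp

lemma determined_disp: "determined (slab 0 (int m) (- int m) (int m)) (\<lambda>\<omega>. edge_disp \<omega> 0 m 0)"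
  using determined_edge_disp[of 0 m 0] by simp

text \<open>A budget of 0 closed edges describes open paths, a special case of the budget in
  \<open>cheap_path_decay\<close>.\<close>

lemma overshoot_tendsto_0:
  assumes "0 < m" "0 \<le> a" "Exp p (\<lambda>\<omega>. edge_disp \<omega> 0 m 0) < a * real m"
  shows "(\<lambda>n. Pr p (\<lambda>\<omega>. cheap_path \<omega> n (a * real n) 0)) \<longlonglongrightarrow> 0"
proof -
  obtain C c \<delta> :: real where C: "0 < C" "0 < c" "0 < \<delta>"
    "\<And>n. Pr p (\<lambda>\<omega>. cheap_path \<omega> n (a * real n) (\<delta> * real n)) \<le> C * exp (- c * real n)"
    using cheap_path_decay[OF assms] by blast
  have le: "Pr p (\<lambda>\<omega>. cheap_path \<omega> n (a * real n) 0) \<le> C * exp (- c * real n)" for n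
  proof (rule order.trans[OF Pr_mono C(4)])
    show "determined (slab 0 (int n) (- int n) (int n)) (\<lambda>\<omega>. cheap_path \<omega> n (a * real n) (\<delta> * real n))"
      using assms(2) by (intro determined_cheap_path) auto
    show "cheap_path \<omega> n (a * real n) 0 \<Longrightarrow> cheap_path \<omega> n (a * real n) (\<delta> * real n)" for \<omega>
      using C(3) unfolding cheap_path_def by (force intro: order.trans[of _ 0])
  qed auto
  have "(\<lambda>n. C * exp (- c * real n)) \<longlonglongrightarrow> 0" using C(2) by real_asymp
  then show ?thesis by (rule tendsto_sandwich[rotated 3, where f = "\<lambda>_. 0"]) (use le in auto)
qed

lemma crossing_imp_cheap:
  assumes "crossing \<omega> 0 (int n) 0 z" "y \<le> real_of_int z"
  shows "cheap_path \<omega> n y 0"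
proof -
  obtain f where f: "nepath 0 (int n) f" "f 0 \<le> 0" "z \<le> f (int n)" "opath \<omega> 0 (int n) f"
    using assms(1) by (auto simp: crossing_def)
  have "closed_count \<omega> f 0 (int n) = 0"
    unfolding closed_count_def card_0_eq[OF finite_closed] using f(4) by (auto simp: opath_def)
  moreover have "y \<le> f (int n)" using f(3) assms(2) by linarith
  ultimately show ?thesis unfolding cheap_path_def using f by (intro exI[of _ f]) auto
qed

text \<open>\<open>\<alpha>\<close> stands for the infimum over \<open>m\<close> of the mean of
  \<open>edge_disp\<close> divided by \<open>m\<close>; the last two assumptions are the two halves
  of being this infimum.\<close>

locale edge_speed =
  fixes p \<alpha> :: real
  assumes alpha: "1/2 < \<alpha>" "\<alpha> \<le> 1"
    and lower: "\<And>m. 0 < m \<Longrightarrow> \<alpha> * real m \<le> Exp p (\<lambda>\<omega>. edge_disp \<omega> 0 m 0)"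
    and upper: "\<And>\<epsilon>. 0 < \<epsilon> \<Longrightarrow> \<exists>m>0. Exp p (\<lambda>\<omega>. edge_disp \<omega> 0 m 0) < (\<alpha> + \<epsilon>) * real m"
begin

lemma overshoot: "0 < \<epsilon> \<Longrightarrow> (\<lambda>n. Pr p (\<lambda>\<omega>. cheap_path \<omega> n ((\<alpha> + \<epsilon>) * real n) 0)) \<longlonglongrightarrow> 0"
  using upper[of \<epsilon>] alpha by (auto intro!: overshoot_tendsto_0)

text \<open>The mean is at least \<open>\<alpha> n\<close> and overshoots are rare, so undershoots must be rare as well.\<close>
lemma undershoot_le:
  assumes "0 < \<epsilon>" "0 < \<epsilon>'" "0 < n"
  shows "\<epsilon>' * Pr p (\<lambda>\<omega>. real (edge_disp \<omega> 0 n 0) < (\<alpha> - \<epsilon>') * real n)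
     \<le> \<epsilon> + Pr p (\<lambda>\<omega>. cheap_path \<omega> n ((\<alpha> + \<epsilon>) * real n) 0)"
proof -
  let ?Y = "\<lambda>\<omega>. real (edge_disp \<omega> 0 n 0)"
  let ?A = "\<lambda>\<omega>. cheap_path \<omega> n ((\<alpha> + \<epsilon>) * real n) 0" and ?B = "\<lambda>\<omega>. ?Y \<omega> < (\<alpha> - \<epsilon>') * real n"
  let ?S = "slab 0 (int n) (- int n) (int n)"
  have dA: "determined ?S ?A" using assms alpha by (intro determined_cheap_path) auto
  have dB: "determined ?S ?B" by (rule determined_disp_less)
  have iA: "integrable (perc_measure p) (\<lambda>\<omega>. of_bool (?A \<omega>) :: real)"
    by (rule integrable_determined[OF finite_slab determined_comp[OF dA]])
  have iB: "integrable (perc_measure p) (\<lambda>\<omega>. of_bool (?B \<omega>) :: real)"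
    by (rule integrable_determined[OF finite_slab determined_comp[OF dB]])
  \<comment> \<open>On \<open>?B\<close> its definition applies, on \<open>?A\<close> the trivial
    bound \<open>n\<close>; outside \<open>?A\<close> an excess over
    \<open>(\<alpha> + \<epsilon>) * real n\<close> is impossible.\<close>
  have pt: "?Y \<omega> \<le> (\<alpha> + \<epsilon>) * real n + real n * of_bool (?A \<omega>) - \<epsilon>' * real n * of_bool (?B \<omega>)" for \<omega>
  proof (cases "?B \<omega>")
    case True
    have "0 \<le> \<epsilon> * real n" "0 \<le> real n * of_bool (?A \<omega>)" using assms by auto
    then show ?thesis using True by (simp add: algebra_simps)
  next
    case B: False
    show ?thesis
    proof (cases "?Y \<omega> \<le> (\<alpha> + \<epsilon>) * real n")
      case True
      then show ?thesis using B by simp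
    next
      case False
      moreover have "0 \<le> (\<alpha> + \<epsilon>) * real n" using assms alpha by simp
      ultimately have "0 < edge_disp \<omega> 0 n 0" by linarith
      from edge_disp_crossing[OF this] have "crossing \<omega> 0 (int n) 0 (int (edge_disp \<omega> 0 n 0))" by simp
      then have "?A \<omega>" by (rule crossing_imp_cheap) (use False in auto)
      moreover have "?Y \<omega> \<le> real n" by (simp add: edge_disp_le)
      ultimately show ?thesis using B \<open>0 \<le> (\<alpha> + \<epsilon>) * real n\<close> by simp
    qed
  qed
  interpret prob_space "perc_measure p" by (rule prob_space_perc)
  have "\<alpha> * real n \<le> Exp p ?Y" by (rule lower[OF assms(3)])
  also have "\<dots> \<le> Exp p (\<lambda>\<omega>. (\<alpha> + \<epsilon>) * real n + real n * of_bool (?A \<omega>) - \<epsilon>' * real n * of_bool (?B \<omega>))"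
    using pt iA iB by (intro integral_mono integrable_determined[OF finite_slab determined_comp[OF determined_disp]]) auto
  also have "\<dots> = (\<alpha> + \<epsilon>) * real n + real n * Pr p ?A - \<epsilon>' * real n * Pr p ?B"
    using iA iB Exp_indicator[OF finite_slab dA, of p] Exp_indicator[OF finite_slab dB, of p] prob_space by simp
  finally have "real n * (\<epsilon>' * Pr p ?B) \<le> real n * (\<epsilon> + Pr p ?A)" by (simp add: algebra_simps)
  then show ?thesis using assms by simp
qed

lemma undershoot:
  assumes "0 < \<epsilon>'"
  shows "(\<lambda>n. Pr p (\<lambda>\<omega>. real (edge_disp \<omega> 0 n 0) < (\<alpha> - \<epsilon>') * real n)) \<longlonglongrightarrow> 0"
proof (rule LIMSEQ_I)
  fix r :: real assume r: "0 < r"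
  \<comment> \<open>Two contributions of size \<open>\<epsilon>\<close> must stay below
    \<open>\<epsilon>' * r\<close>.\<close>
  define \<epsilon> where "\<epsilon> = r * \<epsilon>' / 3"
  have e: "0 < \<epsilon>" using r assms by (simp add: \<epsilon>_def)
  have "\<forall>\<^sub>F n in sequentially. Pr p (\<lambda>\<omega>. cheap_path \<omega> n ((\<alpha> + \<epsilon>) * real n) 0) < \<epsilon>"
    using order_tendstoD(2)[OF overshoot[OF e] e] .
  then obtain N where N: "\<And>n. N \<le> n \<Longrightarrow> Pr p (\<lambda>\<omega>. cheap_path \<omega> n ((\<alpha> + \<epsilon>) * real n) 0) < \<epsilon>"
    by (auto simp: eventually_sequentially)
  show "\<exists>N. \<forall>n\<ge>N. norm (Pr p (\<lambda>\<omega>. real (edge_disp \<omega> 0 n 0) < (\<alpha> - \<epsilon>') * real n) - 0) < r"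
  proof (intro exI allI impI)
    fix n assume n: "max N 1 \<le> n"
    have "\<epsilon>' * Pr p (\<lambda>\<omega>. real (edge_disp \<omega> 0 n 0) < (\<alpha> - \<epsilon>') * real n) < \<epsilon> + \<epsilon>"
      using undershoot_le[OF e assms, of n] N[of n] n by linarith
    also have "\<dots> < \<epsilon>' * r" using r assms by (simp add: \<epsilon>_def)
    finally show "norm (Pr p (\<lambda>\<omega>. real (edge_disp \<omega> 0 n 0) < (\<alpha> - \<epsilon>') * real n) - 0) < r"
      using assms by simp
  qed
qed

text \<open>An excess of \<open>h\<close> over \<open>k * h\<close> levels is the fixed relative
  excess \<open>1 / k\<close>, so the overshoot estimate applies as \<open>h\<close> grows.\<close>

lemma crossing_tendsto_0:
  assumes k: "0 < k"
  shows "(\<lambda>h. Pr p (\<lambda>\<omega>. crossing \<omega> 0 (int (k * h)) 0 \<lceil>\<alpha> * real (k * h) + real h\<rceil>)) \<longlonglongrightarrow> 0"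
proof (rule tendsto_sandwich[of "\<lambda>_. 0"])
  let ?e = "1 / real k"
  have e: "0 < ?e" using k by simp
  have "filterlim (\<lambda>h. k * h) at_top sequentially"
    using k by (intro filterlim_subseq strict_monoI) auto
  from filterlim_compose[OF overshoot[OF e] this]
  show "(\<lambda>h. Pr p (\<lambda>\<omega>. cheap_path \<omega> (k * h) ((\<alpha> + ?e) * real (k * h)) 0)) \<longlonglongrightarrow> 0" .
  show "\<forall>\<^sub>F h in sequentially. Pr p (\<lambda>\<omega>. crossing \<omega> 0 (int (k * h)) 0 \<lceil>\<alpha> * real (k * h) + real h\<rceil>)
      \<le> Pr p (\<lambda>\<omega>. cheap_path \<omega> (k * h) ((\<alpha> + ?e) * real (k * h)) 0)"
  proof (intro always_eventually allI Pr_mono)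
    fix h \<omega> assume "crossing \<omega> 0 (int (k * h)) 0 \<lceil>\<alpha> * real (k * h) + real h\<rceil>"
    then show "cheap_path \<omega> (k * h) ((\<alpha> + ?e) * real (k * h)) 0"
    proof (rule crossing_imp_cheap)
      have "(\<alpha> + ?e) * real (k * h) = \<alpha> * real (k * h) + real h" using k by (simp add: field_simps)
      then show "(\<alpha> + ?e) * real (k * h) \<le> real_of_int \<lceil>\<alpha> * real (k * h) + real h\<rceil>" by linarith
    qed
  next
    show "determined (slab 0 (int (k * h)) (- int (k * h)) (int (k * h))) (\<lambda>\<omega>. cheap_path \<omega> (k * h) ((\<alpha> + ?e) * real (k * h)) 0)" for h
      using e alpha by (intro determined_cheap_path) auto
  qed auto
qed auto

text \<open>An open path that ends nearly as far right as possible cannot stray at the grid levels: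
  to the right it would overshoot, and from the left its remainder would have to overshoot to catch
  up. The case \<open>i = 0\<close> of \<open>low\<close> also locates the start, although the path
  comes from a half-line.\<close>

lemma tube_of_grid:
  assumes h: "0 < h" and J: "2 \<le> J"
    and up: "\<And>j. j \<in> {1..J} \<Longrightarrow> \<not> crossing \<omega> 0 (int (j * h)) 0 \<lceil>\<alpha> * real (j * h) + real h\<rceil>"
    and low: "\<And>i j. i + j = J \<Longrightarrow> 0 < j \<Longrightarrow> \<not> crossing \<omega> (int (i * h)) (int (J * h)) \<lceil>\<alpha> * real (i * h) - 4 * real h\<rceil>
        (\<lceil>\<alpha> * real (i * h) - 4 * real h\<rceil> + \<lceil>\<alpha> * real (j * h) + real h\<rceil>)"
    and disp: "(\<alpha> - 1 / real J) * real (J * h) \<le> real (edge_disp \<omega> 0 (J * h) 0)"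
  shows "has_tube \<omega> (\<alpha> - 1/2) (5 * int h) (int (J * h)) 0 0"
proof -
  have hr: "1 \<le> real h" using h by simp
  \<comment> \<open>The displacement has to be positive: the truncation value 0 would provide no
    path.\<close>
  have "1 / real J \<le> 1/2" using J by (simp add: field_simps)
  then have "0 < \<alpha> - 1 / real J" using alpha by linarith
  then have "0 < (\<alpha> - 1 / real J) * real (J * h)" using J h by (intro mult_pos_pos) auto
  then have "0 < edge_disp \<omega> 0 (J * h) 0" using disp by linarith
  from edge_disp_crossing[OF this] obtain f where f: "opath \<omega> 0 (int (J * h)) f" "f 0 \<le> 0"
      "int (edge_disp \<omega> 0 (J * h) 0) \<le> f (int (J * h))"
    by (auto simp: crossing_def)
  have np: "nepath 0 (int (J * h)) f" using f(1) by (simp add: opath_def)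
  have "(\<alpha> - 1 / real J) * real (J * h) = \<alpha> * real (J * h) - real h" using J by (simp add: field_simps)
  then have fend: "\<alpha> * real (J * h) - real h \<le> f (int (J * h))" using disp f(3) by linarith
  have grid: "- 4 * real h \<le> f (int (i * h)) - \<alpha> * real (i * h) \<and> f (int (i * h)) - \<alpha> * real (i * h) \<le> real h"
    if i: "i \<le> J" for i
  proof
    have ih: "int (i * h) \<le> int (J * h)" using i by (simp only: of_nat_le_iff mult_le_mono1)
    show "f (int (i * h)) - \<alpha> * real (i * h) \<le> real h"
    proof (cases "i = 0")
      case False
      then have nc: "\<not> crossing \<omega> 0 (int (i * h)) 0 \<lceil>\<alpha> * real (i * h) + real h\<rceil>" using i by (intro up) auto
      have "opath \<omega> 0 (int (i * h)) f" by (rule opath_mono[OF f(1)]) (use ih in auto)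
      then have "\<not> \<lceil>\<alpha> * real (i * h) + real h\<rceil> \<le> f (int (i * h))"
        using nc f(2) unfolding crossing_def opath_def by blast
      then show ?thesis by linarith
    qed (use f(2) in auto)
    show "- 4 * real h \<le> f (int (i * h)) - \<alpha> * real (i * h)"
    proof (rule ccontr)
      assume c: "\<not> ?thesis"
      then have "i \<noteq> J" using fend by auto
      define j where "j = J - i"
      have j: "i + j = J" "0 < j" using i \<open>i \<noteq> J\<close> by (auto simp: j_def)
      let ?z = "\<lceil>\<alpha> * real (i * h) - 4 * real h\<rceil>"
      have "opath \<omega> (int (i * h)) (int (J * h)) f" by (rule opath_mono[OF f(1)]) auto
      moreover have "f (int (i * h)) \<le> ?z" using c by linarith
      ultimately have "\<not> ?z + \<lceil>\<alpha> * real (j * h) + real h\<rceil> \<le> f (int (J * h))"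
        using low[OF j] unfolding crossing_def opath_def by blast
      \<comment> \<open>The offset \<open>4 * h\<close> leaves the path \<open>2 * h - 1\<close>
        short of its known end, where 1 is the rounding of \<open>?z\<close>.\<close>
      then have "real_of_int (f (int (J * h))) < \<alpha> * real (i * h) - 4 * real h + 1 + \<alpha> * real (j * h) + real h" by linarith
      also have "\<dots> = \<alpha> * real (J * h) - 3 * real h + 1" by (simp add: j(1)[symmetric] algebra_simps)
      finally show False using fend hr by linarith
    qed
  qed
  \<comment> \<open>Between grid levels the path and the line of slope \<open>\<alpha>\<close> each
    advance by at most \<open>h\<close>, so 4 becomes 5.\<close>
  have "\<bar>real_of_int (f n) - \<alpha> * n\<bar> \<le> 5 * real h" if n: "n \<in> {0..int (J * h)}" for n
  proof -
    define i where "i = nat n div h"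
    define u where "u = n - int (i * h)"
    have ni: "n = int (i * h) + u" by (simp add: u_def)
    have u: "0 \<le> u" "u \<le> int h"
    proof -
      have "nat n = i * h + nat n mod h" by (simp add: i_def)
      then have "n = int (i * h) + int (nat n mod h)" using n by (metis atLeastAtMost_iff nat_0_le of_nat_add)
      moreover have "nat n mod h < h" using h by simp
      ultimately show "0 \<le> u" "u \<le> int h" unfolding u_def by linarith+
    qed
    have "i \<le> J" using n h unfolding i_def
      by (metis atLeastAtMost_iff div_le_mono div_mult_self_is_m nat_le_iff)
    note g = grid[OF this]
    have "f (int (i * h)) \<le> f n \<and> f n \<le> f (int (i * h)) + (n - int (i * h))"
      by (rule nepath_bounds[OF np]) (use n u ni in auto)
    then have "real_of_int (f (int (i * h))) \<le> f n" "real_of_int (f n) \<le> f (int (i * h)) + u" using ni by linarith+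
    moreover have "\<alpha> * n = \<alpha> * real (i * h) + \<alpha> * u" by (simp add: ni algebra_simps)
    moreover have "0 \<le> \<alpha> * u" "\<alpha> * u \<le> u" using u alpha by (auto intro: mult_left_le_one_le)
    moreover have "real_of_int u \<le> real h" using u by linarith
    ultimately show ?thesis using g by linarith
  qed
  then show ?thesis using f(1) unfolding has_tube_def tube_def by (intro exI[of _ f]) auto
qed

text \<open>\<open>J\<close> is fixed while \<open>h\<close> grows, so there are
  \<open>2 * J + 1\<close> bad events, each of vanishing probability. Those excluded in
  \<open>low\<close> are translates of those excluded in \<open>up\<close>.\<close>

lemma tube_fail_tendsto_0:
  assumes J: "2 \<le> J"
  shows "(\<lambda>h. tube_fail p (\<alpha> - 1/2) (5 * int h) (int (J * h))) \<longlonglongrightarrow> 0"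
proof (rule tendsto_sandwich[of "\<lambda>_. 0"])
  define A where "A h j = (\<lambda>\<omega>. crossing \<omega> 0 (int (j * h)) 0 \<lceil>\<alpha> * real (j * h) + real h\<rceil>)" for h j
  define z where "z h j = \<lceil>\<alpha> * real ((J - j) * h) - 4 * real h\<rceil>" for h j
  define B where "B h j = (\<lambda>\<omega>. crossing \<omega> (int ((J - j) * h)) (int (J * h)) (z h j) (z h j + \<lceil>\<alpha> * real (j * h) + real h\<rceil>))" for h j
  define U where "U h = (\<lambda>\<omega>. real (edge_disp \<omega> 0 (J * h) 0) < (\<alpha> - 1 / real J) * real (J * h))" for h
  have "filterlim (\<lambda>h. J * h) at_top sequentially"
    using J by (intro filterlim_subseq strict_monoI) auto
  from filterlim_compose[OF undershoot this, of "1 / real J"]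
  have lim_U: "(\<lambda>h. Pr p (U h)) \<longlonglongrightarrow> 0" using J by (simp add: U_def)
  have lim_A: "(\<lambda>h. Pr p (A h j)) \<longlonglongrightarrow> 0" if "j \<in> {1..J}" for j
    unfolding A_def by (rule crossing_tendsto_0) (use that in auto)
  have "(\<lambda>h. (\<Sum>j\<in>{1..J}. Pr p (A h j) + Pr p (A h j)) + Pr p (U h)) \<longlonglongrightarrow> (\<Sum>j\<in>{1..J}. 0 + 0) + 0"
    by (intro tendsto_intros lim_A lim_U)
  then show "(\<lambda>h. (\<Sum>j\<in>{1..J}. Pr p (A h j) + Pr p (A h j)) + Pr p (U h)) \<longlonglongrightarrow> 0" by simp
  show "\<forall>\<^sub>F h in sequentially. tube_fail p (\<alpha> - 1/2) (5 * int h) (int (J * h))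
      \<le> (\<Sum>j\<in>{1..J}. Pr p (A h j) + Pr p (A h j)) + Pr p (U h)"
    using eventually_gt_at_top[of 0]
  proof eventually_elim
    fix h :: nat assume h: "0 < h"
    have dA: "\<exists>S. finite S \<and> determined S (A h j)" for j
      unfolding A_def by (intro exI conjI, rule finite_slab, rule determined_crossing)
    have dB: "\<exists>S. finite S \<and> determined S (B h j)" for j
      unfolding B_def by (intro exI conjI, rule finite_slab, rule determined_crossing)
    have dU: "\<exists>S. finite S \<and> determined S (U h)"
      unfolding U_def by (intro exI conjI, rule finite_slab, rule determined_disp_less)
    \<comment> \<open>\<open>None\<close> is the undershoot at the end; \<open>True\<close> and
      \<open>False\<close> mark the events excluded in \<open>up\<close> and
      \<open>low\<close>.\<close>
    define Q where "Q i = (case i of None \<Rightarrow> U h | Some (True, j) \<Rightarrow> A h j | Some (False, j) \<Rightarrow> B h j)" for i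
    have dQ: "\<exists>S. finite S \<and> determined S (Q i)" for i
      using dA dB dU by (auto simp: Q_def split: option.splits bool.splits)
    then obtain S where S: "\<And>i. finite (S i) \<and> determined (S i) (Q i)" by metis
    let ?I = "insert None (Some ` (UNIV \<times> {1..J}))"
    have B_eq: "Pr p (B h j) = Pr p (A h j)" if j: "j \<in> {1..J}" for j
    proof -
      let ?i = "int ((J - j) * h)"
      have eq: "int (j * h) + ?i = int (J * h)" using j by (simp add: algebra_simps of_nat_diff)
      have "(\<lambda>\<omega>. A h j (\<lambda>e. \<omega> (shift_edge ?i (z h j) e))) = B h j"
        unfolding A_def B_def crossing_shift eq by (simp add: add.commute)
      moreover have "Pr p (\<lambda>\<omega>. A h j (\<lambda>e. \<omega> (shift_edge ?i (z h j) e))) = Pr p (A h j)"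
        using dA[of j] Pr_reindex[OF inj_shift_edge] by blast
      ultimately show ?thesis by simp
    qed
    have "tube_fail p (\<alpha> - 1/2) (5 * int h) (int (J * h)) \<le> (\<Sum>i\<in>?I. Pr p (Q i))"
    proof (rule Pr_union_le[where S = S])
      fix \<omega> assume nt: "\<not> has_tube \<omega> (\<alpha> - 1/2) (5 * int h) (int (J * h)) 0 0"
      show "\<exists>i\<in>?I. Q i \<omega>"
      proof (rule ccontr)
        assume "\<not> ?thesis"
        then have nQ: "\<not> Q i \<omega>" if "i \<in> ?I" for i using that by blast
        have "has_tube \<omega> (\<alpha> - 1/2) (5 * int h) (int (J * h)) 0 0"
        proof (rule tube_of_grid[OF h J])
          show "\<not> crossing \<omega> 0 (int (j * h)) 0 \<lceil>\<alpha> * real (j * h) + real h\<rceil>" if "j \<in> {1..J}" for j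
            using nQ[of "Some (True, j)"] that by (simp add: Q_def A_def)
          show "\<not> crossing \<omega> (int (i * h)) (int (J * h)) \<lceil>\<alpha> * real (i * h) - 4 * real h\<rceil>
            (\<lceil>\<alpha> * real (i * h) - 4 * real h\<rceil> + \<lceil>\<alpha> * real (j * h) + real h\<rceil>)" if "i + j = J" "0 < j" for i j
          proof -
            have "J - j = i" "j \<in> {1..J}" using that by auto
            then show ?thesis using nQ[of "Some (False, j)"] by (simp add: Q_def B_def z_def)
          qed
          show "(\<alpha> - 1 / real J) * real (J * h) \<le> real (edge_disp \<omega> 0 (J * h) 0)"
            using nQ[of None] unfolding Q_def U_def by simp
        qed
        with nt show False by blast
      qed
    qed (use S in auto)
    also have "\<dots> = Pr p (U h) + (\<Sum>i\<in>UNIV \<times> {1..J}. Pr p (Q (Some i)))"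
      by (subst sum.insert) (auto simp: sum.reindex Q_def)
    also have "(\<Sum>i\<in>UNIV \<times> {1..J}. Pr p (Q (Some i))) = (\<Sum>j\<in>{1..J}. Pr p (B h j)) + (\<Sum>j\<in>{1..J}. Pr p (A h j))"
      by (simp add: Q_def sum.cartesian_product' UNIV_bool)
    also have "\<dots> = (\<Sum>j\<in>{1..J}. Pr p (A h j) + Pr p (A h j))"
      by (simp only: sum.distrib) (use B_eq in simp)
    finally show "tube_fail p (\<alpha> - 1/2) (5 * int h) (int (J * h))
      \<le> (\<Sum>j\<in>{1..J}. Pr p (A h j) + Pr p (A h j)) + Pr p (U h)" by simp
  qed
qed auto

end

text \<open>Otherwise tubes of fixed proportions would fail with probability tending to 0 as they
  grow, against the constant lower bound of \<open>tube_fail_at_pc\<close>.\<close>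

lemma critical_edge_speed:
  assumes s: "1/2 < s"
  shows "\<exists>m>0. Exp oriented_pc (\<lambda>\<omega>. edge_disp \<omega> 0 m 0) < s * real m"
proof (rule ccontr)
  assume neg: "\<not> ?thesis"
  let ?Y = "\<lambda>m. Exp oriented_pc (\<lambda>\<omega>. real (edge_disp \<omega> 0 m 0))"
  define V where "V = (\<lambda>m. ?Y m / real m) ` {0<..}"
  have "s \<le> ?Y m / real m" if "0 < m" for m
  proof -
    have "s * real m \<le> ?Y m" using neg that by (meson not_le)
    then show ?thesis using that by (simp add: field_simps)
  qed
  then have ge: "s \<le> v" if "v \<in> V" for v
    using that unfolding V_def by (elim imageE) simp
  define \<alpha> where "\<alpha> = Inf V"
  have ne: "V \<noteq> {}" by (auto simp: V_def)
  have bdd: "bdd_below V" using ge by (rule bdd_belowI)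
  have a1: "s \<le> \<alpha>" unfolding \<alpha>_def by (rule cInf_greatest[OF ne ge])
  have "?Y 1 \<le> 1"
  proof -
    have "?Y 1 \<le> Exp oriented_pc (\<lambda>_. 1)"
      using edge_disp_le[of _ 0 1 0]
      by (intro Exp_mono[OF finite_slab determined_comp[OF determined_disp] finite_slab determined_const]) auto
    then show ?thesis using Exp_const[of oriented_pc 1] by simp
  qed
  moreover have "\<alpha> \<le> ?Y 1 / real 1" unfolding \<alpha>_def by (rule cInf_lower[OF _ bdd]) (unfold V_def, rule imageI, simp)
  ultimately have a2: "\<alpha> \<le> 1" by simp
  interpret edge_speed oriented_pc \<alpha>
  proof
    show "1/2 < \<alpha>" "\<alpha> \<le> 1" using a1 a2 s by auto
    show "\<alpha> * real m \<le> ?Y m" if "0 < m" for m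
    proof -
      have "\<alpha> \<le> ?Y m / real m" unfolding \<alpha>_def by (rule cInf_lower[OF _ bdd]) (use that in \<open>auto simp: V_def\<close>)
      then show ?thesis using that by (simp add: field_simps)
    qed
    show "\<exists>m>0. ?Y m < (\<alpha> + \<epsilon>) * real m" if "0 < \<epsilon>" for \<epsilon>
    proof -
      have "Inf V < \<alpha> + \<epsilon>" using that by (simp add: \<alpha>_def)
      then obtain v where "v \<in> V" "v < \<alpha> + \<epsilon>" using cInf_lessD[OF ne] by blast
      then obtain m where "0 < m" "?Y m / real m < \<alpha> + \<epsilon>" by (auto simp: V_def)
      then show ?thesis by (intro exI[of _ m]) (auto simp: field_simps)
    qed
  qed
  define \<sigma> where "\<sigma> = \<alpha> - 1/2"
  have \<sigma>: "0 < \<sigma>" "\<sigma> \<le> 1/2" using alpha by (auto simp: \<sigma>_def)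
  \<comment> \<open>\<open>K0\<close> and \<open>M\<close> depend on \<open>\<sigma>\<close> only
    and are fixed before \<open>h\<close> grows. The constant 288 is that of
    \<open>scale_invariant\<close>; 60 = 12 * 5 belongs to the half-width \<open>5 * h\<close> with
    \<open>H = M * h\<close>.\<close>
  obtain K0 :: nat where K0: "288 / \<sigma> \<le> K0" using real_arch_simple by blast
  obtain M :: nat where M: "60 / \<sigma> \<le> M" using real_arch_simple by blast
  have K0': "288 \<le> \<sigma> * K0" using K0 \<sigma> by (simp add: field_simps)
  have K1: "1 \<le> K0" using K0' by (cases K0) auto
  have M': "60 \<le> \<sigma> * M" using M \<sigma> by (simp add: field_simps)
  have M1: "1 \<le> M" using M' by (cases M) auto
  have "(\<lambda>h. tube_fail oriented_pc \<sigma> (5 * int h) (int (2 * M * h))) \<longlonglongrightarrow> 0"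
    unfolding \<sigma>_def by (rule tube_fail_tendsto_0) (use M1 in simp)
  moreover have "\<forall>\<^sub>F h in sequentially. 1 / (256 * (real K0)\<^sup>2) \<le> tube_fail oriented_pc \<sigma> (5 * int h) (int (2 * M * h))"
    using eventually_gt_at_top[of 0]
  proof eventually_elim
    fix h :: nat assume h: "0 < h"
    have "1 / (256 * (real K0)\<^sup>2) \<le> tube_fail oriented_pc \<sigma> (5 * int h) (2 * int (M * h))"
    proof (rule tube_fail_at_pc[OF \<sigma> _ _ K0' K1])
      have "60 * real h \<le> \<sigma> * M * real h" using M' by (intro mult_right_mono) auto
      then show "12 * real_of_int (5 * int h) \<le> \<sigma> * real_of_int (int (M * h))" by simp
    qed (use h M1 in auto)
    then show "1 / (256 * (real K0)\<^sup>2) \<le> tube_fail oriented_pc \<sigma> (5 * int h) (int (2 * M * h))"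
      by (simp add: mult.assoc)
  qed
  ultimately have "1 / (256 * (real K0)\<^sup>2) \<le> 0" by (rule tendsto_lowerbound) simp
  moreover have "0 < 1 / (256 * (real K0)\<^sup>2)" using K1 by simp
  ultimately show False by linarith
qed

section \<open>From percolation to first passage times\<close>

text \<open>The mean is a finite combination of probabilities of events on finitely many edges, each
  Lipschitz in the density.\<close>

lemma Exp_disp_tendsto:
  fixes q :: "nat \<Rightarrow> real"
  assumes q: "q \<longlonglongrightarrow> p" "\<And>k. q k \<in> {0..1}" "p \<in> {0..1}"
  shows "(\<lambda>k. Exp (q k) (\<lambda>\<omega>. edge_disp \<omega> 0 m 0)) \<longlonglongrightarrow> Exp p (\<lambda>\<omega>. edge_disp \<omega> 0 m 0)"
proof -
  let ?S = "slab 0 (int m) (- int m) (int m)"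
  have d: "determined ?S (\<lambda>\<omega>. edge_disp \<omega> 0 m 0 = j)" for j
    by (rule determined_comp[OF determined_disp])
  have eq: "Exp x (\<lambda>\<omega>. edge_disp \<omega> 0 m 0) = (\<Sum>j\<le>m. real j * Pr x (\<lambda>\<omega>. edge_disp \<omega> 0 m 0 = j))" for x
  proof -
    have pt: "real (edge_disp \<omega> 0 m 0) = (\<Sum>j\<le>m. real j * of_bool (edge_disp \<omega> 0 m 0 = j))" for \<omega>
    proof -
      have "(\<Sum>j\<le>m. real j * of_bool (edge_disp \<omega> 0 m 0 = j)) = (\<Sum>j\<in>{edge_disp \<omega> 0 m 0}. real j * of_bool (edge_disp \<omega> 0 m 0 = j))"
        by (rule sum.mono_neutral_right) (auto simp: edge_disp_le)
      then show ?thesis by simp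
    qed
    have "Exp x (\<lambda>\<omega>. edge_disp \<omega> 0 m 0) = Exp x (\<lambda>\<omega>. \<Sum>j\<le>m. real j * of_bool (edge_disp \<omega> 0 m 0 = j))"
      by (intro Bochner_Integration.integral_cong refl pt)
    also have "\<dots> = (\<Sum>j\<le>m. Exp x (\<lambda>\<omega>. real j * of_bool (edge_disp \<omega> 0 m 0 = j)))"
    proof (rule Bochner_Integration.integral_sum)
      show "integrable (perc_measure x) (\<lambda>\<omega>. real j * of_bool (edge_disp \<omega> 0 m 0 = j))" for j
        by (rule integrable_determined[OF finite_slab determined_comp[OF d, of "\<lambda>b. real j * of_bool b"]])
    qed
    also have "\<dots> = (\<Sum>j\<le>m. real j * Pr x (\<lambda>\<omega>. edge_disp \<omega> 0 m 0 = j))"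
      using Exp_indicator[OF finite_slab d] by (intro sum.cong refl) simp
    finally show ?thesis .
  qed
  have "(\<lambda>k. Pr (q k) (\<lambda>\<omega>. edge_disp \<omega> 0 m 0 = j)) \<longlonglongrightarrow> Pr p (\<lambda>\<omega>. edge_disp \<omega> 0 m 0 = j)" for j
  proof (rule Lim_transform_bound[THEN LIM_zero_cancel])
    show "(\<lambda>k. card ?S * (p - q k)) \<longlonglongrightarrow> 0"
      using tendsto_mult[OF tendsto_const[of "real (card ?S)"] tendsto_diff[OF tendsto_const[of p] q(1)]] by simp
    show "\<forall>\<^sub>F k in sequentially. norm (Pr (q k) (\<lambda>\<omega>. edge_disp \<omega> 0 m 0 = j) - Pr p (\<lambda>\<omega>. edge_disp \<omega> 0 m 0 = j)) \<le> norm (card ?S * (p - q k))"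
      using Pr_Lipschitz[OF finite_slab d q(2,3)] by (intro always_eventually allI) (simp add: abs_mult)
  qed
  then show ?thesis unfolding eq by (intro tendsto_intros)
qed

section \<open>Passage times as minima over finitely many paths\<close>

lemma finite_paths: "finite {ds. path_end (0, 0) ds = v}"
proof -
  have "{ds. path_end (0, 0) ds = v} \<subseteq> {ds. set ds \<subseteq> UNIV \<and> length ds = nat (fst v + snd v)}"
    by (auto simp: path_end_walk)
  then show ?thesis by (rule finite_subset) (rule finite_lists_length_eq, simp)
qed

lemma paths_nonempty:
  assumes "0 \<le> a" "0 \<le> b"
  shows "{ds. path_end (0, 0) ds = (a, b)} \<noteq> {}"
proof -
  have "path_end (0, 0) (replicate (nat a) True @ replicate (nat b) False) = (a, b)"
    using assms by (simp add: path_end_eq)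
  then show ?thesis by blast
qed

text \<open>All paths to \<open>v\<close> have the same length, so the infimum is a minimum over a
  finite set. Nonnegative coordinates make this set nonempty, without which \<open>Inf\<close> would
  be an arbitrary value.\<close>

lemma dir_T_le_iff:
  assumes "0 \<le> fst v" "0 \<le> snd v"
  shows "dir_T t (0, 0) v \<le> x \<longleftrightarrow> (\<exists>ds. path_end (0, 0) ds = v \<and> sum_list (map t (path_edges (0, 0) ds)) \<le> x)"
proof -
  let ?D = "{ds. path_end (0, 0) ds = v}"
  have eq: "{sum_list (map t (path_edges (0, 0) ds)) | ds. path_end (0, 0) ds = v}
      = (\<lambda>ds. sum_list (map t (path_edges (0, 0) ds))) ` ?D" by auto
  have f: "finite ((\<lambda>ds. sum_list (map t (path_edges (0, 0) ds))) ` ?D)" using finite_paths by simp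
  have ne: "(\<lambda>ds. sum_list (map t (path_edges (0, 0) ds))) ` ?D \<noteq> {}"
    using paths_nonempty[OF assms] by simp
  show ?thesis
    unfolding dir_T_def eq cInf_eq_Min[OF f ne] using f ne by (simp add: Min_le_iff)
qed

lemma sets_dir_T:
  assumes "sets F = sets borel" "0 \<le> fst v" "0 \<le> snd v"
  shows "{t \<in> space (fpp_measure F). dir_T t (0, 0) v \<le> x} \<in> sets (fpp_measure F)"
proof -
  have [measurable]: "(\<lambda>t. t e) \<in> borel_measurable (fpp_measure F)" for e
  proof -
    have "(\<lambda>t. t e) \<in> fpp_measure F \<rightarrow>\<^sub>M F" unfolding fpp_measure_def by measurable
    then show ?thesis by (simp add: measurable_cong_sets[OF refl assms(1)])
  qed
  have [measurable]: "(\<lambda>t. sum_list (map t es)) \<in> borel_measurable (fpp_measure F)" for es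
    by (induction es) auto
  have "{t \<in> space (fpp_measure F). dir_T t (0, 0) v \<le> x}
      = (\<Union>ds\<in>{ds. path_end (0, 0) ds = v}. {t \<in> space (fpp_measure F). sum_list (map t (path_edges (0, 0) ds)) \<le> x})"
    using dir_T_le_iff[OF assms(2,3)] by auto
  also have "\<dots> \<in> sets (fpp_measure F)"
    by (intro sets.finite_UN finite_paths) measurable
  finally show ?thesis .
qed

text \<open>Every closed edge costs more than \<open>\<eta>\<close>, every other edge at least
  0.\<close>

lemma closed_count_walk_le:
  fixes t :: "edge \<Rightarrow> real"
  assumes t: "\<And>e. 0 \<le> t e" and eta: "0 < \<eta>"
  shows "\<eta> * closed_count (\<lambda>e. t e \<le> \<eta>) (walk ds) 0 (int (length ds)) \<le> sum_list (map t (path_edges (0, 0) ds))"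
proof -
  let ?C = "{n \<in> {0..<int (length ds)}. \<not> t (edge_at (walk ds) n) \<le> \<eta>}"
  have "\<eta> * card ?C = (\<Sum>n\<in>?C. \<eta>)" by simp
  also have "\<dots> \<le> (\<Sum>n\<in>?C. t (edge_at (walk ds) n))" by (intro sum_mono) auto
  also have "\<dots> \<le> (\<Sum>n\<in>{0..<int (length ds)}. t (edge_at (walk ds) n))"
    by (rule sum_mono2) (use t in auto)
  also have "\<dots> = (\<Sum>i<length ds. t (edge_at (walk ds) (int i)))"
    by (rule sum.reindex_bij_witness[of _ int nat]) auto
  also have "\<dots> = (\<Sum>i<length ds. map t (path_edges (0, 0) ds) ! i)"
    by (intro sum.cong refl) (simp add: path_edges_walk)
  also have "\<dots> = sum_list (map t (path_edges (0, 0) ds))"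
    by (simp add: sum_list_sum_nth atLeast0LessThan)
  finally show ?thesis by (simp add: closed_count_def)
qed

lemma closed_count_refl:
  assumes "nepath a b f"
  shows "closed_count (\<lambda>e. \<omega> (refl_edge e)) (\<lambda>n. n - f n) a b = closed_count \<omega> f a b"
proof -
  have "refl_edge (edge_at (\<lambda>n. n - f n) n) = edge_at f n" if "n \<in> {a..<b}" for n
    using that assms by (auto simp: edge_at_def refl_edge_def nepath_def)
  then show ?thesis unfolding closed_count_def by (intro arg_cong[where f = card]) auto
qed

text \<open>\<open>steep\<close> selects the reflected configuration, so that both sides of the diagonal are covered.\<close>
definition cheap_dir :: "bool \<Rightarrow> (edge \<Rightarrow> bool) \<Rightarrow> nat \<Rightarrow> real \<Rightarrow> real \<Rightarrow> bool" where
  "cheap_dir steep \<omega> n y k \<longleftrightarrow> cheap_path (if steep then (\<lambda>e. \<omega> (refl_edge e)) else \<omega>) n y k"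

lemma determined_cheap_dir:
  assumes "0 \<le> y"
  obtains S where "finite S" "determined S (\<lambda>\<omega>. cheap_dir steep \<omega> n y k)"
proof (cases steep)
  case True
  show thesis
    by (rule that[of "refl_edge ` slab 0 (int n) (- int n) (int n)"])
      (use True determined_reindex[OF determined_cheap_path[OF assms], of refl_edge n k] in
        \<open>simp_all add: cheap_dir_def\<close>)
next
  case False
  show thesis
    by (rule that[of "slab 0 (int n) (- int n) (int n)"])
      (use False determined_cheap_path[OF assms] in \<open>simp_all add: cheap_dir_def\<close>)
qed

lemma Pr_cheap_dir:
  assumes "0 \<le> y"
  shows "Pr p (\<lambda>\<omega>. cheap_dir steep \<omega> n y k) = Pr p (\<lambda>\<omega>. cheap_path \<omega> n y k)"
  using Pr_reindex[OF inj_refl_edge finite_slab determined_cheap_path[OF assms]]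
  by (cases steep) (simp_all add: cheap_dir_def)

text \<open>All paths to \<open>(a, b)\<close> have \<open>a + b\<close> edges, which fixes the
  number of levels. In the steep case reflection turns north steps into the counted east
  steps.\<close>

lemma dir_T_imp_cheap_dir:
  fixes t :: "edge \<Rightarrow> real" and y k :: real
  assumes t: "\<And>e. 0 \<le> t e" and eta: "0 < \<eta>" and v: "0 \<le> a" "0 \<le> b"
    and T: "dir_T t (0, 0) (a, b) \<le> \<eta> * k"
    and y: "y \<le> real_of_int (if steep then b else a)"
  shows "cheap_dir steep (\<lambda>e. t e \<le> \<eta>) (nat (a + b)) y k"
proof -
  obtain ds where ds: "path_end (0, 0) ds = (a, b)" "sum_list (map t (path_edges (0, 0) ds)) \<le> \<eta> * k"
    using T dir_T_le_iff[of "(a, b)" t "\<eta> * k"] v by auto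
  let ?n = "int (length ds)" and ?\<omega> = "\<lambda>e. t e \<le> \<eta>"
  have ab: "walk ds ?n = a" "?n - walk ds ?n = b" using ds(1) by (simp_all add: path_end_walk)
  then have n: "nat (a + b) = length ds" by linarith
  have "\<eta> * closed_count ?\<omega> (walk ds) 0 ?n \<le> \<eta> * k"
    using closed_count_walk_le[of t, OF t eta, where ds = ds] ds(2) by linarith
  then have cc: "closed_count ?\<omega> (walk ds) 0 ?n \<le> k" using eta by simp
  show ?thesis
  proof (cases steep)
    case True
    have "nepath 0 ?n (\<lambda>n. n - walk ds n)" using nepath_walk[of ds] by (auto simp: nepath_def)
    then show ?thesis using True y ab cc closed_count_refl[OF nepath_walk[of ds], of ?\<omega>]
      unfolding cheap_dir_def cheap_path_def n by (intro exI[of _ "\<lambda>n. n - walk ds n"]) auto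
  next
    case False
    then show ?thesis using y ab cc nepath_walk[of ds]
      unfolding cheap_dir_def cheap_path_def n by (intro exI[of _ "walk ds"]) auto
  qed
qed

lemma fpp_le_perc:
  fixes x y k \<eta> :: real
  assumes F: "prob_space F" "sets F = sets borel" "measure F {0..} = 1"
    and eta: "0 < \<eta>" and v: "0 \<le> a" "0 \<le> b" and y: "0 \<le> y" "y \<le> real_of_int (if steep then b else a)"
    and x: "x \<le> \<eta> * k"
  shows "measure (fpp_measure F) {t \<in> space (fpp_measure F). dir_T t (0, 0) (a, b) \<le> x}
    \<le> Pr (measure F {..\<eta>}) (\<lambda>\<omega>. cheap_path \<omega> (nat (a + b)) y k)"
proof -
  interpret F: prob_space F by (rule F(1))
  interpret prob_space "fpp_measure F" unfolding fpp_measure_def by (intro prob_space_PiM F(1))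
  have eta_sets: "{..\<eta>} \<in> sets F" and nn_sets: "{0..} \<in> sets F" by (simp_all add: F(2))
  \<comment> \<open>Passage times are nonnegative only almost surely, but simultaneously for the
    countably many edges; the events are therefore compared almost everywhere.\<close>
  have "AE s in F. s \<in> {0..}" using F.prob_eq_1[OF nn_sets] F(3) by simp
  then have "AE t in fpp_measure F. t e \<in> {0..}" for e
    unfolding fpp_measure_def by (intro AE_PiM_component) (auto intro: F(1))
  then have nn: "AE t in fpp_measure F. \<forall>e. 0 \<le> t e"
    by (simp add: AE_all_countable)
  let ?A = "\<lambda>\<omega>. cheap_dir steep \<omega> (nat (a + b)) y k"
  obtain S where S: "finite S" "determined S ?A" using determined_cheap_dir[OF y(1)] by blast
  note thr = Pr_threshold[OF F(1) eta_sets sets_determined[OF S], folded fpp_measure_def]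
  have "prob {t \<in> space (fpp_measure F). dir_T t (0, 0) (a, b) \<le> x}
      \<le> prob {t \<in> space (fpp_measure F). ?A (\<lambda>e. t e \<in> {..\<eta>})}"
  proof (rule finite_measure_mono_AE[OF _ thr(2)])
    show "AE t in fpp_measure F. t \<in> {t \<in> space (fpp_measure F). dir_T t (0, 0) (a, b) \<le> x} \<longrightarrow>
        t \<in> {t \<in> space (fpp_measure F). ?A (\<lambda>e. t e \<in> {..\<eta>})}"
      using nn
    proof eventually_elim
      case (elim t)
      then show ?case using dir_T_imp_cheap_dir[OF _ eta v _ y(2), of t k] x by auto
    qed
  qed
  also have "\<dots> = Pr (measure F {..\<eta>}) ?A" using thr(1) by simp
  finally show ?thesis by (simp add: Pr_cheap_dir[OF y(1)])
qed

section \<open>Directions, thresholds and the conclusion\<close>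

lemma direction_ratio:
  fixes \<theta> :: real
  assumes "0 \<le> \<theta>" "\<theta> \<le> pi / 2" "\<theta> \<noteq> pi / 4"
  shows "1 \<le> cos \<theta> + sin \<theta>" "cos \<theta> + sin \<theta> < 2 * max (cos \<theta>) (sin \<theta>)"
    "0 \<le> cos \<theta>" "0 \<le> sin \<theta>"
proof -
  show c: "0 \<le> cos \<theta>" using assms by (intro cos_ge_zero) auto
  show s: "0 \<le> sin \<theta>" using assms pi_gt_zero by (intro sin_ge_zero) auto
  \<comment> \<open>The square is 1 + 2 sin \<theta> cos \<theta>.\<close>
  have "1 \<le> (cos \<theta> + sin \<theta>)\<^sup>2"
    using c s sin_cos_squared_add2[of \<theta>] by (simp add: power2_sum)
  then show "1 \<le> cos \<theta> + sin \<theta>" using c s by (intro power2_le_imp_le[of 1 "cos \<theta> + sin \<theta>"]) simp_all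
  \<comment> \<open>Injectivity of the cosine on [0, pi] turns equality into \<theta> = pi/4, the
    excluded direction.\<close>
  have "cos \<theta> \<noteq> sin \<theta>"
  proof
    assume "cos \<theta> = sin \<theta>"
    then have "cos \<theta> = cos (pi / 2 - \<theta>)" by (simp add: cos_sin_eq[symmetric] sin_cos_eq)
    moreover have "0 \<le> \<theta>" "\<theta> \<le> pi" "0 \<le> pi / 2 - \<theta>" "pi / 2 - \<theta> \<le> pi"
      using assms pi_gt_zero by linarith+
    ultimately have "\<theta> = pi / 2 - \<theta>" using cos_inj_pi by blast
    then show False using assms by simp
  qed
  then show "cos \<theta> + sin \<theta> < 2 * max (cos \<theta>) (sin \<theta>)" by (auto simp: max_def)
qed

text \<open>As \<eta> decreases to 0, the density of edges with \<open>t e \<le> \<eta>\<close>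
  decreases to \<open>measure F {..0}\<close>, and a strict inequality for the mean over one block
  persists.\<close>

lemma critical_threshold:
  assumes F: "prob_space F" "sets F = sets borel" "measure F {..0} = oriented_pc" and s: "1/2 < s"
  obtains \<eta> :: real and M :: nat where "0 < \<eta>" "0 < M" "Exp (measure F {..\<eta>}) (\<lambda>\<omega>. edge_disp \<omega> 0 M 0) < s * real M"
proof -
  interpret F: prob_space F by (rule F(1))
  obtain M where M: "0 < M" "Exp oriented_pc (\<lambda>\<omega>. edge_disp \<omega> 0 M 0) < s * real M"
    using critical_edge_speed[OF s] by blast
  define q where "q k = measure F {..1 / (real k + 1)}" for k
  have "(\<lambda>k. measure F {..1 / (real k + 1)}) \<longlonglongrightarrow> measure F (\<Inter>k. {..1 / (real k + 1)})"
  proof (rule F.finite_Lim_measure_decseq)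
    show "decseq (\<lambda>k. {..1 / (real k + 1)})"
      by (rule decseq_SucI) (auto elim!: order.trans simp: field_simps)
  qed (auto simp: F(2))
  moreover have "(\<Inter>k. {..1 / (real k + 1)}) = {..0::real}"
  proof (intro equalityI subsetI)
    fix x :: real assume x: "x \<in> (\<Inter>k. {..1 / (real k + 1)})"
    have "(\<lambda>k. 1 / (real k + 1)) \<longlonglongrightarrow> 0" by real_asymp
    then have "x \<le> 0" by (rule LIMSEQ_le_const) (use x in auto)
    then show "x \<in> {..0}" by simp
  qed (auto intro: order.trans)
  ultimately have "q \<longlonglongrightarrow> oriented_pc" by (simp add: q_def[abs_def] F(3))
  then have "(\<lambda>k. Exp (q k) (\<lambda>\<omega>. edge_disp \<omega> 0 M 0)) \<longlonglongrightarrow> Exp oriented_pc (\<lambda>\<omega>. edge_disp \<omega> 0 M 0)"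
    by (rule Exp_disp_tendsto) (use oriented_pc_bounds in \<open>simp_all add: q_def\<close>)
  from order_tendstoD(2)[OF this M(2)] obtain k where "Exp (q k) (\<lambda>\<omega>. edge_disp \<omega> 0 M 0) < s * real M"
    by (auto simp: eventually_sequentially)
  then show thesis using that[of "1 / (real k + 1)" M] M(1) by (simp add: q_def)
qed

theorem theorem4:
  fixes F :: "real measure" and \<theta> :: real
  assumes "prob_space F"
    and "sets F = sets borel"
    and "measure F {0..} = 1"
    and "measure F {..0} = oriented_pc"
    and "0 \<le> \<theta>" and "\<theta> \<le> pi / 2" and "\<theta> \<noteq> pi / 4"
  shows "\<exists>\<delta> > 0. \<exists>C1 > 0. \<exists>C2 > 0. \<forall>r > 0.
           {t \<in> space (fpp_measure F). dir_T_pt t (polar r \<theta>) \<le> \<delta> * r} \<in> sets (fpp_measure F) \<and>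
           measure (fpp_measure F) {t \<in> space (fpp_measure F). dir_T_pt t (polar r \<theta>) \<le> \<delta> * r}
             \<le> C1 * exp (- C2 * r)"
proof -
  note dir = direction_ratio[OF assms(5-7)]
  define S where "S = cos \<theta> + sin \<theta>"
  define M where "M = max (cos \<theta>) (sin \<theta>)"
  define steep where "steep \<longleftrightarrow> cos \<theta> < sin \<theta>"
  \<comment> \<open>\<open>M / S\<close> is the asymptotic share of steps in the dominant direction,
    above 1/2 off the diagonal. The midpoint leaves room on both sides.\<close>
  define s where "s = (1/2 + M / S) / 2"
  have S1: "1 \<le> S" and SM: "S < 2 * M" using dir by (auto simp: S_def M_def)
  have "M \<le> S" using dir by (auto simp: S_def M_def)
  then have MS: "1/2 < M / S" "M / S \<le> 1" using S1 SM by (auto simp: field_simps)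
  define x where "x = M / S"
  have s: "1/2 < s" "s \<le> 1" "s < M / S" using MS unfolding s_def x_def[symmetric] by auto
  have s0: "0 \<le> s" using s by simp
  \<comment> \<open>The surplus over slope \<open>s\<close> per unit of \<open>r\<close>; for
    \<open>r \<ge> 2 / g\<close> it absorbs the rounding to a vertex.\<close>
  define g where "g = M - s * S"
  have g: "0 < g" using s(3) S1 by (simp add: g_def field_simps)
  obtain \<eta> :: real and m where eta: "0 < \<eta>" and m: "0 < m"
      "Exp (measure F {..\<eta>}) (\<lambda>\<omega>. edge_disp \<omega> 0 m 0) < s * real m"
    using critical_threshold[OF assms(1,2,4) s(1)] by blast
  obtain C c \<delta>' :: real where C: "0 < C" "0 < c" "0 < \<delta>'"
    "\<And>n. Pr (measure F {..\<eta>}) (\<lambda>\<omega>. cheap_path \<omega> n (s * real n) (\<delta>' * real n)) \<le> C * exp (- c * real n)"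
    using cheap_path_decay[OF m(1) s0 m(2)] by blast
  define r0 where "r0 = max 2 (2 / g)"
  \<comment> \<open>The factor 1/2 comes from \<open>r / 2 \<le> real n\<close>, valid for
    \<open>r \<ge> 2\<close>.\<close>
  define \<delta> where "\<delta> = \<eta> * \<delta>' / 2"
  \<comment> \<open>The second summand makes the bound at least 1 for \<open>r < r0\<close>.\<close>
  define C1 where "C1 = C + exp (c / 2 * r0)"
  have main: "{t \<in> space (fpp_measure F). dir_T_pt t (polar r \<theta>) \<le> \<delta> * r} \<in> sets (fpp_measure F) \<and>
      measure (fpp_measure F) {t \<in> space (fpp_measure F). dir_T_pt t (polar r \<theta>) \<le> \<delta> * r} \<le> C1 * exp (- (c / 2) * r)"
    if r: "0 < r" for r
  proof
    define a where "a = round (r * cos \<theta>)"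
    define b where "b = round (r * sin \<theta>)"
    have T: "dir_T_pt t (polar r \<theta>) = dir_T t (0, 0) (a, b)" for t
      by (simp add: dir_T_pt_def polar_def nearest_vertex_def a_def b_def)
    have ab: "\<bar>real_of_int a - r * cos \<theta>\<bar> \<le> 1/2" "\<bar>real_of_int b - r * sin \<theta>\<bar> \<le> 1/2"
      unfolding a_def b_def using of_int_round_abs_le by blast+
    have "0 \<le> r * cos \<theta>" "0 \<le> r * sin \<theta>" using r dir by auto
    then have v: "0 \<le> a" "0 \<le> b" using ab by linarith+
    show "{t \<in> space (fpp_measure F). dir_T_pt t (polar r \<theta>) \<le> \<delta> * r} \<in> sets (fpp_measure F)"
      unfolding T using sets_dir_T[OF assms(2), of "(a, b)"] v by simp
    show "measure (fpp_measure F) {t \<in> space (fpp_measure F). dir_T_pt t (polar r \<theta>) \<le> \<delta> * r} \<le> C1 * exp (- (c / 2) * r)"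
    proof (cases "r0 \<le> r")
      case True
      define n where "n = nat (a + b)"
      have n: "real n = real_of_int a + real_of_int b" using v by (simp add: n_def)
      have rS: "r * cos \<theta> + r * sin \<theta> = r * S" by (simp add: S_def algebra_simps)
      have nS: "real n \<le> r * S + 1" "r * S - 1 \<le> real n" using ab n rS by linarith+
      have "r \<le> r * S" using S1 r by simp
      moreover have "2 \<le> r" using True by (simp add: r0_def)
      ultimately have nr: "r / 2 \<le> real n" using nS by linarith
      have "s * real n \<le> s * (r * S + 1)" using nS s by (intro mult_left_mono) auto
      also have "\<dots> \<le> r * M - 1/2"
      proof -
        have "2 / g \<le> r" using True by (simp add: r0_def)
        then have "2 \<le> r * g" using g by (simp add: field_simps)
        then show ?thesis using s by (simp add: g_def algebra_simps)
      qed
      also have "\<dots> \<le> real_of_int (if steep then b else a)"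
      proof (cases steep)
        case True
        then have "M = sin \<theta>" by (simp add: steep_def M_def)
        moreover have "r * sin \<theta> - 1/2 \<le> real_of_int b" using ab(2) by linarith
        ultimately show ?thesis using True by simp
      next
        case False
        then have "M = cos \<theta>" by (simp add: steep_def M_def)
        moreover have "r * cos \<theta> - 1/2 \<le> real_of_int a" using ab(1) by linarith
        ultimately show ?thesis using False by simp
      qed
      finally have y: "s * real n \<le> real_of_int (if steep then b else a)" .
      have "\<delta> * r \<le> \<eta> * (\<delta>' * real n)"
      proof -
        have "\<eta> * \<delta>' * (r / 2) \<le> \<eta> * \<delta>' * real n" using nr eta C(3) by (intro mult_left_mono) auto
        then show ?thesis by (simp add: \<delta>_def algebra_simps)
      qed
      from fpp_le_perc[OF assms(1-3) eta v _ y this]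
      have "measure (fpp_measure F) {t \<in> space (fpp_measure F). dir_T t (0, 0) (a, b) \<le> \<delta> * r}
          \<le> Pr (measure F {..\<eta>}) (\<lambda>\<omega>. cheap_path \<omega> n (s * real n) (\<delta>' * real n))"
        using s by (simp add: n_def)
      also have "\<dots> \<le> C * exp (- c * real n)" by (rule C(4))
      also have "\<dots> \<le> C1 * exp (- (c / 2) * r)"
      proof (rule mult_mono)
        have "c * (r / 2) \<le> c * real n" using nr C(2) by (intro mult_left_mono) auto
        then show "exp (- c * real n) \<le> exp (- (c / 2) * r)" by simp
      qed (use C(1) in \<open>auto simp: C1_def\<close>)
      finally show ?thesis unfolding T .
    next
      case False
      have "prob_space (fpp_measure F)" unfolding fpp_measure_def by (intro prob_space_PiM assms(1))
      then have "measure (fpp_measure F) {t \<in> space (fpp_measure F). dir_T_pt t (polar r \<theta>) \<le> \<delta> * r} \<le> 1"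
        by (rule prob_space.prob_le_1)
      also have "1 \<le> exp (c / 2 * r0) * exp (- (c / 2) * r)"
      proof -
        have "0 \<le> c / 2 * (r0 - r)" using False C(2) by simp
        then have "1 \<le> exp (c / 2 * (r0 - r))" by simp
        also have "\<dots> = exp (c / 2 * r0) * exp (- (c / 2) * r)" by (simp add: exp_add[symmetric] field_simps)
        finally show ?thesis .
      qed
      also have "\<dots> \<le> C1 * exp (- (c / 2) * r)" using C(1) by (intro mult_right_mono) (auto simp: C1_def)
      finally show ?thesis .
    qed
  qed
  have "0 < \<delta>" "0 < C1" "0 < c / 2" using eta C by (auto simp: \<delta>_def C1_def intro: add_pos_pos)
  then show ?thesis using main by blast
qed

end
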